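(* Let $G$ be a group with a length function $\ell$, and let $H=F(a,b)/L$ be the group obtained from $G$ by the construction described in the context, with $G$ identified with $\gamma(G)\le H$. (1) If $g_1,\dots,g_n\in G$ and the equation $\prod_{i=1}^n x_ig_ix_i^{-1}=1$ has a solution $x_1,\dots,x_n\in H$, then it has a solution $x_1,\dots,x_n\in G$. (2) If $n\ge 1$, $(g_1,\dots,g_n)$ is a reluctant family in $G$, and $x_1,\dots,x_n\in H$ satisfy $\prod_{i=1}^n x_ig_ix_i^{-1}=1$ in $H$, then all the elements $x_1,\dots,x_n$ belong to a single left coset $hG$ of $G$ in $H$.
   Context: A length function on a group $G$ is a function $\ell:G\to\mathbb{N}=\{0,1,\dots\}$ with $\ell(g)=\ell(g^{-1})$, $\ell(g)=0$ iff $g=1$, $\ell(gh)\le \ell(g)+\ell(h)$, and such that for some constant $c>0$, $\#\{g\in G:\ell(g)\le r\}\le c^r$ for all $r\in\mathbb{N}$. Words are over the group alphabet $\{a^{\pm1},b^{\pm1}\}$; $|W|$ is the length of a word $W$, and $U\equiv V$ means letter-by-letter equality. A word over $\{a,b\}$ (no inverses) is positive. A reduced word is $s$-aperiodic if it contains no subword of the form $Y^s$ with $Y$ non-empty. A set $\mathcal Y$ of words is exponential if there are constants $C$ and $c>1$ such that $\#\{Y\in\mathcal Y: |Y|\le i\}\ge c^i$ for all $i\ge C$. Construction: Let $\mathcal Y$ be an exponential set of positive words over $\{a,b\}$ such that ( * ) whenever $V$ is a subword of some $W\in\mathcal Y$ with $|V|\ge 0.01|W|$, then $V$ occurs in $W$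 as a subword only once, and if $V$ is also a subword of some $U\in\mathcal Y$ then $U\equiv W$; and ( ** ) every word of $\mathcal Y$ is $7$-aperiodic. Fix a constant $d$ and an injective assignment $g\mapsto X_g\in\mathcal Y$ ($g\in G\setminus\{1\}$) with $\ell(g)\le |X_g|<d\,\ell(g)$. Let $F_G$ be the free group with basis $\{x_g\}_{g\in G\setminus\{1\}}$, $\varepsilon:F_G\to G$ the epimorphism $x_g\mapsto g$, $N=\ker\varepsilon$, $\beta:F_G\to F(a,b)$ the homomorphism $x_g\mapsto X_g$, $L$ the normal closure of $\beta(N)$ in the free group $F(a,b)$, and $H=F(a,b)/L$. The homomorphism $\gamma:G\to H$ given by $\gamma(\varepsilon(w))=\beta(w)L$ is well defined and injective, and $G$ is identified with $\gamma(G)\le H$. A family $(g_1,\dots,g_n)$ of elements of $G$ is reluctant in $G$ if there is no subfamily $(g_{i_1},\dots,g_{i_m})$ with $1\le i_1<\dots<i_m\le n$ and $m\in\{1,\dots,n-1\}$ such that the product of conjugacy classes $\prod_{j=1}^m g_{i_j}^G$ (in $G$) contains $1$. *)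

theory Defs
  imports "HOL-Algebra.Algebra" "HOL-Library.Sublist"
begin

definition length_function :: "('g, 'm) monoid_scheme \<Rightarrow> ('g \<Rightarrow> nat) \<Rightarrow> bool" where
  "length_function G len \<longleftrightarrow>
     (\<forall>g\<in>carrier G. len g = len (inv\<^bsub>G\<^esub> g)) \<and>
     (\<forall>g\<in>carrier G. len g = 0 \<longleftrightarrow> g = \<one>\<^bsub>G\<^esub>) \<and>
     (\<forall>g\<in>carrier G. \<forall>h\<in>carrier G. len (g \<otimes>\<^bsub>G\<^esub> h) \<le> len g + len h) \<and>
     (\<exists>c::real. c > 0 \<and> (\<forall>r::nat. finite {g\<in>carrier G. len g \<le> r}
                                 \<and> real (card {g\<in>carrier G. len g \<le> r}) \<le> c ^ r))"

text \<open>A letter is a pair (generator, inverted-flag); (x, False) is x, (x, True) is x^-1.\<close>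

definition inv_letter :: "'a \<times> bool \<Rightarrow> 'a \<times> bool" where
  "inv_letter l = (fst l, \<not> snd l)"

definition inv_word :: "('a \<times> bool) list \<Rightarrow> ('a \<times> bool) list" where
  "inv_word w = rev (map inv_letter w)"

definition reduced :: "('a \<times> bool) list \<Rightarrow> bool" where
  "reduced w \<longleftrightarrow> (\<forall>i. Suc i < length w \<longrightarrow> w ! Suc i \<noteq> inv_letter (w ! i))"

fun red :: "('a \<times> bool) list \<Rightarrow> ('a \<times> bool) list" where
  "red [] = []"
| "red (l # w) = (case red w of [] \<Rightarrow> [l]
                   | m # w' \<Rightarrow> (if m = inv_letter l then w' else l # m # w'))"

definition free_grp :: "'a set \<Rightarrow> ('a \<times> bool) list monoid" where
  "free_grp S = \<lparr>carrier = {w. reduced w \<and> fst ` set w \<subseteq> S},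
                 monoid.mult = (\<lambda>u v. red (u @ v)), monoid.one = []\<rparr>"

definition normal_closure :: "('a, 'm) monoid_scheme \<Rightarrow> 'a set \<Rightarrow> 'a set" where
  "normal_closure F S = \<Inter> {K. K \<lhd> F \<and> S \<subseteq> K}"

datatype ab = A | B

type_synonym abword = "(ab \<times> bool) list"

definition positive :: "abword \<Rightarrow> bool" where
  "positive w \<longleftrightarrow> (\<forall>l\<in>set w. snd l = False)"

definition aperiodic :: "nat \<Rightarrow> abword \<Rightarrow> bool" where
  "aperiodic s w \<longleftrightarrow> reduced w \<and> \<not> (\<exists>Y. Y \<noteq> [] \<and> sublist (concat (replicate s Y)) w)"

definition exponential :: "abword set \<Rightarrow> bool" where
  "exponential Ys \<longleftrightarrow> (\<exists>(C::nat) (c::real). c > 1 \<and>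
      (\<forall>i\<ge>C. real (card {Y\<in>Ys. length Y \<le> i}) \<ge> c ^ i))"

definition occurrences :: "'a list \<Rightarrow> 'a list \<Rightarrow> nat" where
  "occurrences V W = card {i. i + length V \<le> length W \<and> take (length V) (drop i W) = V}"

definition small_overlap :: "abword set \<Rightarrow> bool" where
  "small_overlap Ys \<longleftrightarrow> (\<forall>W\<in>Ys. \<forall>V. sublist V W \<and> real (length V) \<ge> 0.01 * real (length W) \<longrightarrow>
       occurrences V W = 1 \<and> (\<forall>U\<in>Ys. sublist V U \<longrightarrow> U = W))"

definition Fab :: "(ab \<times> bool) list monoid" where
  "Fab = free_grp (UNIV :: ab set)"

definition FG :: "('g, 'm) monoid_scheme \<Rightarrow> ('g \<times> bool) list monoid" where
  "FG G = free_grp (carrier G - {\<one>\<^bsub>G\<^esub>})"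

definition eps :: "('g, 'm) monoid_scheme \<Rightarrow> ('g \<times> bool) list \<Rightarrow> 'g" where
  "eps G w = foldr (\<lambda>l acc. (if snd l then inv\<^bsub>G\<^esub> (fst l) else fst l) \<otimes>\<^bsub>G\<^esub> acc) w \<one>\<^bsub>G\<^esub>"

definition beta :: "('g \<Rightarrow> abword) \<Rightarrow> ('g \<times> bool) list \<Rightarrow> abword" where
  "beta Xw w = red (concat (map (\<lambda>l. if snd l then inv_word (Xw (fst l)) else Xw (fst l)) w))"

definition Lgrp :: "('g, 'm) monoid_scheme \<Rightarrow> ('g \<Rightarrow> abword) \<Rightarrow> abword set" where
  "Lgrp G Xw = normal_closure Fab (beta Xw ` kernel (FG G) G (eps G))"

definition Hgrp :: "('g, 'm) monoid_scheme \<Rightarrow> ('g \<Rightarrow> abword) \<Rightarrow> abword set monoid" where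
  "Hgrp G Xw = Fab Mod Lgrp G Xw"

text \<open>gamma : G -> H, gamma(eps w) = beta(w) L.\<close>
definition gamma :: "('g, 'm) monoid_scheme \<Rightarrow> ('g \<Rightarrow> abword) \<Rightarrow> 'g \<Rightarrow> abword set" where
  "gamma G Xw g = Lgrp G Xw #>\<^bsub>Fab\<^esub> beta Xw (SOME w. w \<in> carrier (FG G) \<and> eps G w = g)"

definition conj_prod :: "('a, 'm) monoid_scheme \<Rightarrow> 'a list \<Rightarrow> 'a list \<Rightarrow> 'a" where
  "conj_prod M xs gs = foldr (\<lambda>(x, g) acc. (x \<otimes>\<^bsub>M\<^esub> g \<otimes>\<^bsub>M\<^esub> inv\<^bsub>M\<^esub> x) \<otimes>\<^bsub>M\<^esub> acc) (zip xs gs) \<one>\<^bsub>M\<^esub>"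

definition conj_class :: "('a, 'm) monoid_scheme \<Rightarrow> 'a \<Rightarrow> 'a set" where
  "conj_class G g = {x \<otimes>\<^bsub>G\<^esub> g \<otimes>\<^bsub>G\<^esub> inv\<^bsub>G\<^esub> x | x. x \<in> carrier G}"

definition set_prod :: "('a, 'm) monoid_scheme \<Rightarrow> 'a set list \<Rightarrow> 'a set" where
  "set_prod G As = foldr (\<lambda>A B. A <#>\<^bsub>G\<^esub> B) As {\<one>\<^bsub>G\<^esub>}"

definition reluctant :: "('a, 'm) monoid_scheme \<Rightarrow> 'a list \<Rightarrow> bool" where
  "reluctant G gs \<longleftrightarrow> \<not> (\<exists>I. I \<subseteq> {..<length gs} \<and> 1 \<le> card I \<and> card I \<le> length gs - 1 \<and>
       \<one>\<^bsub>G\<^esub> \<in> set_prod G (map (conj_class G) (nths gs I)))"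

end

theory Submission
  imports Defs
begin

text \<open>The group K = F(a,b) acts on its Cayley tree. Long overlaps between words of the family are excluded by the
  small overlap condition, so the reduced form of beta(w) keeps at least 98 percent of every factor of w, and the
  convex hull C of the orbit of 1 under F = beta(F_G), a union of translates of the paths of the words X_g, meets
  its translate vC with v outside F in a set that contains less than a small fixed fraction of each of these paths.
  Starting from {1}, a convex set is repeatedly enlarged by all the translates of C that it meets; a ping-pong
  argument in the tree shows that these translates are arranged like a tree, and in the limit the normal closure of
  F in K turns out to be the free product of the conjugates of F by representatives r of some set of double cosets.
  Dividing by the relators maps this normal closure onto a free product M of copies of G indexed by r.

  An equation with conjugates of elements of G in H lifts to an equation
  l_1 g_1 l_1^-1 ... l_n g_n l_n^-1 = 1 in M, with every g_k in one of the factors. For a set Omega of Bass--Serre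
  vertices (left cosets of factors), deleting from a normal form all syllables at vertices outside Omega is a cocycle
  on M, hence a homomorphism on the stabilizer of Omega. Taking for Omega all cosets of one factor gives solutions in G.
  For a reluctant family, take the orbit Omega of one vertex l_1 G under the group Gamma generated by the factors of
  the equation: the resulting trivial product in G involves the g_k with l_k G in Omega, hence all of them. Then Gamma
  is killed by deleting the syllables at Omega, and comparing syllables shows that Omega is a single vertex.\<close>

section \<open>The Cayley tree of a free group\<close>

text \<open>The words X_g have unbounded lengths, so no absolute bound on overlaps is available;
  smallness is measured on each basic segment relative to the length of that segment. The tightest
  inequality is displacement. A nontrivial element of F may push a point of C to the same place on
  the next copy of a single X_g. The path then covers two partial segments whose lengths add up to
  one full segment, so only half a segment, 12.5 of 25 units, is guaranteed. Of these, 11 are used.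
  Positivity takes care of a word against the inverse of another one, about which the overlap
  condition says nothing: no letter cancels in X_g X_h, and a common stretch of two paths is read in
  the same direction in both. The freeness obtained concerns F, not the relators. Since every
  relator lies in F, the quotient of the free product of the conjugates of F can be formed factor by
  factor, and each factor becomes G because beta is injective. This makes normal forms available
  although H itself is given only as a quotient.\<close>

lemma inv_letter_inv [simp]: "inv_letter (inv_letter l) = l"
  by (simp add: inv_letter_def)

lemma inv_letter_neq [simp]: "inv_letter l \<noteq> l" "l \<noteq> inv_letter l"
  by (auto simp: inv_letter_def prod_eq_iff)

lemma inv_letter_eq_iff [simp]: "inv_letter l = inv_letter m \<longleftrightarrow> l = m"
  by (metis inv_letter_inv)

lemma inv_word_Nil [simp]: "inv_word [] = []"
  and inv_word_Cons: "inv_word (l # w) = inv_word w @ [inv_letter l]"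
  and inv_word_append [simp]: "inv_word (u @ v) = inv_word v @ inv_word u"
  and inv_word_inv [simp]: "inv_word (inv_word w) = w"
  and length_inv_word [simp]: "length (inv_word w) = length w"
  by (auto simp: inv_word_def rev_map o_def)

lemma reduced_Nil [simp]: "reduced []"
  and reduced_singleton [simp]: "reduced [l]"
  by (auto simp: reduced_def)

lemma reduced_Cons2 [simp]: "reduced (l # m # w) \<longleftrightarrow> m \<noteq> inv_letter l \<and> reduced (m # w)"
proof
  assume r: "reduced (l # m # w)"
  have "m \<noteq> inv_letter l" using r unfolding reduced_def by (metis Suc_less_eq length_Cons nth_Cons_0 nth_Cons_Suc zero_less_Suc)
  moreover have "reduced (m # w)" unfolding reduced_def
  proof (intro allI impI)
    fix i assume "Suc i < length (m # w)"
    thus "(m # w) ! Suc i \<noteq> inv_letter ((m # w) ! i)"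
      using r unfolding reduced_def by (metis Suc_less_eq length_Cons nth_Cons_Suc)
  qed
  ultimately show "m \<noteq> inv_letter l \<and> reduced (m # w)" by simp
next
  assume r: "m \<noteq> inv_letter l \<and> reduced (m # w)"
  show "reduced (l # m # w)" unfolding reduced_def
  proof (intro allI impI)
    fix i assume "Suc i < length (l # m # w)"
    thus "(l # m # w) ! Suc i \<noteq> inv_letter ((l # m # w) ! i)"
      using r unfolding reduced_def by (cases i) auto
  qed
qed

lemma reduced_ConsD: "reduced (l # w) \<Longrightarrow> reduced w"
  by (cases w) auto

lemma reduced_appendD: "reduced (u @ v) \<Longrightarrow> reduced u \<and> reduced v"
proof (induction u)
  case (Cons l u)
  thus ?case by (cases u) (auto dest: reduced_ConsD)
qed simp

lemma reduced_append:
  "reduced (u @ v) \<longleftrightarrow> reduced u \<and> reduced v \<and> (u \<noteq> [] \<longrightarrow> v \<noteq> [] \<longrightarrow> hd v \<noteq> inv_letter (last u))"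
proof (induction u)
  case (Cons l u)
  show ?case
  proof (cases u)
    case Nil
    thus ?thesis by (cases v) auto
  next
    case (Cons m u')
    thus ?thesis using Cons.IH by auto
  qed
qed simp

lemma reduced_inv_word [simp]: "reduced (inv_word w) \<longleftrightarrow> reduced w"
proof -
  have *: "reduced w \<Longrightarrow> reduced (inv_word w)" for w :: "('a \<times> bool) list"
  proof (induction w)
    case (Cons l w)
    hence "reduced (inv_word w)" by (auto dest: reduced_ConsD)
    thus ?case using Cons.prems
      by (cases w) (auto simp: inv_word_Cons reduced_append)
  qed simp
  show ?thesis using * by (metis inv_word_inv)
qed

text \<open>One step of \<open>red\<close> as a map of its own: on reduced words
  \<open>cons_red l\<close> and \<open>cons_red (inv_letter l)\<close> are mutually inverse, so the
  letters act by permutations.\<close>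

definition cons_red :: "'a \<times> bool \<Rightarrow> ('a \<times> bool) list \<Rightarrow> ('a \<times> bool) list" where
  "cons_red l w = (case w of [] \<Rightarrow> [l] | m # w' \<Rightarrow> if m = inv_letter l then w' else l # w)"

lemma red_Cons: "red (l # w) = cons_red l (red w)"
  by (simp add: cons_red_def split: list.splits)

declare red.simps(2) [simp del]

lemma reduced_cons_red: "reduced w \<Longrightarrow> reduced (cons_red l w)"
  by (auto simp: cons_red_def split: list.splits dest: reduced_ConsD)

lemma reduced_red [simp]: "reduced (red w)"
  by (induction w) (auto simp: red_Cons reduced_cons_red)

lemma red_reduced: "reduced w \<Longrightarrow> red w = w"
proof (induction w)
  case (Cons l w)
  hence "red w = w" by (auto dest: reduced_ConsD)
  thus ?case using Cons.prems by (cases w) (auto simp: red_Cons cons_red_def)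
qed simp

lemma red_red [simp]: "red (red w) = red w"
  by (rule red_reduced) simp

lemma cons_red_inv [simp]: "reduced w \<Longrightarrow> cons_red l (cons_red (inv_letter l) w) = w"
  by (cases w; cases "tl w") (auto simp: cons_red_def)

lemma red_append: "red (u @ v) = foldr cons_red u (red v)"
  by (induction u) (auto simp: red_Cons)

lemma reduced_foldr_cons_red: "reduced w \<Longrightarrow> reduced (foldr cons_red u w)"
  by (induction u) (auto simp: reduced_cons_red)

text \<open>Van der Waerden's argument: cancelling an inverse pair does not change the permutation
  by which a word acts on reduced words. Associativity of the free group follows.\<close>

lemma foldr_cons_red_red: "reduced w \<Longrightarrow> foldr cons_red (red u) w = foldr cons_red u w"
proof (induction u)
  case (Cons l u)
  note IH = Cons.IH[OF Cons.prems]
  show ?case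
  proof (cases "red u")
    case Nil
    thus ?thesis using IH by (simp add: red_Cons) (simp add: cons_red_def)
  next
    case (Cons m u')
    show ?thesis
    proof (cases "m = inv_letter l")
      case True
      have "foldr cons_red u w = cons_red (inv_letter l) (foldr cons_red u' w)"
        using IH Cons True by simp
      hence "cons_red l (foldr cons_red u w) = foldr cons_red u' w"
        using \<open>reduced w\<close> by (simp add: reduced_foldr_cons_red)
      moreover have "red (l # u) = u'" using Cons True by (simp add: red_Cons) (simp add: cons_red_def)
      ultimately show ?thesis by simp
    next
      case False
      hence "red (l # u) = l # m # u'" using Cons by (simp add: red_Cons) (simp add: cons_red_def)
      thus ?thesis using IH Cons by simp
    qed
  qed
qed simp

lemma red_append_red: "red (red u @ v) = red (u @ v)" "red (u @ red v) = red (u @ v)"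
  by (simp_all add: red_append foldr_cons_red_red)

lemma red_inv_cancel: "red (inv_word u @ u @ v) = red v"
proof (induction u arbitrary: v)
  case (Cons l u)
  have "red (inv_word (l # u) @ (l # u) @ v) = red (inv_word u @ red (inv_letter l # l # u @ v))"
    by (simp add: inv_word_Cons red_append_red)
  also have "red (inv_letter l # l # u @ v) = red (u @ v)"
    using cons_red_inv[of "red (u @ v)" "inv_letter l"] by (simp add: red_Cons)
  finally show ?case using Cons by (simp add: red_append_red)
qed simp

typedef 'a fg = "{w :: ('a \<times> bool) list. reduced w}"
  morphisms word Fg by (rule exI[of _ "[]"]) simp

setup_lifting type_definition_fg

lemma reduced_word [simp]: "reduced (word x)"
  using word by auto

instantiation fg :: (type) group_add
begin
lift_definition zero_fg :: "'a fg" is "[]" by simp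
lift_definition plus_fg :: "'a fg \<Rightarrow> 'a fg \<Rightarrow> 'a fg" is "\<lambda>u v. red (u @ v)" by simp
lift_definition uminus_fg :: "'a fg \<Rightarrow> 'a fg" is inv_word by simp
definition minus_fg :: "'a fg \<Rightarrow> 'a fg \<Rightarrow> 'a fg" where "minus_fg x y = x + - y"
instance
proof
  fix x y z :: "'a fg"
  show "x + y + z = x + (y + z)" by transfer (simp add: red_append_red)
  show "0 + x = x" by transfer (simp add: red_reduced)
  show "x + 0 = x" by transfer (simp add: red_reduced)
  show "- x + x = 0" by transfer (use red_inv_cancel[of _ "[]"] in simp)
  show "x + - y = x - y" by (simp add: minus_fg_def)
qed
end

lemma word_0 [simp]: "word 0 = []" by transfer simp
lemma word_plus: "word (x + y) = red (word x @ word y)" by transfer simp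
lemma word_uminus: "word (- x) = inv_word (word x)" by transfer simp

section \<open>The word metric\<close>

definition nrm :: "'a fg \<Rightarrow> nat" where "nrm x = length (word x)"
definition dst :: "'a fg \<Rightarrow> 'a fg \<Rightarrow> nat" where "dst x y = nrm (- x + y)"

lemma word_diff:
  assumes "word x = c @ u" "word y = c @ v" "u = [] \<or> v = [] \<or> hd u \<noteq> hd v"
  shows "word (- x + y) = inv_word u @ v"
proof -
  have r: "reduced u" "reduced v" using assms(1,2) reduced_appendD by (metis reduced_word)+
  have "word (- x + y) = red (inv_word u @ inv_word c @ c @ v)"
    by (simp add: word_plus word_uminus assms)
  also have "\<dots> = red (inv_word u @ red (inv_word c @ c @ v))" by (simp add: red_append_red)
  also have "\<dots> = red (inv_word u @ v)" by (simp add: red_inv_cancel red_append_red)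
  also have "\<dots> = inv_word u @ v"
  proof (rule red_reduced)
    show "reduced (inv_word u @ v)"
    proof (cases u)
      case (Cons l u')
      have "reduced (inv_word u' @ [inv_letter l])"
        using r(1) unfolding Cons inv_word_Cons[symmetric] by simp
      hence "reduced ((inv_word u' @ [inv_letter l]) @ v)"
        using r(2) assms(3) Cons by (subst reduced_append) auto
      thus ?thesis by (simp add: Cons inv_word_Cons)
    qed (use r in simp)
  qed
  finally show ?thesis .
qed

lemma lcp_split:
  obtains c u v where "a = c @ u" "b = c @ v" "u = [] \<or> v = [] \<or> hd u \<noteq> hd v"
proof -
  have "\<exists>c u v. a = c @ u \<and> b = c @ v \<and> (u = [] \<or> v = [] \<or> hd u \<noteq> hd v)"
  proof (induction a arbitrary: b)
    case (Cons x a)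
    show ?case
    proof (cases "b \<noteq> [] \<and> hd b = x")
      case True
      then obtain b' where b: "b = x # b'" by (cases b) auto
      obtain c u v where "a = c @ u" "b' = c @ v" "u = [] \<or> v = [] \<or> hd u \<noteq> hd v"
        using Cons by blast
      thus ?thesis using b by (intro exI[of _ "x # c"] exI[of _ u] exI[of _ v]) simp
    next
      case False
      thus ?thesis by (intro exI[of _ "[]"] exI[of _ "x # a"] exI[of _ b]) auto
    qed
  qed auto
  thus ?thesis using that by blast
qed

lemma word_inject_iff: "x = y \<longleftrightarrow> word x = word y" by (simp add: word_inject)

lemma dst_0 [simp]: "dst 0 x = nrm x" by (simp add: dst_def)
lemma nrm_0 [simp]: "nrm 0 = 0" by (simp add: nrm_def)
lemma nrm_eq_0 [simp]: "nrm x = 0 \<longleftrightarrow> x = 0" by (simp add: nrm_def word_inject_iff)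
lemma nrm_uminus [simp]: "nrm (- x) = nrm x" by (simp add: nrm_def word_uminus)
lemma dst_sym: "dst x y = dst y x"
  using nrm_uminus[of "- x + y"] by (simp add: dst_def minus_add del: nrm_uminus)
lemma dst_same [simp]: "dst x x = 0" by (simp add: dst_def)
lemma dst_eq_0 [simp]: "dst x y = 0 \<longleftrightarrow> x = y"
  by (simp add: dst_def neg_eq_iff_add_eq_0[symmetric]) 
lemma dst_translate [simp]: "dst (g + x) (g + y) = dst x y"
  by (simp add: dst_def minus_add add.assoc del: add_uminus_conv_diff)

lemma dst_Gromov:
  assumes "word x = c @ u" "word y = c @ v" "u = [] \<or> v = [] \<or> hd u \<noteq> hd v"
  shows "dst x y = length u + length v"
  using word_diff[OF assms] by (simp add: dst_def nrm_def)

lemma dst_triangle0: "dst x y \<le> nrm x + nrm y"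
proof -
  obtain c u v where "word x = c @ u" "word y = c @ v" "u = [] \<or> v = [] \<or> hd u \<noteq> hd v"
    by (rule lcp_split)
  thus ?thesis using dst_Gromov[of x c u y v] by (simp add: nrm_def)
qed

lemma dst_triangle: "dst x y \<le> dst x z + dst z y"
  using dst_triangle0[of "- z + x" "- z + y"] dst_sym[of x z] dst_translate[of "- z" x y]
  unfolding dst_def[symmetric] by simp

section \<open>Segments of the tree\<close>

definition seg :: "'a fg \<Rightarrow> 'a fg \<Rightarrow> 'a fg set" where
  "seg x y = {z. dst x z + dst z y = dst x y}"

lemma seg_sym: "seg x y = seg y x"
  by (auto simp: seg_def dst_sym add.commute)
lemma seg_ends [simp]: "x \<in> seg x y" "y \<in> seg x y"
  by (auto simp: seg_def)
lemma seg_same [simp]: "seg x x = {x}"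
  by (auto simp: seg_def)
lemma seg_translate: "z \<in> seg (g + x) (g + y) \<longleftrightarrow> - g + z \<in> seg x y"
  using dst_translate[of g x "- g + z"] dst_translate[of g "- g + z" y]
  by (simp add: seg_def add.assoc[symmetric])

lemma seg_0: "z \<in> seg 0 x \<longleftrightarrow> prefix (word z) (word x)"
proof -
  obtain c u v where *: "word z = c @ u" "word x = c @ v" "u = [] \<or> v = [] \<or> hd u \<noteq> hd v"
    by (rule lcp_split)
  have "z \<in> seg 0 x \<longleftrightarrow> u = []"
    using dst_Gromov[OF *] * by (auto simp: seg_def nrm_def)
  also have "\<dots> \<longleftrightarrow> prefix (word z) (word x)"
    using * by (cases u; cases v) auto
  finally show ?thesis .
qed

text \<open>Triangles in a tree are tripods. A point p on the way to y lies before the branch point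
  c of z and y, hence on the way to z, or after it, hence on the path from z to y.\<close>

lemma seg_0_subset: assumes "p \<in> seg 0 y" shows "p \<in> seg 0 z \<or> p \<in> seg z y"
proof -
  obtain c u v where *: "word z = c @ u" "word y = c @ v" "u = [] \<or> v = [] \<or> hd u \<noteq> hd v"
    by (rule lcp_split)
  obtain q where q: "word y = word p @ q" using assms by (auto simp: seg_0 prefix_def)
  show ?thesis
  proof (cases "length (word p) \<le> length c")
    case True
    hence "prefix (word p) c" using q *(2) by (metis prefix_def prefix_length_prefix)
    thus ?thesis using *(1) by (simp add: seg_0)
  next
    case False
    hence "\<exists>v'. word p = c @ v' \<and> v' \<noteq> [] \<and> v = v' @ q"
      using q *(2) by (auto simp: append_eq_append_conv2)
    then obtain v' where v': "word p = c @ v'" "v' \<noteq> []" "v = v' @ q" by blast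
    have "dst z p = length u + length v'" using dst_Gromov[of z c u p v'] * v' by auto
    moreover have "dst p y = length q" using dst_Gromov[of p "word p" "[]" y q] q by auto
    moreover have "dst z y = length u + length v" using dst_Gromov * by blast
    ultimately show ?thesis using v' by (simp add: seg_def)
  qed
qed

lemma seg_subset: "seg x y \<subseteq> seg x z \<union> seg z y"
proof
  fix p assume "p \<in> seg x y"
  hence "- x + p \<in> seg 0 (- x + y)" using seg_translate[of p x 0 "- x + y"] by (simp add: add.assoc[symmetric])
  hence "- x + p \<in> seg 0 (- x + z) \<or> - x + p \<in> seg (- x + z) (- x + y)" by (rule seg_0_subset)
  thus "p \<in> seg x z \<union> seg z y"
    using seg_translate[of p x 0 "- x + z"] seg_translate[of p x "- x + z" "- x + y"]
    by (simp add: add.assoc[symmetric])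
qed

lemma median0: "\<exists>m. m \<in> seg 0 x \<and> m \<in> seg 0 y \<and> m \<in> seg x y"
proof -
  obtain c u v where *: "word x = c @ u" "word y = c @ v" "u = [] \<or> v = [] \<or> hd u \<noteq> hd v"
    by (rule lcp_split)
  have rc: "reduced c" using *(1) reduced_appendD by (metis reduced_word)
  define m where "m = Fg c"
  have m: "word m = c" using rc by (simp add: m_def Fg_inverse)
  have "dst x m = length u" using dst_Gromov[of x c u m "[]"] * m by simp
  moreover have "dst m y = length v" using dst_Gromov[of m c "[]" y v] * m by simp
  moreover have "dst x y = length u + length v" using dst_Gromov * by blast
  ultimately show ?thesis using * m by (intro exI[of _ m] conjI) (simp_all add: seg_0, simp add: seg_def)
qed

lemma median: "\<exists>m. m \<in> seg z x \<and> m \<in> seg z y \<and> m \<in> seg x y"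
proof -
  obtain m where "m \<in> seg 0 (- z + x)" "m \<in> seg 0 (- z + y)" "m \<in> seg (- z + x) (- z + y)"
    using median0 by blast
  thus ?thesis
    using seg_translate[of "z + m" z 0 "- z + x"] seg_translate[of "z + m" z 0 "- z + y"]
      seg_translate[of "z + m" z "- z + x" "- z + y"]
    by (intro exI[of _ "z + m"]) (simp add: add.assoc[symmetric])
qed

lemma finite_seg [simp]: "finite (seg x y)"
proof -
  have "finite {z. z \<in> seg 0 w}" for w :: "'a fg"
  proof (rule finite_surj[of "set (prefixes (word w))"])
    show "{z. z \<in> seg 0 w} \<subseteq> Fg ` set (prefixes (word w))"
      by (auto simp: seg_0 image_iff) (metis word_inverse in_set_prefixes)
  qed simp
  hence "finite ((+) x ` seg 0 (- x + y))" by simp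
  moreover have "seg x y \<subseteq> (+) x ` seg 0 (- x + y)"
  proof
    fix z assume "z \<in> seg x y"
    hence "- x + z \<in> seg 0 (- x + y)" using seg_translate[of z x 0 "- x + y"] by (simp add: add.assoc[symmetric])
    thus "z \<in> (+) x ` seg 0 (- x + y)" by (intro image_eqI[of _ _ "- x + z"]) (auto simp: add.assoc[symmetric])
  qed
  ultimately show ?thesis by (rule finite_subset[rotated])
qed

lemma seg_mono: "y \<in> seg x z \<Longrightarrow> p \<in> seg x y \<Longrightarrow> p \<in> seg x z \<and> y \<in> seg p z"
  using dst_triangle[of p z y] dst_triangle[of x z p] by (auto simp: seg_def)

lemma seg_antisym: "p \<in> seg x y \<Longrightarrow> y \<in> seg x p \<Longrightarrow> p = y"
proof -
  assume "p \<in> seg x y" "y \<in> seg x p"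
  hence "dst p y = 0" by (simp add: seg_def dst_sym[of p y] del: dst_eq_0)
  thus "p = y" by simp
qed

lemma seg_linear:
  assumes "x \<in> seg a b" "z \<in> seg a b" "dst a x \<le> dst a z"
  shows "x \<in> seg a z"
proof -
  have "x \<in> seg a z \<or> x \<in> seg z b" using assms(1) seg_subset[of a b z] by auto
  moreover have "x = z" if "x \<in> seg z b"
  proof -
    have "dst z x = 0" using that assms by (simp add: seg_def del: dst_eq_0)
    thus ?thesis by simp
  qed
  ultimately show ?thesis by auto
qed

section \<open>Convex subsets and projections\<close>

definition convex :: "'a fg set \<Rightarrow> bool" where
  "convex C \<longleftrightarrow> (\<forall>x\<in>C. \<forall>y\<in>C. seg x y \<subseteq> C)"

lemma convexD: "convex C \<Longrightarrow> x \<in> C \<Longrightarrow> y \<in> C \<Longrightarrow> z \<in> seg x y \<Longrightarrow> z \<in> C"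
  by (auto simp: convex_def)

text \<open>In a tree it is enough to be star-shaped: the segment from x to y is contained in the
  union of those from p to x and from p to y.\<close>

lemma convex_star:
  assumes "\<And>x. x \<in> C \<Longrightarrow> seg p x \<subseteq> C" shows "convex C"
  unfolding convex_def
proof (intro ballI)
  fix x y assume "x \<in> C" "y \<in> C"
  hence "seg x p \<subseteq> C" "seg p y \<subseteq> C" using assms seg_sym[of x p] by auto
  thus "seg x y \<subseteq> C" using seg_subset[of x y p] by blast
qed

lemma convex_Un: "convex P \<Longrightarrow> convex Q \<Longrightarrow> P \<inter> Q \<noteq> {} \<Longrightarrow> convex (P \<union> Q)"
proof -
  assume *: "convex P" "convex Q" "P \<inter> Q \<noteq> {}"
  then obtain p where "p \<in> P" "p \<in> Q" by auto
  thus ?thesis using * by (intro convex_star[of _ p]) (unfold convex_def, blast)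
qed

lemma convex_seg [simp]: "convex (seg a b)"
proof (rule convex_star[of _ a])
  fix x assume "x \<in> seg a b"
  thus "seg a x \<subseteq> seg a b" using seg_mono by blast
qed

text \<open>The projection of x to a convex set C of the tree; C must be convex and non-empty.\<close>

definition gate :: "'a fg \<Rightarrow> 'a fg set \<Rightarrow> 'a fg" where
  "gate x C = (SOME p. p \<in> C \<and> (\<forall>y\<in>C. p \<in> seg x y))"

text \<open>A point p of C nearest to x works: the median of x, p and y lies in C by convexity and
  is at least as near to x, hence equals p.\<close>

lemma gate_ex:
  assumes "convex C" "C \<noteq> {}" shows "\<exists>p. p \<in> C \<and> (\<forall>y\<in>C. p \<in> seg x y)"
proof -
  obtain p where p: "p \<in> C" "\<forall>y\<in>C. dst x p \<le> dst x y"
    using assms(2) exists_least_iff[of "\<lambda>n. \<exists>y\<in>C. dst x y = n"] by (metis all_not_in_conv not_le_imp_less)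
  have "p \<in> seg x y" if y: "y \<in> C" for y
  proof -
    obtain m where m: "m \<in> seg x p" "m \<in> seg x y" "m \<in> seg p y" using median by blast
    hence "m \<in> C" using assms p y convexD by blast
    hence "dst x p \<le> dst x m" using p by auto
    hence "dst m p = 0" using m(1) by (simp add: seg_def del: dst_eq_0)
    hence "m = p" by simp
    thus ?thesis using m by simp
  qed
  thus ?thesis using p by blast
qed

lemma
  assumes "convex C" "C \<noteq> {}"
  shows gate_in: "gate x C \<in> C" and gate_seg: "y \<in> C \<Longrightarrow> gate x C \<in> seg x y"
  using someI_ex[OF gate_ex[OF assms]] unfolding gate_def by blast+

lemma gate_eqI:
  assumes "convex C" "p \<in> C" "\<And>y. y \<in> C \<Longrightarrow> p \<in> seg x y"
  shows "gate x C = p"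
proof -
  have "C \<noteq> {}" using assms by auto
  note g = gate_in[OF assms(1) this, of x] gate_seg[OF assms(1) this, of _ x]
  show ?thesis using seg_antisym g assms by metis
qed

lemma gate_self [simp]: "convex C \<Longrightarrow> x \<in> C \<Longrightarrow> gate x C = x"
  by (rule gate_eqI) auto

lemma gate_meets:
  assumes "convex P" "convex C" "P \<inter> C \<noteq> {}" "x \<in> P"
  shows "gate x C \<in> P"
proof -
  obtain c where c: "c \<in> P" "c \<in> C" using assms by auto
  hence "gate x C \<in> seg x c" using gate_seg[of C] assms by blast
  thus ?thesis using assms c convexD by blast
qed

text \<open>A path from x that enters P outside Q reaches Q only inside P. Otherwise, on the way to
  a common point c, the gate of P would lie between two points of Q and therefore in Q.\<close>

lemma gate_chain:
  assumes "convex P" "convex Q" "P \<inter> Q \<noteq> {}" "gate x P \<notin> Q"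
  shows "gate x Q \<in> P"
proof -
  obtain c where c: "c \<in> P" "c \<in> Q" using assms by auto
  have ne: "P \<noteq> {}" "Q \<noteq> {}" using c by auto
  let ?a = "gate x P" and ?p = "gate x Q"
  have a: "?a \<in> P" "?a \<in> seg x c" using gate_in gate_seg assms ne c by blast+
  have p: "?p \<in> Q" "?p \<in> seg x c" using gate_in gate_seg assms ne c by blast+
  have "?p \<in> seg x ?a \<or> ?p \<in> seg ?a c" using p seg_subset by blast
  moreover have "?p \<notin> seg x ?a"
  proof
    assume "?p \<in> seg x ?a"
    hence "?a \<in> seg ?p c" using a seg_mono by blast
    thus False using p c assms convexD by blast
  qed
  ultimately show ?thesis using a c assms convexD by blast
qed

text \<open>Disjoint convex sets are joined by a unique bridge, and everything in P projects to its
  end in Q.\<close>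

lemma gate_disjoint_const:
  assumes "convex P" "convex Q" "P \<inter> Q = {}" "x \<in> P" "y \<in> P" "Q \<noteq> {}"
  shows "gate x Q = gate y Q"
proof -
  let ?p = "gate x Q" and ?q = "gate y Q"
  have p: "?p \<in> Q" "?p \<in> seg x ?q" using gate_in gate_seg assms by blast+
  have q: "?q \<in> Q" "?q \<in> seg y ?p" using gate_in gate_seg assms by blast+
  have "?p \<notin> seg x y" using p assms convexD by blast
  hence "?p \<in> seg y ?q" using p seg_subset by blast
  thus ?thesis using q seg_antisym by blast
qed

lemma gates_between:
  assumes "convex C" "C \<noteq> {}" "gate x C \<noteq> gate y C"
  shows "seg (gate x C) (gate y C) \<subseteq> seg x y"
proof -
  let ?p = "gate x C" and ?q = "gate y C"
  have g: "?p \<in> C" "?q \<in> C" using gate_in assms by blast+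
  obtain m where m: "m \<in> seg x y" "m \<in> seg x ?p" "m \<in> seg y ?p" using median seg_sym by metis
  have pq: "?p \<in> seg x ?q" "?q \<in> seg y ?p" using g gate_seg assms by blast+
  have "?p \<in> seg x y"
  proof -
    have "?p \<in> seg x y \<or> ?p \<in> seg y ?q" using pq(1) seg_subset by blast
    thus ?thesis using pq(2) seg_antisym assms(3) by blast
  qed
  moreover have "?q \<in> seg x y"
  proof -
    have "?q \<in> seg y x \<or> ?q \<in> seg x ?p" using pq(2) seg_subset by blast
    thus ?thesis using pq(1) seg_antisym assms(3) seg_sym by blast
  qed
  ultimately show ?thesis using convex_seg convexD by blast
qed

text \<open>Every path from Q to P enters P at the end of the bridge. A path inside W does so as
  well, so this end belongs to W.\<close>

lemma bridge_meets:
  assumes "convex P" "convex Q" "convex W" "P \<inter> Q = {}" "P \<inter> W \<noteq> {}" "Q \<inter> W \<noteq> {}" "x \<in> P" "y \<in> Q"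
  shows "seg x y \<inter> W \<noteq> {}"
proof -
  obtain c d where c: "c \<in> P" "c \<in> W" and d: "d \<in> Q" "d \<in> W" using assms by auto
  have "gate y P = gate d P" using gate_disjoint_const[of Q P] assms d by auto
  moreover have "gate d P \<in> seg d c" using gate_seg[of P] assms c by blast
  moreover have "gate y P \<in> seg y x" using gate_seg[of P] assms by blast
  ultimately show ?thesis using c d assms convexD seg_sym by (metis IntI empty_iff)
qed

section \<open>Translations\<close>

definition tr :: "'a fg \<Rightarrow> 'a fg set \<Rightarrow> 'a fg set" where "tr g S = (+) g ` S"

lemma mem_tr: "z \<in> tr g S \<longleftrightarrow> - g + z \<in> S"
  by (auto simp: tr_def image_iff add.assoc[symmetric]) (metis add.assoc add.left_neutral right_minus)
lemma tr_tr [simp]: "tr g (tr h S) = tr (g + h) S"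
  by (auto simp: mem_tr minus_add add.assoc simp del: add_uminus_conv_diff)
lemma tr_0 [simp]: "tr 0 S = S" by (auto simp: mem_tr)
lemma tr_Int: "tr g (P \<inter> Q) = tr g P \<inter> tr g Q" by (auto simp: mem_tr)
lemma card_tr [simp]: "card (tr g S) = card S"
  unfolding tr_def by (rule card_image) (auto intro: inj_onI)
lemma tr_seg: "tr g (seg x y) = seg (g + x) (g + y)"
  by (auto simp: mem_tr seg_translate)
lemma convex_tr [simp]: "convex (tr g S) \<longleftrightarrow> convex S"
proof -
  have *: "convex S \<Longrightarrow> convex (tr g S)" for g and S :: "'a fg set"
    unfolding convex_def
  proof safe
    fix x y z assume h: "\<forall>x\<in>S. \<forall>y\<in>S. seg x y \<subseteq> S" "x \<in> tr g S" "y \<in> tr g S" "z \<in> seg x y"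
    have "- g + z \<in> seg (- g + x) (- g + y)"
      using h(4) seg_translate[of z g "- g + x" "- g + y"] by (simp add: add.assoc[symmetric])
    thus "z \<in> tr g S" using h by (auto simp: mem_tr)
  qed
  show ?thesis using *[of S g] *[of "tr g S" "- g"] by auto
qed

section \<open>Windmills\<close>

lemmas grp = diff_conv_add_uminus minus_add add.assoc group_add_class.right_minus minus_add_cancel add_minus_cancel

text \<open>\<open>C\<close> plays the role of the hull of an orbit of \<open>F\<close>, and
  \<open>E\<close> that of its basic segments. \<open>overlap\<close> and
  \<open>displacement\<close> are fractions of each single segment because the lengths in
  \<open>E\<close> need not be bounded. \<open>E_card\<close> makes one point cost at most one
  unit.\<close>

locale translates =
  fixes F C :: "'a fg set" and E :: "'a fg set set"
  assumes F_0: "0 \<in> F" and F_add: "f \<in> F \<Longrightarrow> f' \<in> F \<Longrightarrow> f + f' \<in> F" and F_uminus: "f \<in> F \<Longrightarrow> - f \<in> F"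
    and convex_C: "convex C" and C_0: "0 \<in> C" and C_F: "f \<in> F \<Longrightarrow> tr f C \<subseteq> C"
    and E_seg: "e \<in> E \<Longrightarrow> \<exists>a b. e = seg a b" and E_C: "e \<in> E \<Longrightarrow> e \<subseteq> C" and E_card: "e \<in> E \<Longrightarrow> 25 \<le> card e"
    and E_F: "e \<in> E \<Longrightarrow> f \<in> F \<Longrightarrow> tr f e \<in> E"
    and overlap: "e \<in> E \<Longrightarrow> v \<notin> F \<Longrightarrow> 25 * card (tr v C \<inter> e) \<le> card e"
    and displacement: "c \<in> C \<Longrightarrow> f \<in> F \<Longrightarrow> f \<noteq> 0 \<Longrightarrow> \<exists>e\<in>E. 25 * card (seg c (f + c) \<inter> e) > 11 * card e"
begin

abbreviation T :: "'a fg \<Rightarrow> 'a fg set" where "T v \<equiv> tr v C"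

text \<open>The lengths that S covers on the basic segments of the translate by v, in units of 1/25 of each segment.
  Distinct translates overlap in at most 1 unit, windmills meet a translate not yet absorbed in at most 4 units, and a
  nontrivial element of the conjugate of F moves points by more than 11 = 5 + 6 units; so a path that has travelled
  more than 6 units in one translate does so again in the next one.\<close>

definition small :: "nat \<Rightarrow> 'a fg \<Rightarrow> 'a fg set \<Rightarrow> bool" where
  "small k v S \<longleftrightarrow> (\<forall>e\<in>E. 25 * card (S \<inter> tr v e) \<le> k * card e)"

declare convex_C [simp]

lemma finite_E: "e \<in> E \<Longrightarrow> finite e"
  using E_seg by fastforce

lemma finite_tr [simp]: "finite (tr g S) \<longleftrightarrow> finite S"
  by (simp add: tr_def finite_image_iff)

lemma small_mono: "small k v S \<Longrightarrow> S' \<subseteq> S \<Longrightarrow> k \<le> k' \<Longrightarrow> small k' v S'"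
  unfolding small_def
proof
  fix e assume h: "\<forall>e\<in>E. 25 * card (S \<inter> tr v e) \<le> k * card e" "S' \<subseteq> S" "k \<le> k'" "e \<in> E"
  have "card (S' \<inter> tr v e) \<le> card (S \<inter> tr v e)"
    by (rule card_mono) (use h finite_E in auto)
  moreover have "25 * card (S \<inter> tr v e) \<le> k * card e" using h by blast
  moreover have "k * card e \<le> k' * card e" using h by simp
  ultimately show "25 * card (S' \<inter> tr v e) \<le> k' * card e" by linarith
qed

lemma small_Un: "small k v S \<Longrightarrow> small k' v S' \<Longrightarrow> small (k + k') v (S \<union> S')"
  unfolding small_def
proof
  fix e assume h: "\<forall>e\<in>E. 25 * card (S \<inter> tr v e) \<le> k * card e" "\<forall>e\<in>E. 25 * card (S' \<inter> tr v e) \<le> k' * card e" "e \<in> E"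
  have "card ((S \<union> S') \<inter> tr v e) \<le> card (S \<inter> tr v e) + card (S' \<inter> tr v e)"
    by (metis Int_Un_distrib2 card_Un_le)
  moreover have "25 * card (S \<inter> tr v e) \<le> k * card e" "25 * card (S' \<inter> tr v e) \<le> k' * card e" using h by blast+
  ultimately show "25 * card ((S \<union> S') \<inter> tr v e) \<le> (k + k') * card e" by (simp add: add_mult_distrib)
qed

lemma small_singleton: "small 1 v {b}"
  unfolding small_def
proof
  fix e assume "e \<in> E"
  moreover have "card ({b} \<inter> tr v e) \<le> card {b}" by (rule card_mono) auto
  ultimately show "25 * card ({b} \<inter> tr v e) \<le> 1 * card e" using E_card[of e] by simp
qed

lemma T_coset: "- v + v' \<in> F \<Longrightarrow> T v = T v'"
proof -
  have *: "T (v + f) \<subseteq> T v" if "f \<in> F" for v f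
    using C_F[OF that] by (auto simp: tr_tr[symmetric] mem_tr simp del: tr_tr)
  assume f: "- v + v' \<in> F"
  have "v' = v + (- v + v')" by (simp add: add.assoc[symmetric])
  hence "T v' \<subseteq> T v" using *[OF f, of v] by metis
  moreover have "v = v' + - (- v + v')" by (simp add: minus_add add.assoc[symmetric] del: add_uminus_conv_diff)
  hence "T v \<subseteq> T v'" using *[OF F_uminus[OF f], of v'] by metis
  ultimately show ?thesis by blast
qed

lemma T_conj: "f \<in> F \<Longrightarrow> tr (v + f - v) (T v) = T v"
proof -
  assume "f \<in> F"
  hence "T (v + f) = T v" by (intro T_coset[symmetric]) (simp add: add.assoc[symmetric])
  thus ?thesis by simp
qed

lemma T_self: "v \<in> T v" by (simp add: mem_tr C_0)

lemma convex_T: "convex (T v)" by (simp add: convex_C)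

lemma T_overlap: "- v + v' \<notin> F \<Longrightarrow> small 1 v (T v')"
  unfolding small_def
proof
  fix e assume "- v + v' \<notin> F" "e \<in> E"
  hence "25 * card (tr v (T (- v + v') \<inter> e)) \<le> card e" using overlap by (simp only: card_tr)
  thus "25 * card (T v' \<inter> tr v e) \<le> 1 * card e" by (simp add: tr_Int add.assoc[symmetric])
qed

lemma not_small_displacement:
  assumes "c \<in> T v" "f \<in> F" "f \<noteq> 0" shows "\<not> small 11 v (seg c (v + f - v + c))"
proof -
  have "- v + c \<in> C" using assms by (simp add: mem_tr)
  then obtain e where e: "e \<in> E" "25 * card (seg (- v + c) (f + (- v + c)) \<inter> e) > 11 * card e"
    using displacement assms by blast
  have "tr v (seg (- v + c) (f + (- v + c)) \<inter> e) = seg c (v + f - v + c) \<inter> tr v e"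
    unfolding tr_Int tr_seg by (simp add: grp del: add_uminus_conv_diff)
  hence "card (seg (- v + c) (f + (- v + c)) \<inter> e) = card (seg c (v + f - v + c) \<inter> tr v e)"
    using card_tr by metis
  thus ?thesis using e unfolding small_def by (auto simp: not_le intro!: bexI[of _ e])
qed

definition ev :: "('a fg \<times> 'a fg) list \<Rightarrow> 'a fg" where
  "ev s = sum_list (map (\<lambda>(r, f). r + f - r) s)"

lemma ev_simps [simp]: "ev [] = 0" "ev ((r, f) # s) = r + f - r + ev s" "ev (s @ t) = ev s + ev t"
  by (simp_all add: ev_def)

text \<open>The subgroup generated by the conjugates of \<open>F\<close> by \<open>R\<close>;
  inverses of syllables are again syllables because \<open>F\<close> is a group.\<close>

definition L :: "'a fg set \<Rightarrow> 'a fg set" where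
  "L R = ev ` {s. set s \<subseteq> R \<times> F}"

lemma L_0: "0 \<in> L R"
  unfolding L_def by (rule image_eqI[of _ _ "[]"]) auto

lemma L_add: "g \<in> L R \<Longrightarrow> h \<in> L R \<Longrightarrow> g + h \<in> L R"
  unfolding L_def
proof safe
  fix s t assume "set s \<subseteq> R \<times> F" "set t \<subseteq> R \<times> F"
  thus "ev s + ev t \<in> ev ` {s. set s \<subseteq> R \<times> F}"
    by (intro image_eqI[of _ _ "s @ t"]) auto
qed

lemma L_gen: "r \<in> R \<Longrightarrow> f \<in> F \<Longrightarrow> r + f - r \<in> L R"
  unfolding L_def by (rule image_eqI[of _ _ "[(r, f)]"]) auto

lemma L_uminus: assumes "g \<in> L R" shows "- g \<in> L R"
proof -
  have "- ev s \<in> L R" if "set s \<subseteq> R \<times> F" for s using that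
  proof (induction s)
    case (Cons a s)
    obtain r f where a: "a = (r, f)" by fastforce
    have "- ev (a # s) = - ev s + (r + - f - r)"
      by (simp add: a minus_add add.assoc del: add_uminus_conv_diff)
        (simp add: diff_conv_add_uminus minus_add add.assoc del: add_uminus_conv_diff)
    thus ?case using Cons a L_add L_gen F_uminus by (metis SigmaD1 SigmaD2 list.set_intros(1) set_subset_Cons subset_iff)
  qed (simp add: L_0)
  thus ?thesis using assms by (auto simp: L_def)
qed

lemma L_mono: "R \<subseteq> R' \<Longrightarrow> L R \<subseteq> L R'"
  unfolding L_def by (rule image_mono) auto

text \<open>A union of double cosets. As \<open>T v\<close> depends only on the coset of v modulo
  \<open>F\<close>, it serves as the set of translates absorbed so far, invariant under
  \<open>L R\<close>.\<close>

definition Orb :: "'a fg set \<Rightarrow> 'a fg set" where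
  "Orb R = {l + r + f | l r f. l \<in> L R \<and> r \<in> R \<and> f \<in> F}"

lemma Orb_mono: "R \<subseteq> R' \<Longrightarrow> Orb R \<subseteq> Orb R'"
  unfolding Orb_def using L_mono by blast

lemma Orb_translate: "l \<in> L R \<Longrightarrow> v \<in> Orb R \<Longrightarrow> f \<in> F \<Longrightarrow> l + v + f \<in> Orb R"
  unfolding Orb_def mem_Collect_eq using L_add F_add by (metis add.assoc)

lemma Orb_translate_iff: "l \<in> L R \<Longrightarrow> f \<in> F \<Longrightarrow> l + v + f \<in> Orb R \<longleftrightarrow> v \<in> Orb R"
proof
  assume l: "l \<in> L R" "f \<in> F" "l + v + f \<in> Orb R"
  hence "- l + (l + v + f) + - f \<in> Orb R" using L_uminus F_uminus by (blast intro: Orb_translate[of "- l" R "l + v + f" "- f"])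
  moreover have "- l + (l + v + f) + - f = v" by (simp add: grp del: add_uminus_conv_diff)
  ultimately show "v \<in> Orb R" by metis
qed (rule Orb_translate)

text \<open>The normal form criterion for \<open>L R\<close> to be the free product of the
  conjugates of \<open>F\<close> by the elements of \<open>R\<close>.\<close>

definition free :: "'a fg set \<Rightarrow> bool" where
  "free R \<longleftrightarrow> (\<forall>s. set s \<subseteq> R \<times> (F - {0}) \<and> successively (\<lambda>p q. fst p \<noteq> fst q) s \<and> ev s = 0 \<longrightarrow> s = [])"

definition windmill :: "'a fg set \<Rightarrow> 'a fg set \<Rightarrow> bool" where
  "windmill W R \<longleftrightarrow> convex W \<and> 0 \<in> W \<and> (\<forall>g\<in>L R. tr g W = W) \<and> free R \<and>
     (\<forall>v. v \<notin> Orb R \<longrightarrow> small 4 v (W \<inter> T v))"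

end

section \<open>One enlargement of a windmill\<close>

locale windmill_step = translates +
  fixes W R :: "'a fg set"
  assumes windmill: "windmill W R"
begin

lemma convex_W [simp]: "convex W" and W_0: "0 \<in> W" and W_L: "g \<in> L R \<Longrightarrow> tr g W = W" and free_R: "free R"
  and W_small: "v \<notin> Orb R \<Longrightarrow> small 4 v (W \<inter> T v)"
  using windmill unfolding windmill_def by blast+

definition U :: "'a fg set" where "U = {v. v \<notin> Orb R \<and> T v \<inter> W \<noteq> {}}"

lemma U_translate: assumes "u \<in> U" "l \<in> L R" "f \<in> F" shows "l + u + f \<in> U"
proof -
  have "T (l + u + f) = T (l + u)" using assms by (intro T_coset[symmetric]) (simp add: grp del: add_uminus_conv_diff)
  also have "\<dots> \<inter> W = tr l (T u \<inter> W)" using W_L[OF assms(2)] by (simp add: tr_Int)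
  also have "\<dots> \<noteq> {}" using assms(1) by (simp add: U_def tr_def)
  finally show ?thesis using assms Orb_translate_iff by (simp add: U_def)
qed

lemma U_L: "u \<in> U \<Longrightarrow> l \<in> L R \<Longrightarrow> l + u \<in> U"
  using U_translate[OF _ _ F_0] by simp

lemma U_F: "u \<in> U \<Longrightarrow> f \<in> F \<Longrightarrow> u + f \<in> U"
  using U_translate[OF _ L_0] by simp

definition equiv_U :: "'a fg \<Rightarrow> 'a fg \<Rightarrow> bool" where
  "equiv_U v v' \<longleftrightarrow> (\<exists>l\<in>L R. \<exists>f\<in>F. v' = l + v + f)"

lemma equiv_U_refl: "equiv_U v v"
  unfolding equiv_U_def by (rule bexI[OF _ L_0], rule bexI[OF _ F_0]) simp

lemma equiv_U_sym: "equiv_U v v' \<Longrightarrow> equiv_U v' v"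
  unfolding equiv_U_def
proof safe
  fix l f assume "l \<in> L R" "f \<in> F"
  thus "\<exists>l'\<in>L R. \<exists>f'\<in>F. v = l' + (l + v + f) + f'"
    by (intro bexI[of _ "- l"] bexI[of _ "- f"] L_uminus F_uminus)
      (simp_all add: add.assoc[symmetric] diff_conv_add_uminus del: add_uminus_conv_diff, simp add: add.assoc)
qed

lemma equiv_U_trans: "equiv_U v v' \<Longrightarrow> equiv_U v' v'' \<Longrightarrow> equiv_U v v''"
  unfolding equiv_U_def
proof safe
  fix l f l' f' assume "l \<in> L R" "f \<in> F" "l' \<in> L R" "f' \<in> F"
  thus "\<exists>l''\<in>L R. \<exists>f''\<in>F. l' + (l + v + f) + f' = l'' + v + f''"
    by (intro bexI[of _ "l' + l"] bexI[of _ "f + f'"] L_add F_add) (simp_all add: add.assoc)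
qed

text \<open>For equivalent v and v' the predicates \<open>equiv_U v\<close> and
  \<open>equiv_U v'\<close> coincide, so SOME picks one common element: \<open>U'\<close> contains
  exactly one representative of each new double coset.\<close>

definition U' :: "'a fg set" where "U' = (\<lambda>v. SOME v'. equiv_U v v') ` U"

lemma U'_rep: assumes "v \<in> U" shows "\<exists>u\<in>U'. equiv_U u v"
proof -
  have "equiv_U v (SOME v'. equiv_U v v')" by (rule someI[of _ v]) (rule equiv_U_refl)
  thus ?thesis using assms equiv_U_sym by (auto simp: U'_def)
qed

lemma U'_cases:
  assumes "v \<in> U" obtains u l f where "u \<in> U'" "l \<in> L R" "f \<in> F" "v = l + u + f"
  using U'_rep[OF assms] that unfolding equiv_U_def by (elim bexE)

lemma U'_U: "U' \<subseteq> U"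
proof
  fix u assume "u \<in> U'"
  then obtain v where v: "v \<in> U" "u = (SOME v'. equiv_U v v')" by (auto simp: U'_def)
  have "equiv_U v u" unfolding v(2) by (rule someI[of _ v]) (rule equiv_U_refl)
  thus "u \<in> U" using v U_translate by (auto simp: equiv_U_def)
qed

lemma U'_unique: assumes "u \<in> U'" "u' \<in> U'" "equiv_U u u'" shows "u = u'"
proof -
  obtain v v' where v: "u = (SOME w. equiv_U v w)" "u' = (SOME w. equiv_U v' w)" using assms by (auto simp: U'_def)
  have "equiv_U v u" "equiv_U v' u'"
    unfolding v by (rule someI[of _ v], rule equiv_U_refl, rule someI[of _ v'], rule equiv_U_refl)
  hence vv: "equiv_U v v'" using assms(3) equiv_U_trans[of v u u'] equiv_U_trans[of v u' v'] equiv_U_sym[of v' u'] by blast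
  have "equiv_U v = equiv_U v'"
  proof (intro ext iffI)
    fix w
    show "equiv_U v w \<Longrightarrow> equiv_U v' w" using equiv_U_trans[OF equiv_U_sym[OF vv]] .
    show "equiv_U v' w \<Longrightarrow> equiv_U v w" using equiv_U_trans[OF vv] .
  qed
  thus ?thesis using v by simp
qed

definition R' :: "'a fg set" where "R' = R \<union> U'"

lemma U_Orb: "u \<in> U \<Longrightarrow> u \<in> Orb R'"
proof -
  assume "u \<in> U"
  then obtain u' l f where "u' \<in> U'" "l \<in> L R" "f \<in> F" "u = l + u' + f" by (rule U'_cases)
  moreover have "L R \<subseteq> L R'" by (rule L_mono) (simp add: R'_def)
  ultimately show ?thesis unfolding Orb_def by (auto simp: R'_def)
qed

lemma conj_L': assumes "u \<in> U" "f \<in> F" shows "u + f - u \<in> L R'"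
proof -
  obtain u' l f' where u: "u' \<in> U'" "l \<in> L R" "f' \<in> F" "u = l + u' + f'" by (rule U'_cases[OF assms(1)])
  have "L R \<subseteq> L R'" by (rule L_mono) (simp add: R'_def)
  hence l: "l \<in> L R'" "- l \<in> L R'" using u L_uminus by auto
  have "u + f - u = l + (u' + (f' + f + - f') - u') + - l"
    unfolding u(4) by (simp add: diff_conv_add_uminus minus_add add.assoc del: add_uminus_conv_diff)
  moreover have "u' + (f' + f + - f') - u' \<in> L R'"
    using u assms F_add F_uminus by (intro L_gen) (auto simp: R'_def simp del: add_uminus_conv_diff)
  ultimately show ?thesis using l L_add by metis
qed

lemma T_W: "u \<in> U \<Longrightarrow> T (g + u) \<inter> tr g W \<noteq> {}"
  by (auto simp: U_def tr_tr[symmetric] tr_Int[symmetric] simp del: tr_tr) (auto simp: tr_def)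

lemma W_small': "- g + v \<in> U \<Longrightarrow> small 4 v (tr g W \<inter> T v)"
proof -
  assume "- g + v \<in> U"
  hence s: "small 4 (- g + v) (W \<inter> T (- g + v))" using W_small by (simp add: U_def)
  have "card (tr g W \<inter> T v \<inter> tr v e) = card (W \<inter> T (- g + v) \<inter> tr (- g + v) e)" for e
  proof -
    have "tr g (W \<inter> T (- g + v) \<inter> tr (- g + v) e) = tr g W \<inter> T v \<inter> tr v e"
      by (simp add: tr_Int grp del: add_uminus_conv_diff)
    thus ?thesis using card_tr by metis
  qed
  thus ?thesis using s by (simp add: small_def)
qed

text \<open>Seen from x, the windmill translate by g lies behind the translate of C by v: the path from x
  runs for more than 6 units inside the latter.\<close>

definition far :: "'a fg \<Rightarrow> 'a fg \<Rightarrow> 'a fg \<Rightarrow> bool" where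
  "far x v g \<longleftrightarrow> (\<forall>b\<in>tr g W \<inter> T v. \<not> small 6 v (seg (gate x (T v)) b))"

lemma conj_shift: "(g :: 'a fg) + (u + f - u) = (g + u) + f - (g + u) + g"
  by (simp add: diff_conv_add_uminus minus_add add.assoc del: add_uminus_conv_diff)

text \<open>Let h be the conjugate of f by g + u. Both b and its preimage under h lie in the
  translate. The path from the preimage to the gate stays in \<open>Y\<close> and costs at most 5
  units; if the rest up to b cost at most 6, then h would move a point of the translate by at most
  11 units.\<close>

lemma far_core:
  assumes "convex Y" "tr g W \<subseteq> Y" "u \<in> U" "small 5 (g + u) (Y \<inter> T (g + u))"
    and "gate x (T (g + u)) \<in> Y" "f \<in> F" "f \<noteq> 0"
  shows "far x (g + u) (g + (u + f - u))"
  unfolding far_def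
proof (intro ballI notI)
  let ?v = "g + u" let ?h = "?v + f - ?v" let ?p = "gate x (T ?v)"
  fix b assume b: "b \<in> tr (g + (u + f - u)) W \<inter> T ?v" and s: "small 6 ?v (seg ?p b)"
  have "b \<in> tr (?h + g) W" using b conj_shift[of g u f] by simp
  hence c1: "- ?h + b \<in> tr g W" by (simp only: tr_tr[symmetric] mem_tr[of b ?h])
  have c2: "- ?h + b \<in> T ?v" using b T_conj[OF assms(6), of ?v] by (metis IntD2 mem_tr)
  have p: "?p \<in> T ?v" using gate_in[of "T ?v"] T_self[of ?v] convex_T by blast
  have "seg (- ?h + b) ?p \<subseteq> Y \<inter> T ?v"
    using c1 c2 p assms(2,5) convexD[OF assms(1)] convexD[OF convex_T] by blast
  hence "small 5 ?v (seg (- ?h + b) ?p)" using assms(4) small_mono by blast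
  hence "small (5 + 6) ?v (seg (- ?h + b) ?p \<union> seg ?p b)" using s small_Un by blast
  hence "small 11 ?v (seg (- ?h + b) b)" by (rule small_mono) (simp_all add: seg_subset)
  moreover have "?h + (- ?h + b) = b" by (rule add_minus_cancel)
  ultimately show False using not_small_displacement[OF c2 assms(6,7)] by simp
qed

lemma far_start:
  assumes "x \<in> tr g W" "u \<in> U" "f \<in> F" "f \<noteq> 0"
  shows "far x (g + u) (g + (u + f - u))"
proof (rule far_core[of "tr g W"])
  have "small 4 (g + u) (tr g W \<inter> T (g + u))" using assms by (intro W_small') (simp add: add.assoc[symmetric])
  thus "small 5 (g + u) (tr g W \<inter> T (g + u))" by (rule small_mono) auto
  show "gate x (T (g + u)) \<in> tr g W" using T_W assms by (intro gate_meets) auto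
qed (use assms in auto)

lemma far_start':
  assumes "x \<in> T v" "T v \<inter> tr g W \<noteq> {}" "- v + (g + u) \<notin> F" "u \<in> U" "f \<in> F" "f \<noteq> 0"
  shows "far x (g + u) (g + (u + f - u))"
proof (rule far_core[of "tr g W \<union> T v"])
  have "- (g + u) + v \<notin> F" using assms(3) F_uminus by (metis minus_add minus_minus)
  hence "small 1 (g + u) (T v)" by (rule T_overlap)
  moreover have "small 4 (g + u) (tr g W \<inter> T (g + u))" using assms by (intro W_small') (simp add: add.assoc[symmetric])
  ultimately have "small (4 + 1) (g + u) ((tr g W \<inter> T (g + u)) \<union> T v)" using small_Un by blast
  thus "small 5 (g + u) ((tr g W \<union> T v) \<inter> T (g + u))" by (rule small_mono) auto
  show c: "convex (tr g W \<union> T v)" using assms by (intro convex_Un) auto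
  show "gate x (T (g + u)) \<in> tr g W \<union> T v" using T_W[OF assms(4), of g] assms c by (intro gate_meets) auto
qed (use assms in auto)

text \<open>The inductive step of the ping-pong. The windmill and the translate through which it was
  entered cost 4 + 1 units of the next translate. It remains to see that the path from x enters
  their union through \<open>T v\<close>, and at a point outside the next translate, so that it
  reaches the latter from within the union.\<close>

lemma far_step:
  assumes "far x v g" "T v \<inter> tr g W \<noteq> {}" "- v + (g + u) \<notin> F" "u \<in> U" "f \<in> F" "f \<noteq> 0"
  shows "far x (g + u) (g + (u + f - u))"
proof (rule far_core[of "tr g W \<union> T v"])
  have "- (g + u) + v \<notin> F" using assms(3) F_uminus by (metis minus_add minus_minus)
  hence "small 1 (g + u) (T v)" by (rule T_overlap)
  moreover have "small 4 (g + u) (tr g W \<inter> T (g + u))" using assms by (intro W_small') (simp add: add.assoc[symmetric])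
  ultimately have "small (4 + 1) (g + u) ((tr g W \<inter> T (g + u)) \<union> T v)" using small_Un by blast
  thus "small 5 (g + u) ((tr g W \<union> T v) \<inter> T (g + u))" by (rule small_mono) auto
  show c: "convex (tr g W \<union> T v)" using assms by (intro convex_Un) auto
  let ?a = "gate x (T v)"
  have a: "?a \<in> T v" using gate_in[of "T v"] T_self[of v] convex_T by blast
  have far: "\<not> small 6 v (seg ?a b)" if "b \<in> tr g W \<inter> T v" for b using assms(1) that by (simp add: far_def)
  have "?a \<notin> tr g W"
    using far[of ?a] a small_mono[OF small_singleton, of "{?a}" ?a 6 v] by auto
  hence z: "gate x (tr g W) \<in> T v" using assms by (intro gate_chain) auto
  have "gate x (tr g W \<union> T v) = ?a"
  proof (rule gate_eqI[OF c])
    fix y assume "y \<in> tr g W \<union> T v"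
    thus "?a \<in> seg x y"
    proof
      assume y: "y \<in> tr g W"
      hence "gate x (tr g W) \<in> seg x y" by (intro gate_seg) auto
      moreover have "?a \<in> seg x (gate x (tr g W))" using z by (intro gate_seg) auto
      ultimately show ?thesis using seg_mono by blast
    next
      assume "y \<in> T v" thus ?thesis by (intro gate_seg) auto
    qed
  qed (use a in simp)
  \<comment> \<open>Otherwise \<open>T (g + u)\<close> would contain a path from the gate
    \<open>?a\<close> to a point of the windmill inside \<open>T v\<close>. By \<open>far\<close>
    that path exceeds 6 units, whereas distinct translates overlap in at most one.\<close>
  moreover have "?a \<notin> T (g + u)"
  proof
    assume a': "?a \<in> T (g + u)"
    obtain y where y: "y \<in> T (g + u)" "y \<in> tr g W" using T_W assms by blast
    let ?y = "gate y (T v)"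
    have 1: "?y \<in> tr g W" using y assms by (intro gate_meets) auto
    have 2: "?y \<in> T v" using a by (intro gate_in) auto
    have "?y \<in> seg y ?a" using a by (intro gate_seg) auto
    hence 3: "?y \<in> T (g + u)" using y a' convexD convex_T by blast
    have "small 1 v (T (g + u))" using assms by (intro T_overlap)
    moreover have "seg ?a ?y \<subseteq> T (g + u)" using 3 a' convex_T by (simp only: convex_def)
    ultimately have "small 6 v (seg ?a ?y)" using small_mono by (metis one_le_numeral)
    thus False using far 1 2 by blast
  qed
  ultimately show "gate x (T (g + u)) \<in> tr g W \<union> T v"
    using T_W[OF assms(4), of g] c by (intro gate_chain) auto
qed (use assms in auto)

text \<open>Walks between translates of the windmill. The option records the translate of C through which the walk arrived,
  and a step through the same translate is forbidden; turn replaces g by another element with the same windmill.\<close>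

inductive reach :: "('a fg option \<Rightarrow> 'a fg \<Rightarrow> bool) \<Rightarrow> 'a fg option \<Rightarrow> 'a fg \<Rightarrow> bool" for base where
  base: "base q g \<Longrightarrow> reach base q g"
| step: "reach base q g \<Longrightarrow> u \<in> U \<Longrightarrow> f \<in> F \<Longrightarrow> f \<noteq> 0 \<Longrightarrow> (\<And>v. q = Some v \<Longrightarrow> - v + (g + u) \<notin> F)
    \<Longrightarrow> reach base (Some (g + u)) (g + (u + f - u))"
| turn: "reach base q g \<Longrightarrow> l \<in> L R \<Longrightarrow> reach base q (g + l)"

lemma R'_mono: "R \<subseteq> R'" "L R \<subseteq> L R'"
  using L_mono[of R R'] by (auto simp: R'_def)

lemma reach_L':
  assumes "reach base q g" "\<And>q g. base q g \<Longrightarrow> g \<in> L R'" shows "g \<in> L R'"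
  using assms(1) by induction (use assms(2) R'_mono in \<open>auto intro!: L_add conj_L'\<close>)

text \<open>A forbidden step, through the translate by which the walk arrived, is merged with the
  preceding step: the two conjugating elements agree modulo \<open>F\<close>, so their product is a
  single step, or no step at all. At the start this is left to the hypothesis on
  \<open>base\<close>.\<close>

lemma reach_close:
  assumes base: "\<And>q g u f v. base q g \<Longrightarrow> u \<in> U \<Longrightarrow> f \<in> F \<Longrightarrow> q = Some v \<Longrightarrow> - v + (g + u) \<in> F \<Longrightarrow> base q (g + (u + f - u))"
  assumes "reach base q g" "u \<in> U" "f \<in> F"
  shows "\<exists>q'. reach base q' (g + (u + f - u))"
  using assms(2-4)
proof (induction arbitrary: u f)
  case (base q g)
  show ?case
  proof (cases "f = 0 \<or> (\<exists>v. q = Some v \<and> - v + (g + u) \<in> F)")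
    case True
    thus ?thesis using base assms(1)[OF base(1-3)] reach.base by fastforce
  next
    case False
    thus ?thesis using reach.step[OF reach.base[of base, OF base(1)] base(2,3)] by blast
  qed
next
  case (step q g u1 f1)
  let ?v = "g + u1" let ?g = "g + (u1 + f1 - u1)"
  show ?case
  proof (cases "f = 0 \<or> - ?v + (?g + u) \<in> F")
    case False
    hence "reach base (Some (?g + u)) (?g + (u + f - u))"
      by (intro reach.step[of base "Some ?v" ?g]) (use step reach.step in auto)
    thus ?thesis by blast
  next
    case True
    show ?thesis
    proof (cases "f = 0")
      case True
      have "reach base (Some ?v) ?g" using step reach.step by blast
      thus ?thesis using True by auto
    next
      case False
      define f2 where "f2 = - ?v + (?g + u)"
      have f2: "f2 \<in> F" using True False by (simp add: f2_def)
      have u: "u = - ?g + (?v + f2)" by (simp add: f2_def grp del: add_uminus_conv_diff)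
      \<comment> \<open>As \<open>?g + u\<close> equals \<open>?v + f2\<close>, the new factor is a
        conjugate by \<open>?v\<close> of the conjugate of \<open>f\<close> by \<open>f2\<close>;
        \<open>f3\<close> is the combined element seen from the position before the previous
        step.\<close>
      define f3 where "f3 = f2 + f - f2 + f1"
      have f3: "f3 \<in> F" unfolding f3_def diff_conv_add_uminus by (intro F_add F_uminus f2 step(3) step.prems(2))
      have eq: "?g + (u + f - u) = g + (u1 + f3 - u1)"
        unfolding u f3_def by (simp add: grp del: add_uminus_conv_diff)
      show ?thesis
      proof (cases "f3 = 0")
        case True
        thus ?thesis using eq step by auto
      next
        case False
        thus ?thesis using eq reach.step[OF step(1,2) f3 False step(5)] by metis
      qed
    qed
  qed
next
  case (turn q g l)
  have "g + l + (u + f - u) = g + ((l + u) + f - (l + u)) + l"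
    by (simp add: grp del: add_uminus_conv_diff)
  thus ?case using turn.IH[of "l + u" f] turn U_L reach.turn by metis
qed

lemma reach_all:
  assumes base: "\<And>q g u f v. base q g \<Longrightarrow> u \<in> U \<Longrightarrow> f \<in> F \<Longrightarrow> q = Some v \<Longrightarrow> - v + (g + u) \<in> F \<Longrightarrow> base q (g + (u + f - u))"
  assumes "base q0 g0" "h \<in> L R'"
  shows "\<exists>q. reach base q (g0 + h)"
proof -
  have "\<exists>q. reach base q (g0 + ev s)" if "set s \<subseteq> R' \<times> F" for s using that
  proof (induction s rule: rev_induct)
    case Nil
    thus ?case using reach.base[of base] assms by auto
  next
    case (snoc a s)
    obtain r f where a: "a = (r, f)" by fastforce
    have rf: "r \<in> R'" "f \<in> F" using snoc a by auto
    obtain q where q: "reach base q (g0 + ev s)" using snoc by auto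
    have "\<exists>q. reach base q (g0 + ev s + (r + f - r))"
    proof (cases "r \<in> R")
      case True
      thus ?thesis using reach.turn[OF q] L_gen rf by blast
    next
      case False
      hence "r \<in> U" using rf U'_U by (auto simp: R'_def)
      show ?thesis
        by (rule reach_close[where base = base, OF _ q \<open>r \<in> U\<close> rf(2)]) (rule base)
    qed
    thus ?case by (simp add: a add.assoc)
  qed
  thus ?thesis using assms(3) unfolding L_def by blast
qed

definition start :: "'a fg option \<Rightarrow> 'a fg \<Rightarrow> bool" where
  "start q g \<longleftrightarrow> q = None \<and> g = 0"

text \<open>All windmill translates touching \<open>T v\<close> count as starting positions entered
  through \<open>T v\<close>. A step through \<open>T v\<close> itself then merely changes the
  starting position, as \<open>reach_close\<close> requires, and every genuine first step leaves
  through another translate.\<close>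

definition start_at :: "'a fg \<Rightarrow> 'a fg option \<Rightarrow> 'a fg \<Rightarrow> bool" where
  "start_at v q g \<longleftrightarrow> q = Some v \<and> g \<in> L R' \<and> T v \<inter> tr g W \<noteq> {}"

lemma W_turn: "l \<in> L R \<Longrightarrow> tr (g + l) W = tr g W"
  using W_L by (simp add: tr_tr[symmetric] del: tr_tr)

lemma far_turn: "l \<in> L R \<Longrightarrow> far x v (g + l) = far x v g"
  by (simp add: far_def W_turn)

lemma T_conj_W: "u \<in> U \<Longrightarrow> f \<in> F \<Longrightarrow> T (g + u) \<inter> tr (g + (u + f - u)) W \<noteq> {}"
proof -
  assume h: "u \<in> U" "f \<in> F"
  have "T (g + u) = T (g + (u + f - u) + u)"
    using h by (intro T_coset) (simp add: grp del: add_uminus_conv_diff)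
  thus ?thesis using T_W[OF h(1)] by metis
qed

lemma reach_start:
  assumes "reach start q g" "x \<in> W"
  shows "(q = None \<and> tr g W = W) \<or> (\<exists>v. q = Some v \<and> far x v g \<and> T v \<inter> tr g W \<noteq> {})"
  using assms(1)
proof induction
  case (base q g)
  thus ?case by (simp add: start_def)
next
  case (step q g u f)
  have "far x (g + u) (g + (u + f - u))"
  proof (cases q)
    case None
    thus ?thesis using step assms(2) by (intro far_start) auto
  next
    case (Some v)
    thus ?thesis using step by (intro far_step[of x v]) auto
  qed
  thus ?case using T_conj_W step by blast
next
  case (turn q g l)
  thus ?case by (simp add: W_turn far_turn)
qed

lemma reach_start_at:
  assumes "reach (start_at v0) q g" "x \<in> T v0"
  shows "\<exists>v. q = Some v \<and> T v \<inter> tr g W \<noteq> {} \<and> (v = v0 \<or> far x v g \<and> - g + v \<in> U)"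
  using assms(1)
proof induction
  case (base q g)
  thus ?case by (simp add: start_at_def)
next
  case (step q g u f)
  then obtain v where v: "q = Some v" "T v \<inter> tr g W \<noteq> {}" "v = v0 \<or> far x v g" by blast
  have "far x (g + u) (g + (u + f - u))"
    using v(3)
  proof
    assume "v = v0"
    thus ?thesis using v step assms(2) by (intro far_start'[of x v0]) auto
  next
    assume "far x v g"
    thus ?thesis using v step by (intro far_step[of x v]) auto
  qed
  moreover have "- (g + (u + f - u)) + (g + u) = u + - f"
    by (simp add: grp del: add_uminus_conv_diff)
  hence "- (g + (u + f - u)) + (g + u) \<in> U" using U_F[OF step(2) F_uminus[OF step(3)]] by simp
  ultimately show ?case using T_conj_W step by blast
next
  case (turn q g l)
  then obtain v where v: "q = Some v" "T v \<inter> tr g W \<noteq> {}" "v = v0 \<or> far x v g \<and> - g + v \<in> U" by blast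
  have "- (g + l) + v = - l + (- g + v)" by (simp add: grp del: add_uminus_conv_diff)
  hence "- g + v \<in> U \<Longrightarrow> - (g + l) + v \<in> U" using U_L L_uminus turn by metis
  thus ?case using v turn by (auto simp: W_turn far_turn)
qed

text \<open>A translate at the final position that is the one of arrival was new one step earlier,
  by the rule for steps; so the walk is cut there. Only a starting position has no earlier
  step.\<close>

lemma reach_new:
  assumes "reach base q g" "u \<in> U"
  shows "\<exists>q' g' u'. reach base q' g' \<and> u' \<in> U \<and> - (g + u) + (g' + u') \<in> F \<and>
    ((\<forall>v. q' = Some v \<longrightarrow> - v + (g' + u') \<notin> F) \<or> (base q' g' \<and> (\<exists>v. q' = Some v \<and> - v + (g' + u') \<in> F)))"
  using assms
proof (induction arbitrary: u)
  case (base q g)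
  have "- (g + u) + (g + u) \<in> F" using F_0 by simp
  thus ?case using base reach.base[of base, OF base(1)] by blast
next
  case (step q g u1 f1)
  let ?g = "g + (u1 + f1 - u1)"
  show ?case
  proof (cases "- (g + u1) + (?g + u) \<in> F")
    case True
    moreover have "- (?g + u) + (g + u1) = - (- (g + u1) + (?g + u))" by (simp add: grp del: add_uminus_conv_diff)
    ultimately have "- (?g + u) + (g + u1) \<in> F" using F_uminus by metis
    thus ?thesis using step by blast
  next
    case False
    have "reach base (Some (g + u1)) ?g" using step reach.step by blast
    moreover have "- (?g + u) + (?g + u) \<in> F" using F_0 by simp
    ultimately show ?thesis using False step(7) by blast
  qed
next
  case (turn q g l)
  hence "l + u \<in> U" using U_L by blast
  from turn.IH[OF this] show ?case by (simp only: add.assoc)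
qed

section \<open>Freeness of the enlarged family\<close>

lemma free_run:
  assumes "set s \<subseteq> R' \<times> (F - {0})" "successively (\<lambda>p q. fst p \<noteq> fst q) s"
  shows "set s \<subseteq> R \<times> F \<or> (\<exists>s1 u f s2. s = s1 @ (u, f) # s2 \<and> u \<in> U' \<and> f \<in> F \<and> set s2 \<subseteq> R \<times> F \<and>
    reach start (Some (ev s1 + u)) (ev s1 + (u + f - u)))"
  using assms
\<comment> \<open>The word is read from left to right as a walk: syllables with index in
  \<open>R\<close> are turns, those with index in \<open>U'\<close> are steps, and \<open>s2\<close>
  collects the turns since the last step.\<close>
proof (induction s rule: rev_induct)
  case (snoc a s)
  obtain r f where a: "a = (r, f)" by fastforce
  have rf: "r \<in> R'" "f \<in> F" "f \<noteq> 0" using snoc a by auto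
  have IH: "set s \<subseteq> R \<times> F \<or> (\<exists>s1 u f s2. s = s1 @ (u, f) # s2 \<and> u \<in> U' \<and> f \<in> F \<and> set s2 \<subseteq> R \<times> F \<and>
    reach start (Some (ev s1 + u)) (ev s1 + (u + f - u)))"
    using snoc by (auto simp: successively_append_iff)
  show ?case
  proof (cases "r \<in> R")
    case True
    have sa: "set (x @ [a]) \<subseteq> R \<times> F" if "set x \<subseteq> R \<times> F" for x using that True rf a by auto
    from IH show ?thesis
    proof
      assume "set s \<subseteq> R \<times> F" thus ?thesis using sa by blast
    next
      assume "\<exists>s1 u f s2. s = s1 @ (u, f) # s2 \<and> u \<in> U' \<and> f \<in> F \<and> set s2 \<subseteq> R \<times> F \<and>
        reach start (Some (ev s1 + u)) (ev s1 + (u + f - u))"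
      then obtain s1 u f s2 where "s = s1 @ (u, f) # s2" "u \<in> U'" "f \<in> F" "set s2 \<subseteq> R \<times> F"
        "reach start (Some (ev s1 + u)) (ev s1 + (u + f - u))" by blast
      thus ?thesis using sa[of s2]
        by (intro disjI2 exI[of _ s1] exI[of _ u] exI[of _ f] exI[of _ "s2 @ [a]"]) simp
    qed
  next
    case False
    hence rU: "r \<in> U'" using rf by (simp add: R'_def)
    have "reach start (Some (ev s + r)) (ev s + (r + f - r))"
      using IH
    proof
      assume "set s \<subseteq> R \<times> F"
      hence "ev s \<in> L R" by (auto simp: L_def)
      hence "reach start None (0 + ev s)" by (intro reach.turn reach.base) (auto simp: start_def)
      thus ?thesis using rU U'_U rf by (intro reach.step[of start None]) auto
    next
      assume "\<exists>s1 u f s2. s = s1 @ (u, f) # s2 \<and> u \<in> U' \<and> f \<in> F \<and> set s2 \<subseteq> R \<times> F \<and>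
        reach start (Some (ev s1 + u)) (ev s1 + (u + f - u))"
      then obtain s1 u f1 s2 where s: "s = s1 @ (u, f1) # s2" "u \<in> U'" "f1 \<in> F" "set s2 \<subseteq> R \<times> F"
        and re: "reach start (Some (ev s1 + u)) (ev s1 + (u + f1 - u))" by blast
      have l: "ev s2 \<in> L R" using s by (auto simp: L_def)
      have re: "reach start (Some (ev s1 + u)) (ev s)"
        using reach.turn[OF re l] s by (simp add: add.assoc)
      \<comment> \<open>If the new step used the same translate, r and u would represent the same
        double coset and hence be equal. Then \<open>ev s2\<close> is a conjugate by u of some
        \<open>f2\<close> in \<open>F\<close> that preserves both W and \<open>T u\<close>; a
        nontrivial one would move a common point by more than 11 units, although W covers at most 4
        there. So \<open>ev s2\<close> vanishes, \<open>s2\<close> is empty by freeness of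
        \<open>R\<close>, and two adjacent syllables have equal index.\<close>
      have "- (ev s1 + u) + (ev s + r) \<notin> F"
      proof
        assume "- (ev s1 + u) + (ev s + r) \<in> F"
        moreover have "- (ev s1 + u) + (ev s + r) = f1 + (- u + ev s2 + r)"
          using s by (simp add: grp del: add_uminus_conv_diff)
        ultimately have "- f1 + (f1 + (- u + ev s2 + r)) \<in> F" using F_add F_uminus s by metis
        hence f2: "- u + ev s2 + r \<in> F" unfolding minus_add_cancel .
        hence "equiv_U r u" unfolding equiv_U_def
          by (intro bexI[OF _ l] bexI[OF _ F_uminus[OF f2]]) (simp add: grp del: add_uminus_conv_diff)
        hence ru: "r = u" using U'_unique rU s by blast
        define f2 where "f2 = - u + ev s2 + u"
        have ev2: "ev s2 = u + f2 - u" by (simp add: f2_def grp del: add_uminus_conv_diff)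
        have f2F: "f2 \<in> F" using f2 ru by (simp add: f2_def)
        have "f2 = 0"
        proof (rule ccontr)
          assume "f2 \<noteq> 0"
          have "T u \<inter> W \<noteq> {}" "u \<notin> Orb R" using s(2) U'_U by (auto simp: U_def)
          then obtain c where c: "c \<in> T u" "c \<in> W" by blast
          have "ev s2 + c \<in> T u" using T_conj[OF f2F, of u] c(1) ev2 by (auto simp: tr_def)
          moreover have "ev s2 + c \<in> W" using W_L[OF l] c(2) by (auto simp: tr_def)
          ultimately have "seg c (ev s2 + c) \<subseteq> W \<inter> T u" using c convexD[OF convex_T] convexD[OF convex_W] by blast
          hence "small 11 u (seg c (ev s2 + c))"
            by (rule small_mono[OF W_small[OF \<open>u \<notin> Orb R\<close>]]) simp
          thus False using not_small_displacement[OF c(1) f2F \<open>f2 \<noteq> 0\<close>] ev2 by simp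
        qed
        hence ev0: "ev s2 = 0" using ev2 by simp
        have suc: "successively (\<lambda>p q. fst p \<noteq> fst q) (s1 @ (u, f1) # s2 @ [a])" using snoc.prems s by simp
        hence "successively (\<lambda>p q. fst p \<noteq> fst q) s2"
          by (auto simp: successively_append_iff successively_Cons)
        moreover have "set s2 \<subseteq> R \<times> (F - {0})" using s snoc.prems by auto
        ultimately have "s2 = []" using free_R ev0 unfolding free_def by blast
        thus False using suc ru a by (auto simp: successively_append_iff successively_Cons)
      qed
      thus ?thesis using rU U'_U rf by (intro reach.step[OF re]) auto
    qed
    thus ?thesis using rU rf a by (intro disjI2 exI[of _ s] exI[of _ r] exI[of _ f] exI[of _ "[]"]) simp
  qed
qed simp

text \<open>If the product is 0, a walk with at least one step ends at W itself. But W contains the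
  starting point 0 and therefore also the gate of 0 to the last translate, so nothing of W is far
  behind that translate.\<close>

lemma free_R': "free R'"
  unfolding free_def
proof (intro allI impI, elim conjE)
  fix s assume s: "set s \<subseteq> R' \<times> (F - {0})" "successively (\<lambda>p q. fst p \<noteq> fst q) s" "ev s = 0"
  from free_run[OF s(1,2)] show "s = []"
  proof
    assume "set s \<subseteq> R \<times> F"
    hence "set s \<subseteq> R \<times> (F - {0})" using s(1) by auto
    thus ?thesis using free_R s unfolding free_def by blast
  next
    assume "\<exists>s1 u f s2. s = s1 @ (u, f) # s2 \<and> u \<in> U' \<and> f \<in> F \<and> set s2 \<subseteq> R \<times> F \<and>
        reach start (Some (ev s1 + u)) (ev s1 + (u + f - u))"
    then obtain s1 u f s2 where d: "s = s1 @ (u, f) # s2" "set s2 \<subseteq> R \<times> F"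
      and re: "reach start (Some (ev s1 + u)) (ev s1 + (u + f - u))" by blast
    have "ev s2 \<in> L R" using d by (auto simp: L_def)
    hence "reach start (Some (ev s1 + u)) (ev s)"
      using reach.turn[OF re] d by (simp add: add.assoc)
    hence "far 0 (ev s1 + u) 0 \<and> T (ev s1 + u) \<inter> W \<noteq> {}" using reach_start[OF _ W_0] s(3) by force
    hence fr: "\<And>b. b \<in> W \<Longrightarrow> b \<in> T (ev s1 + u) \<Longrightarrow> \<not> small 6 (ev s1 + u) (seg (gate 0 (T (ev s1 + u))) b)"
      and ne: "W \<inter> T (ev s1 + u) \<noteq> {}" by (auto simp: far_def)
    have "gate 0 (T (ev s1 + u)) \<in> W" using W_0 convex_T ne by (intro gate_meets) auto
    moreover have "gate 0 (T (ev s1 + u)) \<in> T (ev s1 + u)" using T_self convex_T by (intro gate_in) auto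
    ultimately have "\<not> small 6 (ev s1 + u) {gate 0 (T (ev s1 + u))}" using fr[of "gate 0 (T (ev s1 + u))"] by simp
    thus ?thesis using small_mono[OF small_singleton order_refl, of 6] by auto
  qed
qed

section \<open>The enlarged convex set\<close>

definition Z :: "'a fg set" where "Z = (\<Union>g\<in>L R'. tr g (W \<union> (\<Union>u\<in>U. T u)))"

lemma Z_W: "g \<in> L R' \<Longrightarrow> tr g W \<subseteq> Z" and Z_T: "g \<in> L R' \<Longrightarrow> u \<in> U \<Longrightarrow> T (g + u) \<subseteq> Z"
  unfolding Z_def tr_tr[symmetric] by (auto simp: tr_def)

lemma Z_cases:
  assumes "z \<in> Z"
  obtains g where "g \<in> L R'" "z \<in> tr g W" | g u where "g \<in> L R'" "u \<in> U" "z \<in> T (g + u)"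
  using assms unfolding Z_def tr_tr[symmetric] by (auto simp: tr_def)

text \<open>Consecutive windmill translates along a word touch a common translate of
  \<open>C\<close>, which joins them inside \<open>Z\<close>.\<close>

lemma seg_0_W: "g \<in> L R' \<Longrightarrow> z \<in> tr g W \<Longrightarrow> seg 0 z \<subseteq> Z"
proof -
  have "\<forall>z\<in>tr (ev s) W. seg 0 z \<subseteq> Z" if "set s \<subseteq> R' \<times> F" for s
    using that
  proof (induction s rule: rev_induct)
    case Nil
    have "seg 0 z \<subseteq> W" if "z \<in> W" for z using that W_0 convexD[OF convex_W] by blast
    moreover have "W \<subseteq> Z" using Z_W[OF L_0] by simp
    ultimately show ?case by auto
  next
    case (snoc a s)
    obtain r f where a: "a = (r, f)" by fastforce
    have rf: "r \<in> R'" "f \<in> F" using snoc a by auto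
    have IH: "\<forall>z\<in>tr (ev s) W. seg 0 z \<subseteq> Z" and sL: "ev s \<in> L R'" using snoc by (auto simp: L_def)
    show ?case
    proof (cases "r \<in> R")
      case True
      thus ?thesis using IH a W_turn[OF L_gen[OF True rf(2)]] by simp
    next
      case False
      hence rU: "r \<in> U" using rf U'_U by (auto simp: R'_def)
      let ?g = "ev s" let ?h = "r + f - r"
      have gh: "?g + ?h \<in> L R'" using sL rU rf conj_L' L_add by blast
      obtain c d where c: "c \<in> T (?g + r)" "c \<in> tr ?g W" and d: "d \<in> T (?g + r)" "d \<in> tr (?g + ?h) W"
        using T_W[OF rU] T_conj_W[OF rU rf(2)] by blast
      have cd: "seg c d \<subseteq> Z" using c d convexD[OF convex_T] Z_T[OF sL rU] by blast
      have "seg 0 z \<subseteq> Z" if z: "z \<in> tr (?g + ?h) W" for z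
      proof -
        have "convex (tr (?g + ?h) W)" by simp
        hence "seg d z \<subseteq> Z" using d z Z_W[OF gh] unfolding convex_def by blast
        moreover have "seg 0 c \<subseteq> Z" using IH c by blast
        ultimately show ?thesis using cd seg_subset[of 0 z c] seg_subset[of c z d] by blast
      qed
      thus ?thesis by (simp add: a)
    qed
  qed
  thus "g \<in> L R' \<Longrightarrow> z \<in> tr g W \<Longrightarrow> seg 0 z \<subseteq> Z" unfolding L_def by blast
qed

lemma convex_Z: "convex Z"
proof (rule convex_star[of _ 0])
  fix z assume "z \<in> Z"
  thus "seg 0 z \<subseteq> Z"
  proof (cases rule: Z_cases)
    case (1 g)
    thus ?thesis by (rule seg_0_W)
  next
    case (2 g u)
    obtain c where c: "c \<in> T (g + u)" "c \<in> tr g W" using T_W[OF 2(2)] by blast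
    have "seg c z \<subseteq> Z" using c 2 convexD[OF convex_T] Z_T by blast
    thus ?thesis using seg_0_W[OF 2(1) c(2)] seg_subset[of 0 z c] by blast
  qed
qed

lemma tr_Z: assumes "g \<in> L R'" shows "tr g Z = Z"
proof -
  have *: "tr g Z \<subseteq> Z" if "g \<in> L R'" for g
  proof
    fix z assume "z \<in> tr g Z"
    then obtain h where h: "h \<in> L R'" "z \<in> tr g (tr h (W \<union> (\<Union>u\<in>U. T u)))" unfolding Z_def mem_tr[of z g] by (auto simp: mem_tr[of z g])
    thus "z \<in> Z" using L_add[OF that h(1)] unfolding Z_def tr_tr by blast
  qed
  have "tr g (tr (- g) Z) \<subseteq> tr g Z" using *[OF L_uminus[OF assms]] unfolding tr_def by blast
  hence "Z \<subseteq> tr g Z" by simp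
  thus ?thesis using *[OF assms] by blast
qed

lemma disjoint_W: assumes "v \<notin> Orb R'" "g \<in> L R'" shows "T v \<inter> tr g W = {}"
proof (rule ccontr)
  assume "T v \<inter> tr g W \<noteq> {}"
  then obtain z where "- v + z \<in> C" "- g + z \<in> W" unfolding mem_tr[symmetric] by blast
  moreover have "- (- g + v) + (- g + z) = - v + z" by (simp add: grp del: add_uminus_conv_diff)
  ultimately have "- g + z \<in> T (- g + v)" unfolding mem_tr by simp
  hence "T (- g + v) \<inter> W \<noteq> {}" using \<open>- g + z \<in> W\<close> by blast
  hence "- g + v \<in> Orb R'" using U_Orb Orb_mono[OF R'_mono(1)] by (cases "- g + v \<in> Orb R") (auto simp: U_def)
  hence "g + (- g + v) + 0 \<in> Orb R'" using assms F_0 by (intro Orb_translate) auto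
  thus False using assms by (simp add: add.assoc[symmetric])
qed

lemma not_coset: assumes "v \<notin> Orb R'" "w \<in> Orb R'" shows "- v + w \<notin> F" "- w + v \<notin> F"
proof -
  show "- w + v \<notin> F"
  proof
    assume "- w + v \<in> F"
    hence "0 + w + (- w + v) \<in> Orb R'" using assms L_0 by (intro Orb_translate) auto
    thus False using assms by (simp add: add.assoc[symmetric])
  qed
  thus "- v + w \<notin> F" using F_uminus by (metis minus_add minus_minus)
qed

lemma LU_Orb: "g \<in> L R' \<Longrightarrow> u \<in> U \<Longrightarrow> g + u \<in> Orb R'"
  using Orb_translate[of g R' u 0] U_Orb F_0 by simp

text \<open>The reason why \<open>Z\<close> covers little of a translate \<open>T v\<close> not yet
  absorbed. If the two translates met by \<open>T v\<close> were disjoint, a walk would lead from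
  one to the other. A windmill touching both would contain the bridge between them and meet
  \<open>T v\<close>, which misses all windmills. Otherwise the path from x to y inside
  \<open>T v\<close> covers at most one unit of the last translate \<open>v'\<close> on the walk,
  and at most 5 more lead to the windmill behind it, contradicting the more than 6 units given by
  \<open>far\<close>.\<close>

lemma T_meet:
  assumes v: "v \<notin> Orb R'" and g: "g0 \<in> L R'" "g1 \<in> L R'" and u: "u0 \<in> U" "u1 \<in> U"
    and x: "x \<in> T (g0 + u0)" "x \<in> T v" and y: "y \<in> T (g1 + u1)" "y \<in> T v"
  shows "T (g0 + u0) \<inter> T (g1 + u1) \<noteq> {}"
proof
  assume disj: "T (g0 + u0) \<inter> T (g1 + u1) = {}"
  let ?v0 = "g0 + u0"
  have base: "start_at ?v0 q (g + (u + f - u))"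
    if "start_at ?v0 q g" "u \<in> U" "f \<in> F" "q = Some v" "- v + (g + u) \<in> F" for q g u f v
  proof -
    have "T ?v0 = T (g + u)" using that by (intro T_coset) (auto simp: start_at_def)
    thus ?thesis using that conj_L' L_add T_conj_W by (auto simp: start_at_def)
  qed
  have "start_at ?v0 (Some ?v0) g0" using g T_W u by (simp add: start_at_def)
  then obtain q where "reach (start_at ?v0) q (g0 + (- g0 + g1))"
    using reach_all[where base = "start_at ?v0", OF _ _ L_add[OF L_uminus[OF g(1)] g(2)]] base by metis
  hence "reach (start_at ?v0) q g1" by (simp add: add.assoc[symmetric])
  then obtain q' g' u' where re: "reach (start_at ?v0) q' g'" and u': "u' \<in> U"
    and same: "- (g1 + u1) + (g' + u') \<in> F"
    and new: "(\<forall>v. q' = Some v \<longrightarrow> - v + (g' + u') \<notin> F) \<or>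
      (start_at ?v0 q' g' \<and> (\<exists>v. q' = Some v \<and> - v + (g' + u') \<in> F))"
    using reach_new[OF _ u(2)] by blast
  have g': "g' \<in> L R'" using reach_L'[OF re] by (simp add: start_at_def)
  let ?w = "g' + u'"
  have T1: "T (g1 + u1) = T ?w" by (rule T_coset[OF same])
  obtain v' where v': "q' = Some v'" "T v' \<inter> tr g' W \<noteq> {}" "v' = ?v0 \<or> far x v' g' \<and> - g' + v' \<in> U"
    using reach_start_at[OF re x(1)] by blast
  have ne: "- v' + ?w \<notin> F"
  proof
    assume "- v' + ?w \<in> F"
    hence "v' = ?v0" using new v' by (auto simp: start_at_def)
    hence "T ?v0 = T ?w" using \<open>- v' + ?w \<in> F\<close> by (intro T_coset) simp
    thus False using disj T1 T_self by blast
  qed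
  have Tw: "T ?w \<inter> tr g' W \<noteq> {}" by (rule T_W[OF u'])
  have xy: "seg x y \<subseteq> T v" using x y convexD[OF convex_T] by blast
  show False
    using v'(3)
  proof
    assume "v' = ?v0"
    hence "seg x y \<inter> tr g' W \<noteq> {}"
      using v'(2) Tw disj x y T1 convex_T by (intro bridge_meets[of "T ?v0" "T ?w"]) auto
    thus False using xy disjoint_W[OF v g'] by blast
  next
    assume far: "far x v' g' \<and> - g' + v' \<in> U"
    let ?Y = "tr g' W \<union> T ?w"
    have cY: "convex ?Y" using Tw by (intro convex_Un) auto
    have "small (4 + 1) v' ((tr g' W \<inter> T v') \<union> T ?w)"
      using W_small' far T_overlap[OF ne] small_Un by blast
    hence Y5: "small 5 v' (?Y \<inter> T v')" by (rule small_mono) auto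
    let ?x = "gate x (T v')" let ?y = "gate y (T v')"
    have gy: "?y \<in> ?Y" using y T1 v'(2) cY by (intro gate_meets) auto
    have gT: "?x \<in> T v'" "?y \<in> T v'" using T_self convex_T by (auto intro!: gate_in)
    obtain b where b: "b \<in> tr g' W" "b \<in> T v'" using v'(2) by blast
    have "seg ?y b \<subseteq> ?Y \<inter> T v'" using gy gT b convexD[OF cY] convexD[OF convex_T] by blast
    hence yb: "small 5 v' (seg ?y b)" using Y5 small_mono by blast
    have "small 6 v' (seg ?x b)"
    proof (cases "?x = ?y")
      case True
      thus ?thesis using yb by (auto intro: small_mono)
    next
      case False
      hence "seg ?x ?y \<subseteq> seg x y" using T_self by (intro gates_between) auto
      hence "seg ?x ?y \<subseteq> T v" using xy by blast
      moreover have "v' \<in> Orb R'" using LU_Orb[OF g', of "- g' + v'"] far by (simp add: add.assoc[symmetric])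
      hence "small 1 v' (T v)" using not_coset(2)[OF v] by (intro T_overlap)
      ultimately have "small 1 v' (seg ?x ?y)" using small_mono by blast
      hence "small (1 + 5) v' (seg ?x ?y \<union> seg ?y b)" using yb small_Un by blast
      thus ?thesis by (rule small_mono) (simp_all add: seg_subset)
    qed
    thus False using far b unfolding far_def by blast
  qed
qed

text \<open>The 1-neighbourhood makes the windmills exhaust the tree; it costs at most 2 further points, that is, 2 units, on
  a segment.\<close>

definition N :: "'a fg set \<Rightarrow> 'a fg set" where
  "N S = {z. \<exists>y\<in>S. dst z y \<le> 1}"

text \<open>The extreme points of \<open>Z\<close> on the segment lie in translates that meet each
  other. Their union is convex, so it contains all that lies between, and two overlaps cost 2
  units.\<close>

lemma Z_small:
  assumes v: "v \<notin> Orb R'" and e: "e \<in> E" shows "25 * card (Z \<inter> tr v e) \<le> 2 * card e"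
    and "card (N Z \<inter> tr v e) \<le> card (Z \<inter> tr v e) + 2"
proof -
  obtain a b where ab: "tr v e = seg a b" using E_seg[OF e] tr_seg by metis
  have eT: "tr v e \<subseteq> T v" using E_C[OF e] by (auto simp: tr_def)
  let ?S = "Z \<inter> tr v e"
  have fin: "finite ?S" using ab by simp
  have uniq: "x = y" if "x \<in> seg a b" "y \<in> seg a b" "dst a x = dst a y" for x y
    using seg_linear[of x a b y] seg_linear[of y a b x] seg_antisym[of x a y] that by simp
  have level: "card {z \<in> seg a b. dst a z = n} \<le> 1" for n
    using uniq by (simp add: card_le_Suc0_iff_eq)
  have "25 * card ?S \<le> 2 * card e \<and> card (N Z \<inter> tr v e) \<le> card ?S + 2"
  proof (cases "?S = {}")
    case True
    \<comment> \<open>If \<open>Z\<close> misses the segment, all points of the segment project to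
      the same \<open>?q\<close> in \<open>Z\<close>. A point within distance 1 of \<open>Z\<close>
      is adjacent to \<open>?q\<close> and must be the foot of the bridge.\<close>
    have "z = z'" if z: "z \<in> N Z" "z \<in> tr v e" and z': "z' \<in> N Z" "z' \<in> tr v e" for z z'
    proof -
      have c: "convex (tr v e)" using ab by simp
      let ?q = "gate z Z"
      have q': "?q = gate z' Z" using True z z' convex_Z c by (intro gate_disjoint_const[of "tr v e"]) (auto simp: N_def)
      have *: "w = gate ?q (tr v e)" if w: "w \<in> N Z" "w \<in> tr v e" "?q = gate w Z" for w
      proof -
        obtain y where y: "y \<in> Z" "dst w y \<le> 1" using w by (auto simp: N_def)
        have "gate w Z \<in> seg w y" using y convex_Z by (intro gate_seg) auto
        hence d: "dst w ?q \<le> 1" using y w by (auto simp: seg_def)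
        have q: "?q \<in> Z" using y convex_Z by (intro gate_in) auto
        have p: "gate ?q (tr v e) \<in> seg ?q w" "gate ?q (tr v e) \<in> tr v e" using w c by (auto intro!: gate_seg gate_in)
        hence "gate ?q (tr v e) \<noteq> ?q" using q True by auto
        hence "dst ?q (gate ?q (tr v e)) \<noteq> 0" by simp
        hence "dst (gate ?q (tr v e)) w = 0" using p(1) d dst_sym[of w ?q] by (simp add: seg_def del: dst_eq_0)
        thus ?thesis by simp
      qed
      show ?thesis using *[OF z] *[OF z' q'] by simp
    qed
    moreover have "finite (N Z \<inter> tr v e)" using ab by simp
    ultimately have "card (N Z \<inter> tr v e) \<le> 1" by (auto simp: card_le_Suc0_iff_eq)
    thus ?thesis using True by simp
  next
    case False
    obtain x where x: "x \<in> ?S" "\<And>z. z \<in> ?S \<Longrightarrow> dst a x \<le> dst a z"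
      using arg_min_if_finite[OF fin False, of "dst a"] by (metis linorder_not_less)
    obtain y where y: "y \<in> ?S" "\<And>z. z \<in> ?S \<Longrightarrow> dst a z \<le> dst a y"
    proof -
      have "Max (dst a ` ?S) \<in> dst a ` ?S" using fin False by (intro Max_in) auto
      then obtain y where "y \<in> ?S" "dst a y = Max (dst a ` ?S)" by auto
      thus ?thesis using that fin by (metis Max_ge finite_imageI imageI)
    qed
    have xy: "z \<in> seg x y" if "z \<in> seg a b" "dst a x \<le> dst a z" "dst a z \<le> dst a y" for z
    proof -
      have "x \<in> seg a z" "z \<in> seg a y" using seg_linear that x(1) y(1) ab by auto
      thus ?thesis using seg_mono by blast
    qed
    have xyZ: "seg x y \<subseteq> Z" using x(1) y(1) convexD[OF convex_Z] by blast
    have T: "\<exists>g u. g \<in> L R' \<and> u \<in> U \<and> z \<in> T (g + u)" if "z \<in> ?S" for z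
    proof -
      have "z \<in> Z" "z \<in> T v" using that eT by auto
      thus ?thesis using disjoint_W[OF v] by (cases rule: Z_cases) blast+
    qed
    obtain g0 u0 g1 u1 where g: "g0 \<in> L R'" "u0 \<in> U" "x \<in> T (g0 + u0)" "g1 \<in> L R'" "u1 \<in> U" "y \<in> T (g1 + u1)"
      using T[OF x(1)] T[OF y(1)] by blast
    have "T (g0 + u0) \<inter> T (g1 + u1) \<noteq> {}"
      using g x(1) y(1) eT by (intro T_meet[OF v, of g0 g1 u0 u1 x y]) auto
    hence "convex (T (g0 + u0) \<union> T (g1 + u1))" using convex_T by (intro convex_Un)
    hence "seg x y \<subseteq> T (g0 + u0) \<union> T (g1 + u1)" using g unfolding convex_def by blast
    moreover have "?S \<subseteq> seg x y" using xy x(2) y(2) ab by auto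
    ultimately have "?S \<subseteq> T (g0 + u0) \<union> T (g1 + u1)" by blast
    moreover have "small (1 + 1) v (T (g0 + u0) \<union> T (g1 + u1))"
      by (intro small_Un T_overlap not_coset(1)[OF v] LU_Orb g)
    ultimately have "small 2 v ?S" using small_mono one_add_one order_refl by metis
    hence 1: "25 * card ?S \<le> 2 * card e" using e by (auto simp: small_def Int_assoc)
    \<comment> \<open>A point of the neighbourhood outside \<open>Z\<close> is one level before x or
      one level after y. If x is at level 0, the truncated subtraction only adds a level that also
      has at most one point.\<close>
    have "N Z \<inter> tr v e \<subseteq> ?S \<union> {z \<in> seg a b. dst a z = dst a x - 1} \<union> {z \<in> seg a b. dst a z = dst a y + 1}"
    proof
      fix z assume z: "z \<in> N Z \<inter> tr v e"
      show "z \<in> ?S \<union> {z \<in> seg a b. dst a z = dst a x - 1} \<union> {z \<in> seg a b. dst a z = dst a y + 1}"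
      proof (cases "z \<in> Z")
        case False
        obtain y0 where y0: "y0 \<in> Z" "dst z y0 \<le> 1" using z by (auto simp: N_def)
        let ?z = "gate z Z"
        have "?z \<in> seg z y0" using y0 convex_Z by (intro gate_seg) auto
        hence d: "dst z ?z \<le> 1" using y0 by (auto simp: seg_def)
        have "?z \<in> Z" using y0 convex_Z by (intro gate_in) auto
        moreover have "?z \<in> seg z y" using y(1) convex_Z by (intro gate_seg) auto
        hence "?z \<in> tr v e" using z y(1) ab convexD[OF convex_seg] by auto
        ultimately have "dst a x \<le> dst a ?z" "dst a ?z \<le> dst a y" using x(2) y(2) by auto
        moreover have "dst a z \<le> dst a ?z + 1" "dst a ?z \<le> dst a z + 1"
          using d dst_triangle[of a z ?z] dst_triangle[of a ?z z] dst_sym[of z ?z] by auto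
        moreover have "dst a z < dst a x \<or> dst a y < dst a z" using xy[of z] xyZ False z ab by (metis IntD2 linorder_not_less subsetD)
        ultimately show ?thesis using z ab by auto
      qed (use z in simp)
    qed
    hence "card (N Z \<inter> tr v e) \<le> card (?S \<union> {z \<in> seg a b. dst a z = dst a x - 1} \<union> {z \<in> seg a b. dst a z = dst a y + 1})"
      using fin by (intro card_mono) auto
    also have "\<dots> \<le> card ?S + 1 + 1"
      using level card_Un_le[of "?S \<union> {z \<in> seg a b. dst a z = dst a x - 1}" "{z \<in> seg a b. dst a z = dst a y + 1}"]
        card_Un_le[of ?S "{z \<in> seg a b. dst a z = dst a x - 1}"]
      by (meson add_mono order_refl order_trans)
    finally show ?thesis using 1 by simp
  qed
  thus "25 * card (Z \<inter> tr v e) \<le> 2 * card e" "card (N Z \<inter> tr v e) \<le> card (Z \<inter> tr v e) + 2" by auto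
qed

lemma subset_N: "S \<subseteq> N S"
  unfolding N_def by (metis (mono_tags, lifting) dst_same le0 mem_Collect_eq subsetI)

lemma convex_N: assumes "convex S" shows "convex (N S)"
  unfolding convex_def
proof (intro ballI subsetI)
  have near: "z = x \<or> z = y" if "z \<in> seg x y" "dst x y \<le> 1" for x y z :: "'a fg"
  proof -
    have "dst x z = 0 \<or> dst z y = 0" using that by (auto simp: seg_def simp del: dst_eq_0)
    thus ?thesis by auto
  qed
  fix x y z assume h: "x \<in> N S" "y \<in> N S" "z \<in> seg x y"
  obtain x' y' where x': "x' \<in> S" "dst x x' \<le> 1" and y': "y' \<in> S" "dst y y' \<le> 1" using h by (auto simp: N_def)
  have "z \<in> seg x x' \<or> z \<in> seg x' y' \<or> z \<in> seg y' y" using h(3) seg_subset[of x y x'] seg_subset[of x' y y'] by blast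
  moreover have "seg x' y' \<subseteq> S" using x' y' assms convexD by blast
  ultimately show "z \<in> N S" using near[of z x x'] near[of z y y'] h x' y' subset_N[of S] seg_sym[of y' y] by blast
qed

lemma tr_N: "tr g S = S \<Longrightarrow> tr g (N S) = N S"
proof -
  have *: "tr g (N S) \<subseteq> N (tr g S)" for g and S :: "'a fg set"
  proof
    fix z assume "z \<in> tr g (N S)"
    then obtain y where y: "y \<in> S" "dst (- g + z) y \<le> 1" by (auto simp: mem_tr N_def)
    have "dst z (g + y) \<le> 1" using y dst_translate[of g "- g + z" y] by (simp add: add.assoc[symmetric])
    thus "z \<in> N (tr g S)" using y by (auto simp: N_def tr_def)
  qed
  assume S: "tr g S = S"
  have "tr (- g) S = S" using S by (metis tr_tr add.left_inverse tr_0)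
  hence "tr g (tr (- g) (N S)) \<subseteq> tr g (N S)" using *[of "- g" S] by (auto simp: tr_def)
  hence "N S \<subseteq> tr g (N S)" by simp
  thus ?thesis using *[of g S] S by auto
qed

lemma windmill_N_Z: "windmill (N Z) R'"
  unfolding windmill_def
proof (intro conjI allI impI ballI)
  show "convex (N Z)" by (rule convex_N[OF convex_Z])
  show "0 \<in> N Z" using Z_W[OF L_0] W_0 subset_N[of Z] by auto
  show "free R'" by (rule free_R')
  show "tr g (N Z) = N Z" if "g \<in> L R'" for g using tr_N tr_Z that by blast
  fix v assume v: "v \<notin> Orb R'"
  show "small 4 v (N Z \<inter> T v)"
    unfolding small_def
  proof
    fix e assume e: "e \<in> E"
    have "card (N Z \<inter> T v \<inter> tr v e) \<le> card (N Z \<inter> tr v e)" by (rule card_mono) (use finite_E[OF e] in auto)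
    thus "25 * card (N Z \<inter> T v \<inter> tr v e) \<le> 4 * card e" using Z_small[OF v e] E_card[OF e] by linarith
  qed
qed

lemma extension:
  "\<exists>W' R'. windmill W' R' \<and> R \<subseteq> R' \<and> N W \<subseteq> W' \<and> (\<forall>v. T v \<inter> W \<noteq> {} \<longrightarrow> v \<in> Orb R')"
proof (intro exI conjI allI impI)
  show "windmill (N Z) R'" by (rule windmill_N_Z)
  show "R \<subseteq> R'" by (rule R'_mono)
  show "N W \<subseteq> N Z" using Z_W[OF L_0] by (auto simp: N_def)
  show "v \<in> Orb R'" if "T v \<inter> W \<noteq> {}" for v
    using that U_Orb Orb_mono[OF R'_mono(1)] by (cases "v \<in> Orb R") (auto simp: U_def)
qed

end

section \<open>Exhaustion of the tree\<close>

context translates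
begin

lemma windmill_0: "windmill {0} {}"
proof -
  have "L {} = {0}" by (auto simp: L_def)
  moreover have "small 4 v ({0} \<inter> T v)" for v by (rule small_mono[OF small_singleton]) auto
  ultimately show ?thesis by (auto simp: windmill_def convex_def free_def)
qed

lemma predecessor: assumes "nrm z = Suc n" shows "\<exists>y. nrm y = n \<and> dst z y \<le> 1"
proof -
  have ne: "word z \<noteq> []" using assms by (auto simp: nrm_def)
  hence w: "word z = butlast (word z) @ [last (word z)]" by simp
  hence "reduced (butlast (word z))" using reduced_appendD reduced_word by metis
  hence y: "word (Fg (butlast (word z))) = butlast (word z)" by (simp add: Fg_inverse)
  have "dst z (Fg (butlast (word z))) = 1"
    using dst_Gromov[of z "butlast (word z)" "[last (word z)]" "Fg (butlast (word z))" "[]"] w y by simp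
  thus ?thesis using assms y ne by (intro exI[of _ "Fg (butlast (word z))"]) (simp add: nrm_def)
qed

text \<open>Every enlargement includes the 1-neighbourhood, so the n-th windmill contains the ball
  of radius n about 0. Hence \<open>T v\<close> meets the windmill with number \<open>nrm v\<close>
  and is absorbed by the next. Freeness survives the union because a word involves finitely many
  indices.\<close>

theorem free_transversal: "\<exists>R. free R \<and> Orb R = UNIV"
proof -
  let ?P = "\<lambda>p. windmill (fst p) (snd p)"
  let ?Q = "\<lambda>p p'. snd p \<subseteq> snd p' \<and> {z. \<exists>y\<in>fst p. dst z y \<le> 1} \<subseteq> fst p' \<and>
    (\<forall>v. T v \<inter> fst p \<noteq> {} \<longrightarrow> v \<in> Orb (snd p'))"
  have step: "\<exists>p'. ?P p' \<and> ?Q p p'" if "?P p" for p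
  proof -
    interpret windmill_step F C E "fst p" "snd p" by unfold_locales (rule that)
    obtain W' R' where "windmill W' R'" "snd p \<subseteq> R'" "{z. \<exists>y\<in>fst p. dst z y \<le> 1} \<subseteq> W'"
      "\<forall>v. T v \<inter> fst p \<noteq> {} \<longrightarrow> v \<in> Orb R'"
      using extension unfolding N_def by blast
    thus ?thesis by (intro exI[of _ "(W', R')"]) simp
  qed
  have "\<exists>p. ?P p" using windmill_0 by (intro exI[of _ "({0}, {})"]) simp
  then obtain h where "\<forall>n. ?P (h n) \<and> ?Q (h n) (h (Suc n))"
    using dependent_nat_choice[of "\<lambda>_. ?P" "\<lambda>_. ?Q", OF _ step] by blast
  hence h: "\<And>n. ?P (h n)" "\<And>n. ?Q (h n) (h (Suc n))" by blast+
  define R where "R = (\<Union>n. snd (h n))"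
  have mono: "snd (h m) \<subseteq> snd (h n)" if "m \<le> n" for m n
    using lift_Suc_mono_le[of "\<lambda>n. snd (h n)" m n] h that by blast
  have ball: "z \<in> fst (h (nrm z))" for z
  proof (induction "nrm z" arbitrary: z)
    case 0
    thus ?case using h(1)[of 0] by (simp add: windmill_def)
  next
    case (Suc n)
    then obtain y where y: "nrm y = n" "dst z y \<le> 1" using predecessor by metis
    hence "y \<in> fst (h n)" using Suc by metis
    hence "z \<in> fst (h (Suc n))" using y h(2)[of n] by auto
    thus ?case using Suc by simp
  qed
  have "v \<in> Orb R" for v
  proof -
    have "T v \<inter> fst (h (nrm v)) \<noteq> {}" using ball T_self by blast
    hence "v \<in> Orb (snd (h (Suc (nrm v))))" using h(2) by blast
    thus ?thesis using Orb_mono[of "snd (h (Suc (nrm v)))" R] by (auto simp: R_def)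
  qed
  moreover have "free R"
    unfolding free_def
  proof (intro allI impI, elim conjE)
    fix s assume s: "set s \<subseteq> R \<times> (F - {0})" "successively (\<lambda>p q. fst p \<noteq> fst q) s" "ev s = 0"
    have "\<exists>n. set s \<subseteq> snd (h n) \<times> (F - {0})" using s(1)
    proof (induction s)
      case (Cons a s)
      then obtain n where n: "set s \<subseteq> snd (h n) \<times> (F - {0})" by auto
      have "fst a \<in> R" using Cons.prems by auto
      then obtain m where m: "fst a \<in> snd (h m)" unfolding R_def by blast
      have "set (a # s) \<subseteq> snd (h (max m n)) \<times> (F - {0})"
        using n m mono[of m "max m n"] mono[of n "max m n"] Cons.prems by (cases a) auto
      thus ?case by blast
    qed auto
    then obtain n where n: "set s \<subseteq> snd (h n) \<times> (F - {0})" by blast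
    have "free (snd (h n))" using h(1) by (simp add: windmill_def)
    thus "s = []" using n s unfolding free_def by blast
  qed
  ultimately show ?thesis by blast
qed

end

section \<open>Small cancellation\<close>

lemma seg_0_points: "seg 0 x = (\<lambda>k. Fg (take k (word x))) ` {..nrm x}"
proof (intro equalityI subsetI)
  fix z assume "z \<in> seg 0 x"
  then obtain q where q: "word x = word z @ q" by (auto simp: seg_0 prefix_def)
  hence "z = Fg (take (nrm z) (word x))" by (simp add: nrm_def word_inverse)
  thus "z \<in> (\<lambda>k. Fg (take k (word x))) ` {..nrm x}" using q by (intro image_eqI[of _ _ "nrm z"]) (auto simp: nrm_def)
next
  fix z assume "z \<in> (\<lambda>k. Fg (take k (word x))) ` {..nrm x}"
  then obtain k where z: "z = Fg (take k (word x))" by blast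
  have "reduced (take k (word x))" using reduced_appendD[of "take k (word x)" "drop k (word x)"] by simp
  thus "z \<in> seg 0 x" unfolding z by (simp add: seg_0 Fg_inverse take_is_prefix)
qed

lemma card_seg: "card (seg a b) = dst a b + 1"
proof -
  let ?x = "- a + b"
  have "inj_on (\<lambda>k. Fg (take k (word ?x))) {..nrm ?x}"
  proof (rule inj_onI)
    fix k l assume kl: "k \<in> {..nrm ?x}" "l \<in> {..nrm ?x}" "Fg (take k (word ?x)) = Fg (take l (word ?x))"
    have "reduced (take k (word ?x))" for k using reduced_appendD[of "take k (word ?x)" "drop k (word ?x)"] by simp
    hence "take k (word ?x) = take l (word ?x)" using kl(3) by (simp add: Fg_inject)
    hence "length (take k (word ?x)) = length (take l (word ?x))" by simp
    thus "k = l" using kl by (simp add: nrm_def)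
  qed
  hence "card (seg 0 ?x) = nrm ?x + 1" unfolding seg_0_points by (simp add: card_image)
  moreover have "seg a b = tr a (seg 0 ?x)" unfolding tr_seg by simp
  ultimately show ?thesis by (simp add: dst_def)
qed

lemma dst_seg: "x \<in> seg a b \<Longrightarrow> z \<in> seg a b \<Longrightarrow> dst a x \<le> dst a z \<Longrightarrow> dst a x + dst x z = dst a z"
  using seg_linear[of x a b z] by (simp add: seg_def)

text \<open>The summand 100 accounts for a path of length n having n + 1 points.\<close>

lemma card_seg_subset:
  assumes "S \<subseteq> seg a b" "\<And>z z'. z \<in> S \<Longrightarrow> z' \<in> S \<Longrightarrow> 100 * dst z z' \<le> N"
  shows "100 * card S \<le> N + 100"
proof (cases "S = {}")
  case False
  have fin: "finite S" using assms(1) finite_seg by (rule finite_subset)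
  have inj: "inj_on (dst a) S"
  proof (rule inj_onI)
    fix x y assume xy: "x \<in> S" "y \<in> S" "dst a x = dst a y"
    hence "dst a x + dst x y = dst a y" using assms(1) by (intro dst_seg[of _ a b]) auto
    thus "x = y" using xy by simp
  qed
  let ?I = "dst a ` S"
  have I: "finite ?I" "?I \<noteq> {}" using fin False by auto
  obtain x y where x: "x \<in> S" "dst a x = Min ?I" and y: "y \<in> S" "dst a y = Max ?I"
    using Min_in[OF I] Max_in[OF I] by (metis imageE)
  have "dst a x \<le> dst a y" using x(2) y(2) I Min_in[OF I] by simp
  hence "dst a x + dst x y = dst a y" using x y assms(1) by (intro dst_seg[of _ a b]) auto
  moreover have "?I \<subseteq> {Min ?I..Max ?I}" using I by auto
  hence "card ?I \<le> Max ?I + 1 - Min ?I" using card_mono[of "{Min ?I..Max ?I}" ?I] by simp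
  ultimately have "card ?I \<le> dst x y + 1" using x y by simp
  hence "card S \<le> dst x y + 1" using card_image[OF inj] by simp
  moreover have "100 * dst x y \<le> N" using assms(2) x y by blast
  ultimately show ?thesis by simp
qed simp

lemma seg_interval:
  assumes "x \<in> seg a b" "y \<in> seg a b" "z \<in> seg a b" "dst a x \<le> dst a z" "dst a z \<le> dst a y"
  shows "z \<in> seg x y"
proof -
  have "x \<in> seg a z" "z \<in> seg a y" using seg_linear assms by blast+
  thus ?thesis using seg_mono by blast
qed

lemma ex_extremes:
  assumes "S \<subseteq> seg a b" "S \<noteq> {}"
  shows "\<exists>x\<in>S. \<exists>y\<in>S. S \<subseteq> seg x y"
proof -
  have fin: "finite S" using assms(1) finite_seg by (rule finite_subset)
  let ?I = "dst a ` S"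
  have I: "finite ?I" "?I \<noteq> {}" using fin assms by auto
  obtain x y where x: "x \<in> S" "dst a x = Min ?I" and y: "y \<in> S" "dst a y = Max ?I"
    using Min_in[OF I] Max_in[OF I] by (metis imageE)
  have "S \<subseteq> seg x y"
  proof
    fix z assume z: "z \<in> S"
    hence "dst a x \<le> dst a z" "dst a z \<le> dst a y" using x y I by auto
    thus "z \<in> seg x y" using x y z assms(1) by (intro seg_interval[of x a b y z]) auto
  qed
  thus ?thesis using x y by blast
qed

text \<open>In \<open>piece\<close>, a subword of at least one percent of \<open>Y g\<close>
  determines both the factor and the position. The bound 98 is what \<open>E_overlap\<close> needs:
  two overlaps have at most (2n + 200)/100 points, and this is at most (n + 1)/25 exactly when n is
  at least 98.\<close>

locale small_cancellation =
  fixes S :: "'g set" and Y :: "'g \<Rightarrow> 'a fg"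
  assumes pos: "g \<in> S \<Longrightarrow> l \<in> set (word (Y g)) \<Longrightarrow> \<not> snd l"
    and long: "g \<in> S \<Longrightarrow> 98 \<le> nrm (Y g)"
    and piece: "g \<in> S \<Longrightarrow> h \<in> S \<Longrightarrow> word (Y g) = p @ V @ q \<Longrightarrow> word (Y h) = p' @ V @ q' \<Longrightarrow>
      nrm (Y g) \<le> 100 * length V \<Longrightarrow> g = h \<and> p = p'"
begin

section \<open>Paths of words in the generators\<close>

definition val :: "'g \<times> bool \<Rightarrow> 'a fg" where
  "val y = (if snd y then - Y (fst y) else Y (fst y))"

definition be :: "('g \<times> bool) list \<Rightarrow> 'a fg" where
  "be w = sum_list (map val w)"

lemma be_simps [simp]: "be [] = 0" "be (y # w) = val y + be w" "be (u @ w) = be u + be w"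
  by (simp_all add: be_def)

lemma val_inv [simp]: "val (inv_letter y) = - val y"
  by (simp add: val_def inv_letter_def)

lemma be_inv: "be (inv_word w) = - be w"
  by (induction w) (simp_all add: inv_word_Cons minus_add)

lemma be_red: "be (red w) = be w"
proof (induction w)
  case (Cons l w)
  show ?case
  proof (cases "red w")
    case Nil
    thus ?thesis using Cons by (simp add: red_Cons cons_red_def)
  next
    case (Cons m u)
    have "be w = val m + be u" using Cons.IH Cons by simp
    thus ?thesis using Cons by (auto simp: red_Cons cons_red_def add.assoc[symmetric])
  qed
qed simp

definition Wd :: "('g \<times> bool) list set" where
  "Wd = {w. fst ` set w \<subseteq> S}"

lemma Wd_simps [simp]: "[] \<in> Wd" "y # w \<in> Wd \<longleftrightarrow> fst y \<in> S \<and> w \<in> Wd" "u @ w \<in> Wd \<longleftrightarrow> u \<in> Wd \<and> w \<in> Wd"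
  by (auto simp: Wd_def)

lemma Wd_inv [simp]: "inv_word w \<in> Wd \<longleftrightarrow> w \<in> Wd"
  by (simp add: Wd_def inv_word_def image_image inv_letter_def)

lemma Wd_red: "w \<in> Wd \<Longrightarrow> red w \<in> Wd"
proof (induction w)
  case (Cons l w)
  thus ?case by (cases "red w") (auto simp: red_Cons cons_red_def)
qed simp

definition F :: "'a fg set" where "F = be ` Wd"

lemma F_reduced: "f \<in> F \<Longrightarrow> \<exists>w\<in>Wd. reduced w \<and> f = be w"
proof -
  assume "f \<in> F"
  then obtain w where "w \<in> Wd" "f = be w" by (auto simp: F_def)
  thus ?thesis by (intro bexI[of _ "red w"]) (simp_all add: be_red Wd_red)
qed

lemma F_0: "0 \<in> F"
  unfolding F_def by (rule image_eqI[of _ _ "[]"]) auto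
lemma F_add: "f \<in> F \<Longrightarrow> f' \<in> F \<Longrightarrow> f + f' \<in> F"
  unfolding F_def
proof safe
  fix u w assume "u \<in> Wd" "w \<in> Wd"
  thus "be u + be w \<in> be ` Wd" by (intro image_eqI[of _ _ "u @ w"]) auto
qed
lemma F_uminus: "f \<in> F \<Longrightarrow> - f \<in> F"
  unfolding F_def
proof safe
  fix w assume "w \<in> Wd"
  thus "- be w \<in> be ` Wd" by (intro image_eqI[of _ _ "inv_word w"]) (auto simp: be_inv)
qed
lemma F_val: "fst y \<in> S \<Longrightarrow> val y \<in> F"
  unfolding F_def by (rule image_eqI[of _ _ "[y]"]) auto

abbreviation N :: "'g \<times> bool \<Rightarrow> nat" where "N y \<equiv> nrm (Y (fst y))"

lemma nrm_val [simp]: "nrm (val y) = N y"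
  by (simp add: val_def)

definition Seg :: "'a fg \<Rightarrow> 'g \<times> bool \<Rightarrow> 'a fg set" where
  "Seg s y = seg s (s + val y)"

lemma convex_Seg [simp]: "convex (Seg s y)" by (simp add: Seg_def)

lemma Seg_ends: "s \<in> Seg s y" "s + val y \<in> Seg s y" by (simp_all add: Seg_def)

lemma Seg_inv: "Seg (s + val y) (inv_letter y) = Seg s y"
  by (simp add: Seg_def seg_sym add.assoc)

lemma dst_Seg: "z \<in> Seg s y \<Longrightarrow> dst s z + dst (s + val y) z = N y"
  using dst_translate[of s 0 "val y"] by (simp add: Seg_def seg_def dst_sym)

lemma sign_val: assumes "fst y \<in> S" "l \<in> set (word (val y))" shows "snd l = snd y"
proof (cases "snd y")
  case True
  hence "l \<in> inv_letter ` set (word (Y (fst y)))"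
    using assms(2) by (simp add: val_def word_uminus inv_word_def)
  thus ?thesis using True pos[OF assms(1)] by (auto simp: inv_letter_def)
next
  case False
  thus ?thesis using assms pos[OF assms(1)] by (simp add: val_def)
qed

text \<open>For equal signs, a common initial part is a common prefix of two words of the family, or
  a common suffix if both are inverted, and so is shorter than one percent. For opposite signs it is
  empty, because positive and negative letters differ.\<close>

lemma adjacent0:
  assumes "fst y \<in> S" "fst y' \<in> S" "y \<noteq> y'" "z \<in> seg 0 (val y)" "z \<in> seg 0 (val y')"
  shows "100 * nrm z < N y \<and> (snd y \<noteq> snd y' \<longrightarrow> z = 0)"
proof -
  obtain g b where y: "y = (g, b)" by fastforce
  obtain h b' where y': "y' = (h, b')" by fastforce
  have gS: "g \<in> S" "h \<in> S" using assms y y' by auto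
  have pre: "prefix (word z) (word (val y))" "prefix (word z) (word (val y'))" using assms by (auto simp: seg_0)
  have sgn: "snd l = b" if "l \<in> set (word (val y))" for l
    using sign_val[OF assms(1) that] y by simp
  have sgn': "snd l = b'" if "l \<in> set (word (val y'))" for l
    using sign_val[OF assms(2) that] y' by simp
  show ?thesis
  proof (cases "b = b'")
    case False
    have "word z = []"
    proof (rule ccontr)
      assume "word z \<noteq> []"
      then obtain l where "l \<in> set (word z)" by (cases "word z") auto
      hence "snd l = b" "snd l = b'" using pre sgn sgn' set_mono_prefix by blast+
      thus False using False by simp
    qed
    hence "z = 0" by (simp add: word_inject_iff)
    thus ?thesis using long[OF gS(1)] y by simp
  next
    case True
    hence gh: "g \<noteq> h" using assms y y' by auto
    have "\<not> nrm (Y g) \<le> 100 * nrm z"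
    proof
      assume le: "nrm (Y g) \<le> 100 * nrm z"
      show False
      proof (cases b)
        case False
        then obtain q q' where "word (Y g) = [] @ word z @ q" "word (Y h) = [] @ word z @ q'"
          using pre True y y' by (auto simp: val_def prefix_def)
        thus False using piece[OF gS] le gh unfolding nrm_def[of z] by blast
      next
        case b: True
        then obtain q q' where "inv_word (word (Y g)) = word z @ q" "inv_word (word (Y h)) = word z @ q'"
          using pre True y y' by (auto simp: val_def prefix_def word_uminus)
        hence "word (Y g) = inv_word q @ inv_word (word z) @ []" "word (Y h) = inv_word q' @ inv_word (word z) @ []"
          by (metis append_Nil2 inv_word_append inv_word_inv)+
        thus False using piece[OF gS] le gh unfolding nrm_def[of z] by (metis length_inv_word)
      qed
    qed
    thus ?thesis using True y y' by simp
  qed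
qed

lemma adjacent:
  assumes "fst y \<in> S" "fst y' \<in> S" "y' \<noteq> inv_letter y" "z \<in> Seg s y" "z \<in> Seg (s + val y) y'"
  shows "100 * dst (s + val y) z < N y" "100 * dst (s + val y) z < N y'" "snd y = snd y' \<Longrightarrow> z = s + val y"
proof -
  let ?t = "s + val y" let ?z = "- ?t + z"
  have z1: "?z \<in> seg 0 (val (inv_letter y))"
    using assms(4) seg_translate[of z ?t 0 "- val y"] by (simp add: Seg_def seg_sym add.assoc)
  have z2: "?z \<in> seg 0 (val y')"
    using assms(5) seg_translate[of z ?t 0 "val y'"] by (simp add: Seg_def)
  have S': "fst (inv_letter y) \<in> S" using assms by (simp add: inv_letter_def)
  have d: "nrm ?z = dst ?t z" by (simp add: dst_def)
  have 1: "100 * nrm ?z < N (inv_letter y) \<and> (snd (inv_letter y) \<noteq> snd y' \<longrightarrow> ?z = 0)"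
    by (rule adjacent0[OF S' assms(2) _ z1 z2]) (use assms in auto)
  have 2: "100 * nrm ?z < N y'"
    using adjacent0[OF assms(2) S' _ z2 z1] assms by auto
  show "100 * dst (s + val y) z < N y" "100 * dst (s + val y) z < N y'" using 1 2 d by (auto simp: inv_letter_def)
  assume "snd y = snd y'"
  hence "nrm ?z = 0" using 1 by (simp add: inv_letter_def)
  thus "z = s + val y" unfolding d by simp
qed

text \<open>The path enters each segment within one percent of its beginning. By induction its gate
  on the previous segment is near the start of that segment, hence not in the next one, which meets
  it only near its end; \<open>gate_chain\<close> then places the next gate in the
  intersection.\<close>

lemma gate_path:
  assumes "reduced (y # w @ [y'])" "y # w @ [y'] \<in> Wd" "x \<in> Seg s y"
  shows "100 * dst (s + val y + be w) (gate x (Seg (s + val y + be w) y')) < N y'"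
  using assms
proof (induction w arbitrary: y' rule: rev_induct)
  case Nil
  have "gate x (Seg (s + val y) y') \<in> Seg s y"
    using Nil Seg_ends(2)[of s y] Seg_ends(1)[of "s + val y" y'] by (intro gate_meets) auto
  moreover have "gate x (Seg (s + val y) y') \<in> Seg (s + val y) y'"
    using Seg_ends(1)[of "s + val y" y'] by (intro gate_in) auto
  ultimately show ?case using Nil adjacent(2)[of y y' _ s] by auto
next
  case (snoc y1 w)
  let ?u = "s + val y + be w"
  let ?t = "?u + val y1"
  have r: "reduced (y # w @ [y1])" "y' \<noteq> inv_letter y1"
    using snoc.prems(1) reduced_appendD[of "y # w @ [y1]" "[y']"] reduced_appendD[of "y # w" "[y1, y']"] by auto
  have S1: "fst y1 \<in> S" "fst y' \<in> S" using snoc.prems by auto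
  let ?A = "Seg ?u y1" and ?B = "Seg ?t y'"
  have a: "100 * dst ?u (gate x ?A) < N y1" using snoc.IH[of y1] r(1) snoc.prems by simp
  have aA: "gate x ?A \<in> ?A" using Seg_ends(1)[of ?u y1] by (intro gate_in) auto
  have "gate x ?A \<notin> ?B"
  proof
    assume "gate x ?A \<in> ?B"
    hence "100 * dst ?t (gate x ?A) < N y1" using adjacent(1)[OF S1 r(2) aA] by blast
    thus False using a dst_Seg[OF aA] by linarith
  qed
  hence "gate x ?B \<in> ?A" using Seg_ends(2)[of ?u y1] Seg_ends(1)[of ?t y'] by (intro gate_chain) auto
  moreover have "gate x ?B \<in> ?B" using Seg_ends(1)[of ?t y'] by (intro gate_in) auto
  ultimately have "100 * dst ?t (gate x ?B) < N y'" using adjacent(2)[OF S1 r(2)] by blast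
  thus ?case by (simp add: add.assoc)
qed

text \<open>Injectivity of \<open>be\<close>. If the path closes up, 0 is the far end of the last
  segment and its own projection, while \<open>gate_path\<close> puts this projection near the other
  end.\<close>

lemma be_eq_0: assumes "w \<in> Wd" "reduced w" "be w = 0" shows "w = []"
proof (rule ccontr)
  assume "w \<noteq> []"
  then obtain w0 y' where w: "w = w0 @ [y']" by (metis rev_exhaust)
  have y': "fst y' \<in> S" using assms w by simp
  show False
  proof (cases w0)
    case Nil
    hence "nrm (val y') = 0" using assms w by simp
    thus False using long[OF y'] unfolding nrm_val by linarith
  next
    case (Cons y m)
    let ?t = "val y + be m"
    have t: "?t + val y' = 0" using assms w Cons by (simp add: add.assoc)
    hence "0 \<in> Seg ?t y'" using Seg_ends(2)[of ?t y'] by simp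
    moreover have "100 * dst (0 + val y + be m) (gate 0 (Seg (0 + val y + be m) y')) < N y'"
      using assms w Cons Seg_ends(1)[of 0 y] by (intro gate_path) auto
    ultimately have "100 * dst ?t 0 < N y'" by simp
    moreover have "dst ?t 0 = N y'" using dst_translate[of ?t 0 "val y'"] t by simp
    ultimately show False by simp
  qed
qed

section \<open>Segments crossed by a path\<close>

definition crosses :: "'a fg \<Rightarrow> 'a fg \<Rightarrow> 'a fg \<Rightarrow> 'g \<times> bool \<Rightarrow> bool" where
  "crosses p q t y \<longleftrightarrow> fst y \<in> S \<and> (\<exists>z z'. z \<in> Seg t y \<and> z' \<in> Seg t y \<and> seg z z' \<subseteq> seg p q \<and>
     98 * N y \<le> 100 * dst z z')"

text \<open>\<open>gate_path\<close> is applied from both ends, to the word and to its inverse: at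
  most one percent of the first middle segment is lost on either side.\<close>

lemma crosses_middle:
  assumes "reduced (y # m @ [y'])" "y # m @ [y'] \<in> Wd" "m \<noteq> []" "p \<in> Seg s y" "q \<in> Seg (s + val y + be m) y'"
  shows "crosses p q (s + val y) (hd m)"
proof -
  obtain y1 m' where m: "m = y1 # m'" using assms by (cases m) auto
  let ?t = "s + val y"
  let ?t' = "?t + val y1"
  have r: "reduced ([y] @ [y1])" "reduced (y1 # m' @ [y'])" using assms(1) m by auto
  have S1: "fst y \<in> S" "fst y1 \<in> S" using assms(2) m by auto
  let ?z = "gate p (Seg ?t y1)" and ?z' = "gate q (Seg ?t y1)"
  have z: "100 * dst ?t ?z < N y1"
    using gate_path[of y "[]" y1 p s] r S1 assms by auto
  have "reduced (inv_word (y1 # m' @ [y']))" using r by (simp only: reduced_inv_word)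
  hence r': "reduced (inv_letter y' # inv_word m' @ [inv_letter y1])" by (simp add: inv_word_Cons)
  have w': "inv_letter y' # inv_word m' @ [inv_letter y1] \<in> Wd" using assms(2) m by (simp add: inv_letter_def)
  let ?e = "s + val y + be m + val y'"
  have "q \<in> Seg ?e (inv_letter y')" using assms(5) Seg_inv by simp
  from gate_path[OF r' w' this]
  have "100 * dst (?e + val (inv_letter y') + be (inv_word m')) (gate q (Seg (?e + val (inv_letter y') + be (inv_word m')) (inv_letter y1))) < N (inv_letter y1)" .
  moreover have "?e + val (inv_letter y') + be (inv_word m') = ?t'"
    by (simp add: m be_inv grp del: add_uminus_conv_diff)
  ultimately have z': "100 * dst ?t' ?z' < N y1" using Seg_inv[of ?t y1] by (simp add: inv_letter_def)
  have zs: "?z \<in> Seg ?t y1" "?z' \<in> Seg ?t y1" using Seg_ends(1)[of ?t y1] by (auto intro!: gate_in)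
  have "?z \<noteq> ?z'" using z z' dst_Seg[OF zs(1)] by auto
  hence "seg ?z ?z' \<subseteq> seg p q" using Seg_ends(1)[of ?t y1] by (intro gates_between) auto
  moreover have "dst ?t ?t' = N y1" using dst_translate[of ?t 0 "val y1"] by simp
  hence "N y1 \<le> dst ?t ?z + dst ?z ?z' + dst ?t' ?z'"
    using dst_triangle[of ?t ?t' ?z] dst_triangle[of ?z ?t' ?z'] dst_sym[of ?t' ?z'] by linarith
  hence "98 * N y1 \<le> 100 * dst ?z ?z'" using z z' by linarith
  ultimately show ?thesis unfolding crosses_def using zs S1 m by auto
qed

text \<open>The segments of p and q are attached to w as first and last letters, each traversed in
  the direction that does not cancel against w. The excluded words are those for which the two
  segments share an endpoint, so that nothing remains between them.\<close>

lemma crosses_path: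
  assumes w: "w \<in> Wd" "reduced w" and gh: "g \<in> S" "h \<in> S"
    and p: "p \<in> seg s (s + Y g)" and q: "q \<in> seg (s + be w) (s + be w + Y h)"
    and ne: "w \<noteq> []" "w \<noteq> [(g, False)]" "w \<noteq> [(h, True)]" "w \<noteq> [(g, False), (h, True)]"
  shows "\<exists>f\<in>F. \<exists>y. crosses p q (s + f) y"
proof -
  let ?a = "(g, False)" and ?b = "(h, False)"
  have ab: "inv_letter ?a = (g, True)" "inv_letter ?b = (h, True)" "val ?a = Y g" "val ?b = Y h"
    by (simp_all add: inv_letter_def val_def)
  have pa: "p \<in> Seg s ?a" using p by (simp add: Seg_def ab)
  have pa': "p \<in> Seg (s + Y g) (inv_letter ?a)" using pa Seg_inv[of s ?a] ab by simp
  have qb: "q \<in> Seg (s + be w) ?b" using q by (simp add: Seg_def ab)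
  have qb': "q \<in> Seg (s + be w + Y h) (inv_letter ?b)" using qb Seg_inv[of "s + be w" ?b] ab by simp
  have Fa: "val ?a \<in> F" using F_val[of ?a] gh by simp
  show ?thesis
  proof (cases "hd w = ?a")
    case True
    then obtain w1 where w1: "w = ?a # w1" using ne by (cases w) auto
    hence w1ne: "w1 \<noteq> []" using ne by auto
    show ?thesis
    proof (cases "last w = inv_letter ?b")
      case True
      then obtain m where m: "w1 = m @ [inv_letter ?b]" using w1 w1ne by (metis append_butlast_last_id last_ConsR)
      have "m \<noteq> []" using m w1 ne ab by auto
      moreover have "s + val ?a + be m = s + be w + Y h" using m w1 ab by (simp add: grp val_def del: add_uminus_conv_diff)
      ultimately have "crosses p q (s + val ?a) (hd m)"
        using w w1 m pa qb' by (intro crosses_middle[of ?a m "inv_letter ?b"]) auto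
      thus ?thesis using Fa by blast
    next
      case False
      have "reduced (w @ [?b])" using w False ne by (simp add: reduced_append) (metis inv_letter_inv)
      moreover have "s + val ?a + be w1 = s + be w" using w1 by (simp add: add.assoc)
      ultimately have "crosses p q (s + val ?a) (hd w1)"
        using w w1 w1ne pa qb gh by (intro crosses_middle[of ?a w1 ?b]) auto
      thus ?thesis using Fa by blast
    qed
  next
    case False
    have r: "reduced (inv_letter ?a # w)" using w False ne by (cases w) auto
    show ?thesis
    proof (cases "last w = inv_letter ?b")
      case True
      then obtain m where m: "w = m @ [inv_letter ?b]" using ne by (metis append_butlast_last_id)
      have "m \<noteq> []" using m ne ab by auto
      moreover have "s + Y g + val (inv_letter ?a) + be m = s + be w + Y h" using m by (simp add: grp val_def inv_letter_def del: add_uminus_conv_diff)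
      ultimately have "crosses p q (s + Y g + val (inv_letter ?a)) (hd m)"
        using w m r pa' qb' gh ab by (intro crosses_middle[of "inv_letter ?a" m "inv_letter ?b"]) auto
      hence "crosses p q (s + 0) (hd m)" by (simp add: val_def inv_letter_def add.assoc)
      thus ?thesis using F_0 by blast
    next
      case False
      have "reduced (inv_letter ?a # w @ [?b])" using r False ne reduced_append[of "inv_letter ?a # w" "[?b]"] by (metis append_Cons inv_letter_inv last_ConsR list.sel(1) reduced_singleton)
      moreover have "s + Y g + val (inv_letter ?a) + be w = s + be w" by (simp add: grp val_def inv_letter_def del: add_uminus_conv_diff)
      ultimately have "crosses p q (s + Y g + val (inv_letter ?a)) (hd w)"
        using w ne pa' qb gh ab by (intro crosses_middle[of "inv_letter ?a" w ?b]) auto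
      hence "crosses p q (s + 0) (hd w)" by (simp add: val_def inv_letter_def add.assoc)
      thus ?thesis using F_0 by blast
    qed
  qed
qed

section \<open>Overlap and displacement of translates\<close>

definition E :: "'a fg set set" where
  "E = {seg f (f + Y g) |f g. f \<in> F \<and> g \<in> S}"

lemma E_I: "f \<in> F \<Longrightarrow> g \<in> S \<Longrightarrow> seg f (f + Y g) \<in> E"
  unfolding E_def by blast

text \<open>\<open>F\<close> is included for the case that S is empty and there are no
  segments.\<close>

definition C :: "'a fg set" where
  "C = F \<union> \<Union>E"

lemma Seg_E: "f \<in> F \<Longrightarrow> fst y \<in> S \<Longrightarrow> Seg f y \<in> E"
proof -
  assume f: "f \<in> F" "fst y \<in> S"
  show ?thesis
  proof (cases "snd y")
    case True
    hence "Seg f y = seg (f + val y) (f + val y + Y (fst y))"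
      by (simp add: Seg_def seg_sym val_def add.assoc)
    thus ?thesis using f F_add F_val unfolding E_def by blast
  next
    case False
    thus ?thesis using f unfolding E_def Seg_def val_def by auto
  qed
qed

lemma C_cases: assumes "c \<in> C" "S \<noteq> {}" obtains s g where "s \<in> F" "g \<in> S" "c \<in> seg s (s + Y g)"
proof -
  obtain g where g: "g \<in> S" using assms by blast
  show ?thesis
  proof (cases "c \<in> F")
    case True
    thus ?thesis using that[OF True g] by simp
  next
    case False
    thus ?thesis using assms(1) that unfolding C_def E_def by blast
  qed
qed

text \<open>The common stretch spells a subword of both words. It is read in the same direction in
  both, since a nonempty positive word is not the inverse of a positive word; \<open>piece\<close>
  then gives equal factors and positions, hence equal base points.\<close>

lemma aligned:
  assumes gh: "g \<in> S" "h \<in> S" and z: "z \<in> seg t (t + Y g)" "z \<in> seg t' (t' + Y h)"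
    and z': "z' \<in> seg t (t + Y g)" "z' \<in> seg t' (t' + Y h)"
    and long: "nrm (Y g) \<le> 100 * dst z z' \<or> nrm (Y h) \<le> 100 * dst z z'" "z \<noteq> z'"
  shows "t = t'"
proof -
  have wlog: "t = t'"
    if gh: "g \<in> S" "h \<in> S" and z: "z \<in> seg t (t + Y g)" "z \<in> seg t' (t' + Y h)"
      and z': "z' \<in> seg t (t + Y g)" "z' \<in> seg t' (t' + Y h)"
      and long: "nrm (Y g) \<le> 100 * dst z z'" and ne: "z \<noteq> z'" and le: "nrm (- t + z) \<le> nrm (- t + z')"
    for t t' z z' g h
  proof -
    have pre: "prefix (word (- u + x)) (word (Y k))" if "x \<in> seg u (u + Y k)" for u x k
      using that seg_translate[of x u 0 "Y k"] by (simp add: seg_0)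
    have diff: "- x + y = - (- u + x) + (- u + y)" for u x y :: "'a fg" by (simp add: grp del: add_uminus_conv_diff)
    let ?a = "word (- t + z)" and ?a' = "word (- t + z')" and ?b = "word (- t' + z)" and ?b' = "word (- t' + z')"
    have "prefix ?a ?a'" using pre[OF z(1)] pre[OF z'(1)] le prefix_length_prefix by (auto simp: nrm_def)
    then obtain V where V: "?a' = ?a @ V" by (auto simp: prefix_def)
    obtain q where q: "word (Y g) = ?a' @ q" using pre[OF z'(1)] by (auto simp: prefix_def)
    have wV: "word (- z + z') = V" using word_diff[of "- t + z" ?a "[]" "- t + z'" V] V diff[of z z' t] by simp
    have "V \<noteq> []" using wV ne by (metis word_0 word_inject_iff neg_eq_iff_add_eq_0 minus_minus add.inverse_unique minus_equation_iff)
    have posV: "\<not> snd l" if "l \<in> set V" for l using pos[OF gh(1), of l] q V that by auto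
    have "prefix ?b ?b'"
    proof (rule ccontr)
      assume "\<not> prefix ?b ?b'"
      hence "prefix ?b' ?b" using pre[OF z(2)] pre[OF z'(2)] prefix_same_cases by blast
      then obtain V' where V': "?b = ?b' @ V'" by (auto simp: prefix_def)
      have "word (- z + z') = inv_word V'" using word_diff[of "- t' + z" ?b' V' "- t' + z'" "[]"] V' diff[of z z' t'] by simp
      hence V'2: "V = inv_word V'" using wV by simp
      obtain q' where "word (Y h) = ?b @ q'" using pre[OF z(2)] by (auto simp: prefix_def)
      hence "\<not> snd l" if "l \<in> set V'" for l using pos[OF gh(2), of l] V' that by auto
      hence "snd l" if "l \<in> set V" for l using that V'2 by (auto simp: inv_word_def inv_letter_def)
      thus False using posV \<open>V \<noteq> []\<close> by (cases V) auto
    qed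
    then obtain V' where V': "?b' = ?b @ V'" by (auto simp: prefix_def)
    have "word (- z + z') = V'" using word_diff[of "- t' + z" ?b "[]" "- t' + z'" V'] V' diff[of z z' t'] by simp
    hence V'2: "V' = V" using wV by simp
    obtain q' where q': "word (Y h) = ?b' @ q'" using pre[OF z'(2)] by (auto simp: prefix_def)
    have "dst z z' = length V" using wV by (simp add: dst_def nrm_def)
    hence "g = h \<and> ?a = ?b" using piece[OF gh, of ?a V q ?b q'] q q' V V' V'2 long by simp
    hence "- t + z = - t' + z" by (simp add: word_inject_iff)
    thus ?thesis by simp
  qed
  have wlog2: "t = t'"
    if gh: "g \<in> S" "h \<in> S" and z: "z \<in> seg t (t + Y g)" "z \<in> seg t' (t' + Y h)"
      and z': "z' \<in> seg t (t + Y g)" "z' \<in> seg t' (t' + Y h)"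
      and long: "nrm (Y g) \<le> 100 * dst z z'" and ne: "z \<noteq> z'"
    for t t' z z' g h
    using wlog[OF gh z z' long ne] wlog[OF gh z' z _ ne[symmetric]] long dst_sym[of z z'] by (metis nat_le_linear)
  show ?thesis using long(1) wlog2[OF gh z z' _ long(2)] wlog2[OF gh(2,1) z(2,1) z'(2,1) _ long(2)] by metis
qed

text \<open>The extreme points x and y of the overlap lie on two segments of the translate. If these
  did not meet, the path from x to y, which runs inside e, would cross 98 percent of a further
  segment, and \<open>aligned\<close> would put v into \<open>F\<close>. So the two segments form a
  convex set covering the overlap, and each contributes at most one percent and one point.\<close>

lemma E_overlap:
  assumes e: "e \<in> E" and v: "v \<notin> F"
  shows "25 * card (tr v C \<inter> e) \<le> card e"
proof -
  obtain f g where f: "f \<in> F" "g \<in> S" "e = seg f (f + Y g)" using e by (auto simp: E_def)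
  have ce: "card e = nrm (Y g) + 1" using dst_translate[of f 0 "Y g"] f by (simp add: card_seg)
  have no: "f \<noteq> v + s" if "s \<in> F" for s
  proof
    assume "f = v + s"
    hence "v = f + - s" by (simp add: grp del: add_uminus_conv_diff)
    thus False using v f that F_add F_uminus by blast
  qed
  have Sne: "S \<noteq> {}" using f by blast
  show ?thesis
  proof (cases "tr v C \<inter> e = {}")
    case False
    then obtain x y where xy: "x \<in> tr v C \<inter> e" "y \<in> tr v C \<inter> e" "tr v C \<inter> e \<subseteq> seg x y"
      using ex_extremes[of "tr v C \<inter> e" f "f + Y g"] f by blast
    obtain s1 g1 where 1: "s1 \<in> F" "g1 \<in> S" "- v + x \<in> seg s1 (s1 + Y g1)"
      by (rule C_cases[of "- v + x"]) (use xy(1) Sne in \<open>auto simp: mem_tr\<close>)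
    obtain s2 g2 where 2: "s2 \<in> F" "g2 \<in> S" "- v + y \<in> seg s2 (s2 + Y g2)"
      by (rule C_cases[of "- v + y"]) (use xy(2) Sne in \<open>auto simp: mem_tr\<close>)
    let ?e1 = "seg (v + s1) (v + s1 + Y g1)" and ?e2 = "seg (v + s2) (v + s2 + Y g2)"
    have xe: "x \<in> ?e1" "y \<in> ?e2" using 1(3) 2(3) by (simp_all add: seg_translate[symmetric] add.assoc)
    have "- s1 + s2 \<in> F" using 1 2 F_add F_uminus by blast
    then obtain w where w: "w \<in> Wd" "reduced w" "- s1 + s2 = be w" using F_reduced by blast
    have s2: "s2 = s1 + be w" by (simp add: w(3)[symmetric] add.assoc[symmetric])
    have xye: "seg x y \<subseteq> e" using xy f convexD[OF convex_seg] by blast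
    have meet: "?e1 \<inter> ?e2 \<noteq> {}"
    proof (cases "w = [] \<or> w = [(g1, False)] \<or> w = [(g2, True)] \<or> w = [(g1, False), (g2, True)]")
      case True
      hence "v + s1 = v + s2 \<or> v + s1 + Y g1 = v + s2 \<or> v + s1 = v + s2 + Y g2 \<or> v + s1 + Y g1 = v + s2 + Y g2"
        using s2 by (auto simp: val_def add.assoc)
      moreover have "v + s1 \<in> ?e1" "v + s1 + Y g1 \<in> ?e1" "v + s2 \<in> ?e2" "v + s2 + Y g2 \<in> ?e2" by simp_all
      ultimately show ?thesis by (metis IntI empty_iff)
    next
      case False
      have "- v + y \<in> seg (s1 + be w) (s1 + be w + Y g2)" using 2(3) unfolding s2 .
      from crosses_path[OF w(1,2) 1(2) 2(2) 1(3) this] False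
      obtain t y1 where t: "t \<in> F" "crosses (- v + x) (- v + y) (s1 + t) y1" by blast
      then obtain z z' where z: "fst y1 \<in> S" "z \<in> Seg (s1 + t) y1" "z' \<in> Seg (s1 + t) y1"
        "seg z z' \<subseteq> seg (- v + x) (- v + y)" "98 * N y1 \<le> 100 * dst z z'" unfolding crosses_def by blast
      have N: "98 \<le> N y1" using long[OF z(1)] .
      have "Seg (s1 + t) y1 \<in> E" using 1 t z F_add by (intro Seg_E)
      then obtain t1 g3 where t1: "t1 \<in> F" "g3 \<in> S" "Seg (s1 + t) y1 = seg t1 (t1 + Y g3)" by (auto simp: E_def)
      have "card (Seg (s1 + t) y1) = N y1 + 1" using dst_translate[of "s1 + t" 0 "val y1"] by (simp add: Seg_def card_seg)
      moreover have "card (seg t1 (t1 + Y g3)) = nrm (Y g3) + 1" using dst_translate[of t1 0 "Y g3"] by (simp add: card_seg)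
      ultimately have N3: "N y1 = nrm (Y g3)" using t1 by simp
      have "f = v + t1"
      proof (rule aligned[OF f(2) t1(2)])
        have "tr v (seg z z') \<subseteq> tr v (seg (- v + x) (- v + y))" using z(4) by (auto simp: tr_def)
        hence "seg (v + z) (v + z') \<subseteq> seg x y" unfolding tr_seg by (simp add: add.assoc[symmetric])
        hence "seg (v + z) (v + z') \<subseteq> e" using xye by blast
        thus "v + z \<in> seg f (f + Y g)" "v + z' \<in> seg f (f + Y g)" using f seg_ends by blast+
        show "v + z \<in> seg (v + t1) (v + t1 + Y g3)" "v + z' \<in> seg (v + t1) (v + t1 + Y g3)"
          using z(2,3) t1(3) by (simp_all add: add.assoc seg_translate add.assoc[symmetric, of "- v" v])
        show "nrm (Y g) \<le> 100 * dst (v + z) (v + z') \<or> nrm (Y g3) \<le> 100 * dst (v + z) (v + z')"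
          using z(5) N3 by simp
        show "v + z \<noteq> v + z'" using z(5) N by auto
      qed
      thus ?thesis using no t1 by blast
    qed
    have pc: "100 * card (seg (v + s) (v + s + Y h) \<inter> e) \<le> nrm (Y g) + 100" if s: "s \<in> F" "h \<in> S" for s h
    proof (rule card_seg_subset)
      show "seg (v + s) (v + s + Y h) \<inter> e \<subseteq> seg f (f + Y g)" using f by blast
      fix z z' assume z: "z \<in> seg (v + s) (v + s + Y h) \<inter> e" "z' \<in> seg (v + s) (v + s + Y h) \<inter> e"
      show "100 * dst z z' \<le> nrm (Y g)"
      proof (rule ccontr)
        assume "\<not> 100 * dst z z' \<le> nrm (Y g)"
        moreover from this have "z \<noteq> z'" by auto
        ultimately have "f = v + s" using z f s by (intro aligned[of g h z f "v + s" z']) auto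
        thus False using no s by blast
      qed
    qed
    have "convex (?e1 \<union> ?e2)" using meet by (intro convex_Un) auto
    hence "seg x y \<subseteq> ?e1 \<union> ?e2" using xe unfolding convex_def by blast
    hence "tr v C \<inter> e \<subseteq> (?e1 \<inter> e) \<union> (?e2 \<inter> e)" using xy(3) by blast
    hence "card (tr v C \<inter> e) \<le> card ((?e1 \<inter> e) \<union> (?e2 \<inter> e))" by (rule card_mono[rotated]) simp
    also have "\<dots> \<le> card (?e1 \<inter> e) + card (?e2 \<inter> e)" by (rule card_Un_le)
    finally have "100 * card (tr v C \<inter> e) \<le> 2 * nrm (Y g) + 200" using pc[OF 1(1,2)] pc[OF 2(1,2)] by simp
    thus ?thesis using ce long[OF f(2)] by simp
  qed simp
qed

text \<open>The extreme case of displacement. Two consecutive copies of a positive word do not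
  backtrack at \<open>?t\<close>, so the path consists of the end of the first segment after c and
  the beginning of the second up to the same offset. The lengths add up to that of the word, so one
  part is at least half: 25/2 exceeds 11.\<close>

lemma adjacent_displacement:
  assumes "g \<in> S" "c \<in> seg s (s + Y g)" "c' \<in> seg (s + Y g) (s + Y g + Y g)" "dst s c = dst (s + Y g) c'"
  shows "25 * card (seg c c' \<inter> seg s (s + Y g)) > 11 * (nrm (Y g) + 1) \<or>
    25 * card (seg c c' \<inter> seg (s + Y g) (s + Y g + Y g)) > 11 * (nrm (Y g) + 1)"
proof -
  let ?t = "s + Y g" and ?a = "(g, False)"
  have S1: "Seg s ?a = seg s ?t" "Seg ?t ?a = seg ?t (?t + Y g)" "val ?a = Y g" by (simp_all add: Seg_def val_def)
  have "gate c (Seg ?t ?a) \<in> Seg s ?a"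
  proof (rule gate_meets)
    have "?t \<in> Seg s ?a" "?t \<in> Seg ?t ?a" using S1 by simp_all
    thus "Seg s ?a \<inter> Seg ?t ?a \<noteq> {}" by blast
  qed (use assms S1 in simp_all)
  moreover have "gate c (Seg ?t ?a) \<in> Seg ?t ?a" using Seg_ends(1)[of ?t ?a] by (intro gate_in) auto
  ultimately have "gate c (Seg ?t ?a) = ?t"
    using adjacent(3)[of ?a ?a _ s] assms(1) S1(3) by (auto simp: inv_letter_def)
  moreover have "gate c (Seg ?t ?a) \<in> seg c c'" using assms(3) S1 by (intro gate_seg) auto
  ultimately have t: "?t \<in> seg c c'" by simp
  have "seg c ?t \<subseteq> seg c c'" "seg ?t c' \<subseteq> seg c c'" using t convexD[OF convex_seg] seg_ends by blast+
  moreover have "seg c ?t \<subseteq> seg s ?t" "seg ?t c' \<subseteq> seg ?t (?t + Y g)"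
    using assms(2,3) convexD[OF convex_seg] seg_ends by blast+
  ultimately have "card (seg c ?t) \<le> card (seg c c' \<inter> seg s ?t)" "card (seg ?t c') \<le> card (seg c c' \<inter> seg ?t (?t + Y g))"
    by (auto intro!: card_mono)
  moreover have "dst c ?t + dst ?t c' = nrm (Y g)"
    using dst_Seg[of c s ?a] assms S1 dst_sym[of c ?t] by simp
  ultimately have *: "dst c ?t + 1 \<le> card (seg c c' \<inter> seg s ?t)"
    "dst ?t c' + 1 \<le> card (seg c c' \<inter> seg ?t (?t + Y g))" "dst c ?t + dst ?t c' = nrm (Y g)"
    unfolding card_seg by blast+
  have "11 * (n + 1) < 25 * a' \<or> 11 * (n + 1) < 25 * b'"
    if "a + 1 \<le> a'" "b + 1 \<le> b'" "a + b = n" "98 \<le> n" for a b n a' b' :: nat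
  proof -
    have "22 * (n + 1) < 50 * a'" if "b \<le> a" using that \<open>a + 1 \<le> a'\<close> \<open>a + b = n\<close> by auto
    moreover have "22 * (n + 1) < 50 * b'" if "a \<le> b" using that \<open>b + 1 \<le> b'\<close> \<open>a + b = n\<close> by auto
    ultimately show ?thesis by (cases "a \<le> b") auto
  qed
  from this[OF * long[OF assms(1)]] show ?thesis .
qed

lemma F_displacement:
  assumes c: "c \<in> C" and f: "f \<in> F" "f \<noteq> 0"
  shows "\<exists>e\<in>E. 25 * card (seg c (f + c) \<inter> e) > 11 * card e"
proof -
  have Sne: "S \<noteq> {}"
  proof
    assume "S = {}"
    hence "Wd = {[]}" unfolding Wd_def by auto
    thus False using f by (simp add: F_def)
  qed
  obtain s g where s: "s \<in> F" "g \<in> S" "c \<in> seg s (s + Y g)" using c Sne by (rule C_cases)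
  have "- s + (f + s) \<in> F" using s f F_add F_uminus by blast
  then obtain w where w: "w \<in> Wd" "reduced w" "- s + (f + s) = be w" using F_reduced by blast
  have fs: "f + s = s + be w" by (simp add: w(3)[symmetric] add.assoc[symmetric])
  have wne: "w \<noteq> []"
  proof
    assume "w = []"
    hence "f + s = 0 + s" using fs by simp
    thus False using f by (simp only: add_right_cancel)
  qed
  have fc: "f + c \<in> seg (f + s) (f + s + Y g)" using s(3) by (simp add: seg_translate add.assoc)
  have cE: "card (seg t (t + Y h)) = nrm (Y h) + 1" for t h using dst_translate[of t 0 "Y h"] by (simp add: card_seg)
  have fsF: "f + s \<in> F" using f s F_add by blast
  have d: "dst s c = dst (f + s) (f + c)" by simp
  \<comment> \<open>Among the exceptions in \<open>crosses_path\<close>, now with h = g, the empty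
    word is excluded by f being nontrivial and the two-letter word by reducedness. The single
    letters are the shifts to a neighbouring copy.\<close>
  consider "w = [(g, False)]" | "w = [(g, True)]" | "w \<noteq> [(g, False)]" "w \<noteq> [(g, True)]" by blast
  thus ?thesis
  proof cases
    case 1
    hence eq: "f + s = s + Y g" using fs by (simp add: val_def)
    let ?e = "seg s (s + Y g)" and ?e' = "seg (s + Y g) (s + Y g + Y g)"
    have "25 * card (seg c (f + c) \<inter> ?e) > 11 * card ?e \<or> 25 * card (seg c (f + c) \<inter> ?e') > 11 * card ?e'"
      using adjacent_displacement[OF s(2,3), of "f + c"] fc d unfolding eq cE by simp
    moreover have "?e \<in> E" by (rule E_I[OF s(1,2)])
    moreover have "?e' \<in> E" using E_I[OF fsF s(2)] unfolding eq .
    ultimately show ?thesis by blast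
  next
    case 2
    hence eq: "s = f + s + Y g" using fs by (simp add: val_def)
    let ?e = "seg (f + s) (f + s + Y g)" and ?e' = "seg (f + s + Y g) (f + s + Y g + Y g)"
    have "c \<in> ?e'" using s(3) eq by simp
    moreover have "dst (f + s) (f + c) = dst (f + s + Y g) c" using d eq by simp
    ultimately have "25 * card (seg c (f + c) \<inter> ?e) > 11 * card ?e \<or> 25 * card (seg c (f + c) \<inter> ?e') > 11 * card ?e'"
      using adjacent_displacement[OF s(2) fc, of c] seg_sym[of c "f + c"] unfolding cE by simp
    moreover have "?e \<in> E" by (rule E_I[OF fsF s(2)])
    moreover have "?e' \<in> E" unfolding eq[symmetric] by (rule E_I[OF s(1,2)])
    ultimately show ?thesis by blast
  next
    case 3
    have "w \<noteq> [(g, False), (g, True)]" using w(2) by (auto simp: inv_letter_def)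
    then obtain t y where t: "t \<in> F" "crosses c (f + c) (s + t) y"
      using crosses_path[OF w(1,2) s(2,2,3) fc[unfolded fs]] wne 3 by blast
    then obtain z z' where z: "fst y \<in> S" "z \<in> Seg (s + t) y" "z' \<in> Seg (s + t) y"
      "seg z z' \<subseteq> seg c (f + c)" "98 * N y \<le> 100 * dst z z'" unfolding crosses_def by blast
    have "seg z z' \<subseteq> seg c (f + c) \<inter> Seg (s + t) y" using z convexD[OF convex_Seg] by blast
    hence "card (seg z z') \<le> card (seg c (f + c) \<inter> Seg (s + t) y)" by (rule card_mono[rotated]) simp
    moreover have "card (Seg (s + t) y) = N y + 1" using dst_translate[of "s + t" 0 "val y"] by (simp add: Seg_def card_seg)
    ultimately have "25 * card (seg c (f + c) \<inter> Seg (s + t) y) > 11 * card (Seg (s + t) y)"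
      using z(5) long[OF z(1)] unfolding card_seg by linarith
    moreover have "Seg (s + t) y \<in> E" using s t z F_add by (intro Seg_E)
    ultimately show ?thesis by blast
  qed
qed

lemma F_C: "F \<subseteq> C" by (simp add: C_def)

lemma E_C: "e \<in> E \<Longrightarrow> e \<subseteq> C" by (auto simp: C_def)

lemma tr_E: "e \<in> E \<Longrightarrow> f \<in> F \<Longrightarrow> tr f e \<in> E"
proof -
  assume "e \<in> E" and f: "f \<in> F"
  then obtain f' g where f': "f' \<in> F" "g \<in> S" "e = seg f' (f' + Y g)" by (auto simp: E_def)
  hence "tr f e = seg (f + f') (f + f' + Y g)" by (simp add: tr_seg add.assoc)
  thus ?thesis using E_I[OF F_add[OF f f'(1)] f'(2)] by simp
qed

lemma tr_C: "f \<in> F \<Longrightarrow> tr f C \<subseteq> C"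
proof
  fix z assume f: "f \<in> F" and "z \<in> tr f C"
  hence "- f + z \<in> F \<or> (\<exists>e\<in>E. - f + z \<in> e)" by (auto simp: mem_tr C_def)
  thus "z \<in> C"
  proof
    assume "- f + z \<in> F"
    hence "f + (- f + z) \<in> F" using f F_add by blast
    thus ?thesis using F_C by (auto simp: add.assoc[symmetric])
  next
    assume "\<exists>e\<in>E. - f + z \<in> e"
    then obtain e where "e \<in> E" "z \<in> tr f e" by (auto simp: mem_tr)
    thus ?thesis using tr_E f E_C by blast
  qed
qed

lemma convex_C: "convex C"
proof (rule convex_star[of _ 0])
  have be: "seg 0 (be w) \<subseteq> C" if "w \<in> Wd" for w
    using that
  proof (induction w rule: rev_induct)
    case Nil
    thus ?case using F_0 F_C by auto
  next
    case (snoc y w)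
    have "be w \<in> F" using snoc by (auto simp: F_def)
    hence "Seg (be w) y \<subseteq> C" using snoc Seg_E E_C by auto
    thus ?case using snoc seg_subset[of 0 "be w + val y" "be w"] by (auto simp: Seg_def)
  qed
  fix c assume "c \<in> C"
  then consider "c \<in> F" | e where "e \<in> E" "c \<in> e" by (auto simp: C_def)
  thus "seg 0 c \<subseteq> C"
  proof cases
    case 1
    thus ?thesis using be by (auto simp: F_def)
  next
    case 2
    then obtain f g where f: "f \<in> F" "e = seg f (f + Y g)" by (auto simp: E_def)
    have "seg 0 f \<subseteq> C" using be f by (auto simp: F_def)
    moreover have "seg f c \<subseteq> C" using 2 f E_C convexD[OF convex_seg] seg_ends by blast
    ultimately show ?thesis using seg_subset[of 0 c f] by blast
  qed
qed

sublocale translates F C E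
proof
  show "e \<in> E \<Longrightarrow> 25 \<le> card e" for e
  proof -
    assume "e \<in> E"
    then obtain f g where f: "g \<in> S" "e = seg f (f + Y g)" by (auto simp: E_def)
    thus ?thesis using long[OF f(1)] dst_translate[of f 0 "Y g"] by (simp add: card_seg)
  qed
  show "e \<in> E \<Longrightarrow> \<exists>a b. e = seg a b" for e by (auto simp: E_def)
  show "0 \<in> C" using F_0 F_C by blast
qed (use F_0 F_add F_uminus convex_C tr_C E_C tr_E E_overlap F_displacement in auto)

end

section \<open>Free products of copies of a group\<close>

context group
begin

text \<open>Elements are lists of syllables (i, g) in normal form; lm multiplies by a syllable on the left.\<close>

fun lm :: "'i \<Rightarrow> 'a \<Rightarrow> ('i \<times> 'a) list \<Rightarrow> ('i \<times> 'a) list" where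
  "lm i g [] = (if g = \<one> then [] else [(i, g)])"
| "lm i g ((j, h) # s) = (if g = \<one> then (j, h) # s else if i = j then if g \<otimes> h = \<one> then s else (i, g \<otimes> h) # s
     else (i, g) # (j, h) # s)"

definition nf :: "('i \<times> 'a) list \<Rightarrow> bool" where
  "nf s \<longleftrightarrow> snd ` set s \<subseteq> carrier G - {\<one>} \<and> successively (\<lambda>p q. fst p \<noteq> fst q) s"

lemma nf_Nil [simp]: "nf []" by (simp add: nf_def)

lemma nf_Cons [simp]: "nf ((i, g) # s) \<longleftrightarrow> g \<in> carrier G \<and> g \<noteq> \<one> \<and> nf s \<and> (s \<noteq> [] \<longrightarrow> fst (hd s) \<noteq> i)"
  by (cases s) (auto simp: nf_def)

lemma lm_one [simp]: "lm i \<one> s = s"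
  by (cases s) auto

lemma nf_lm: "nf s \<Longrightarrow> g \<in> carrier G \<Longrightarrow> nf (lm i g s)"
  by (cases "(i, g, s)" rule: lm.cases) auto

text \<open>Every factor acts on the normal forms through \<open>lm\<close>. As for free groups,
  associativity of the free product is read off from this action.\<close>

lemma lm_lm: "nf s \<Longrightarrow> g \<in> carrier G \<Longrightarrow> h \<in> carrier G \<Longrightarrow> lm i g (lm i h s) = lm i (g \<otimes> h) s"
proof (cases s)
  case Nil
  assume "g \<in> carrier G" "h \<in> carrier G"
  thus ?thesis using Nil by auto
next
  case (Cons p s')
  obtain j k where p: "p = (j, k)" by fastforce
  assume a: "nf s" "g \<in> carrier G" "h \<in> carrier G"
  hence k: "k \<in> carrier G" "k \<noteq> \<one>" "nf s'" "s' \<noteq> [] \<Longrightarrow> fst (hd s') \<noteq> j" using Cons p by auto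
  show ?thesis
  proof (cases "i = j")
    case False
    thus ?thesis using Cons p a by auto
  next
    case True
    have e: "g = inv h \<longleftrightarrow> g \<otimes> h = \<one>" using a inv_equality by (metis l_inv)
    show ?thesis
    proof (cases "h \<otimes> k = \<one>")
      case hk: True
      hence ghk: "g \<otimes> h \<otimes> k = g" using a k by (simp add: m_assoc)
      have h1: "h \<noteq> \<one>" using hk k by auto
      have "lm i h s = s'" using hk h1 Cons p True by simp
      moreover have "lm i g s' = lm i (g \<otimes> h) s"
      proof (cases "g \<otimes> h = \<one>")
        case True
        hence "g = k" using ghk k by simp
        thus ?thesis using True \<open>i = j\<close> k Cons p by (cases s') auto
      next
        case False
        thus ?thesis using ghk \<open>i = j\<close> k Cons p by (cases s') auto
      qed
      ultimately show ?thesis by simp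
    next
      case False
      have "g \<otimes> (h \<otimes> k) = g \<otimes> h \<otimes> k" using a k by (simp add: m_assoc)
      moreover have "g \<otimes> h = \<one> \<Longrightarrow> g \<otimes> h \<otimes> k = k" using k by simp
      ultimately show ?thesis using True False Cons p a k by auto
    qed
  qed
qed

definition fpm :: "('i \<times> 'a) list \<Rightarrow> ('i \<times> 'a) list \<Rightarrow> ('i \<times> 'a) list" where
  "fpm s t = foldr (\<lambda>(i, g). lm i g) s t"

lemma fpm_simps [simp]: "fpm [] t = t" "fpm ((i, g) # s) t = lm i g (fpm s t)"
  by (simp_all add: fpm_def)

lemma nf_fpm: "nf s \<Longrightarrow> nf t \<Longrightarrow> nf (fpm s t)"
  by (induction s) (auto simp: nf_lm)

lemma fpm_Nil: "nf s \<Longrightarrow> fpm s [] = s"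
proof (induction s)
  case (Cons p s)
  thus ?case by (cases p; cases s) auto
qed simp

lemma fpm_lm: "nf s \<Longrightarrow> nf t \<Longrightarrow> g \<in> carrier G \<Longrightarrow> fpm (lm i g s) t = lm i g (fpm s t)"
proof (cases s)
  case (Cons p s')
  obtain j k where p: "p = (j, k)" by fastforce
  assume a: "nf s" "nf t" "g \<in> carrier G"
  hence k: "k \<in> carrier G" "nf s'" using Cons p by auto
  have "lm i g (lm i k (fpm s' t)) = lm i (g \<otimes> k) (fpm s' t)" using a k by (simp add: lm_lm nf_fpm)
  thus ?thesis using Cons p by auto
qed auto

lemma fpm_assoc: "nf s \<Longrightarrow> nf t \<Longrightarrow> nf u \<Longrightarrow> fpm (fpm s t) u = fpm s (fpm t u)"
  by (induction s) (auto simp: fpm_lm nf_fpm)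

definition FP :: "('i \<times> 'a) list monoid" where
  "FP = \<lparr>carrier = Collect nf, monoid.mult = fpm, one = []\<rparr>"

lemma FP_simps: "x \<in> carrier FP \<longleftrightarrow> nf x" "x \<otimes>\<^bsub>FP\<^esub> y = fpm x y" "\<one>\<^bsub>FP\<^esub> = []"
  by (simp_all add: FP_def)

lemma lm_cancel: "nf t \<Longrightarrow> g \<in> carrier G \<Longrightarrow> lm i (inv g) (lm i g t) = t"
  by (simp add: lm_lm)

lemma group_FP: "group (FP :: ('i \<times> 'a) list monoid)"
proof (rule groupI)
  show "\<exists>y\<in>carrier FP. y \<otimes>\<^bsub>FP\<^esub> x = \<one>\<^bsub>FP\<^esub>" if "x \<in> carrier FP" for x :: "('i \<times> 'a) list"
  proof -
    have "\<exists>y. nf y \<and> fpm y x = []" if "nf x" for x :: "('i \<times> 'a) list" using that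
    proof (induction x)
      case (Cons p x)
      obtain i g where p: "p = (i, g)" by fastforce
      obtain y where y: "nf y" "fpm y x = []" using Cons p by auto
      have g: "g \<in> carrier G" "nf x" using Cons.prems p by auto
      have "lm i g x = p # x" using Cons.prems p by (cases x) auto
      hence "lm i (inv g) (p # x) = x" using g lm_cancel[of x g i] by simp
      hence "fpm (lm i (inv g) []) (p # x) = x" using fpm_lm[OF nf_Nil Cons.prems, of "inv g" i] g by (simp del: lm.simps)
      hence "fpm (fpm y (lm i (inv g) [])) (p # x) = []" using Cons.prems y g by (simp add: fpm_assoc nf_lm)
      thus ?case using y g nf_lm nf_fpm by (metis inv_closed nf_Nil)
    qed (auto intro: exI[of _ "[]"])
    then obtain y where "nf y" "fpm y x = []" using \<open>x \<in> carrier FP\<close> by (auto simp: FP_simps)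
    thus ?thesis by (intro bexI[of _ y]) (simp_all add: FP_simps)
  qed
qed (auto simp: FP_simps nf_fpm fpm_assoc)

definition syl :: "'i \<Rightarrow> 'a \<Rightarrow> ('i \<times> 'a) list" where
  "syl i g = lm i g []"

lemma nf_syl [simp]: "g \<in> carrier G \<Longrightarrow> nf (syl i g)"
  by (simp add: syl_def nf_lm)

lemma fpm_syl: "nf s \<Longrightarrow> g \<in> carrier G \<Longrightarrow> fpm (syl i g) s = lm i g s"
  by (simp add: syl_def fpm_lm)

lemma syl_hom: "syl i \<in> hom G FP"
  by (rule homI) (auto simp: FP_simps fpm_syl, simp add: syl_def lm_lm)

lemma syl_eq_iff: "syl i g = syl i h \<longleftrightarrow> g = h"
  by (auto simp: syl_def)

text \<open>A subset of the Bass--Serre vertices is a predicate on pairs (i, x), standing for the coset of the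
  i-th factor containing x; keep Om s deletes from s all syllables at vertices outside Om.\<close>

primrec keep :: "('i \<times> 'a) list \<Rightarrow> ('i \<Rightarrow> ('i \<times> 'a) list \<Rightarrow> bool) \<Rightarrow> ('i \<times> 'a) list" where
  "keep [] Om = []"
| "keep (p # s) Om = (if Om (fst p) [] then lm (fst p) (snd p) else id) (keep s (\<lambda>j x. Om j (lm (fst p) (snd p) x)))"

definition vertex_set :: "('i \<Rightarrow> ('i \<times> 'a) list \<Rightarrow> bool) \<Rightarrow> bool" where
  "vertex_set Om \<longleftrightarrow> (\<forall>i x g. nf x \<longrightarrow> g \<in> carrier G \<longrightarrow> Om i (fpm x (syl i g)) = Om i x)"

lemma keep_cong: "(\<And>i x. nf x \<Longrightarrow> Om i x = Om' i x) \<Longrightarrow> nf s \<Longrightarrow> keep s Om = keep s Om'"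
proof (induction s arbitrary: Om Om')
  case (Cons p s)
  obtain i g where p: "p = (i, g)" by fastforce
  have "keep s (\<lambda>j x. Om j (lm i g x)) = keep s (\<lambda>j x. Om' j (lm i g x))"
    using Cons.prems p by (intro Cons.IH) (auto simp: nf_lm)
  thus ?case using Cons.prems(1)[OF nf_Nil] by (simp add: p)
qed simp

lemma nf_keep: "nf s \<Longrightarrow> nf (keep s Om)"
proof (induction s arbitrary: Om)
  case (Cons p s)
  thus ?case by (cases p) (auto simp: nf_lm)
qed simp

text \<open>When a syllable merges with the first one, both sit at the same vertex, so both are kept
  or both deleted.\<close>

lemma keep_lm:
  assumes "vertex_set Om" "nf s" "g \<in> carrier G"
  shows "keep (lm i g s) Om = (if Om i [] then lm i g else id) (keep s (\<lambda>j x. Om j (lm i g x)))"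
proof (cases "g = \<one>")
  case True
  thus ?thesis by auto
next
  case g1: False
  show ?thesis
  proof (cases s)
    case Nil
    thus ?thesis using g1 by simp
  next
    case (Cons p s')
    obtain j k where p: "p = (j, k)" by fastforce
    have k: "k \<in> carrier G" "nf s'" using assms Cons p by auto
    show ?thesis
    proof (cases "i = j")
      case False
      thus ?thesis using g1 Cons p by simp
    next
      case True
      have V: "Om i (lm i g []) = Om i []"
        using assms(1,3) unfolding vertex_set_def syl_def by (metis fpm_simps(1) nf_Nil)
      have Om: "keep s' (\<lambda>m x. Om m (lm i g (lm i k x))) = keep s' (\<lambda>m x. Om m (lm i (g \<otimes> k) x))"
        using assms k by (intro keep_cong) (simp_all add: lm_lm)
      have lm2: "lm i g (lm i k t) = lm i (g \<otimes> k) t" if "nf t" for t using that assms k by (simp add: lm_lm)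
      show ?thesis
        using Cons p True V Om k g1 lm2[OF nf_keep[OF k(2)]] by auto
    qed
  qed
qed

lemma vertex_set_shift:
  "vertex_set Om \<Longrightarrow> nf z \<Longrightarrow> vertex_set (\<lambda>j x. Om j (fpm z x))"
  unfolding vertex_set_def by (simp add: fpm_assoc[symmetric] nf_fpm)

lemma keep_fpm:
  assumes "vertex_set Om" "nf s" "nf t"
  shows "keep (fpm s t) Om = fpm (keep s Om) (keep t (\<lambda>j x. Om j (fpm s x)))"
  using assms
proof (induction s arbitrary: Om)
  case (Cons p s)
  obtain i g where p: "p = (i, g)" by fastforce
  have g: "g \<in> carrier G" "nf s" using Cons.prems p by auto
  let ?Om = "\<lambda>j x. Om j (lm i g x)"
  have "vertex_set (\<lambda>j x. Om j (fpm (syl i g) x))" using Cons.prems g by (intro vertex_set_shift) auto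
  hence v: "vertex_set ?Om" unfolding vertex_set_def using g by (simp add: fpm_syl nf_fpm)
  have "keep (fpm (p # s) t) Om = (if Om i [] then lm i g else id) (keep (fpm s t) ?Om)"
    using keep_lm[OF Cons.prems(1) nf_fpm[OF g(2) Cons.prems(3)] g(1)] p by simp
  also have "keep (fpm s t) ?Om = fpm (keep s ?Om) (keep t (\<lambda>j x. ?Om j (fpm s x)))"
    using Cons.IH[OF v g(2) Cons.prems(3)] .
  finally show ?case using p g Cons.prems by (auto simp: fpm_lm nf_keep)
qed simp

lemma lm_Cons: "nf ((i, g) # s) \<Longrightarrow> lm i g s = (i, g) # s"
  by (cases s) auto

lemma nf_take: "nf s \<Longrightarrow> nf (take a s)"
  by (metis append_take_drop_id image_Un le_sup_iff nf_def set_append successively_append_iff)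

lemma keep_id: "nf s \<Longrightarrow> (\<And>a. a < length s \<Longrightarrow> Om (fst (s ! a)) (take a s)) \<Longrightarrow> keep s Om = s"
proof (induction s arbitrary: Om)
  case (Cons p s)
  obtain i g where p: "p = (i, g)" by fastforce
  have "keep s (\<lambda>j x. Om j (lm i g x)) = s"
  proof (rule Cons.IH)
    show "nf s" using Cons.prems p by simp
    fix a assume a: "a < length s"
    have "nf ((i, g) # take a s)" using nf_take[OF Cons.prems(1), of "Suc a"] p by simp
    hence "lm i g (take a s) = (i, g) # take a s" by (rule lm_Cons)
    thus "Om (fst (s ! a)) (lm i g (take a s))" using Cons.prems(2)[of "Suc a"] a p by simp
  qed
  moreover have "Om i []" using Cons.prems(2)[of 0] p by simp
  moreover have "lm i g s = p # s" using Cons.prems(1) unfolding p by (rule lm_Cons)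
  ultimately show ?case by (simp add: p)
qed simp

lemma keep_supported:
  assumes "\<And>j x. Om j x \<Longrightarrow> j = i" "nf s" shows "keep s Om \<in> syl i ` carrier G"
  using assms
proof (induction s arbitrary: Om)
  case Nil
  thus ?case by (auto simp: syl_def intro!: image_eqI[of _ _ \<one>])
next
  case (Cons p s)
  obtain j g where p: "p = (j, g)" by fastforce
  have g: "g \<in> carrier G" "nf s" using Cons.prems p by auto
  have "keep s (\<lambda>m x. Om m (lm j g x)) \<in> syl i ` carrier G" using Cons.prems g by (intro Cons.IH) auto
  then obtain h where h: "h \<in> carrier G" "keep s (\<lambda>m x. Om m (lm j g x)) = syl i h" by blast
  show ?case
  proof (cases "Om j []")
    case True
    hence "j = i" using Cons.prems by blast
    have "lm i g (syl i h) = syl i (g \<otimes> h)" using g h by (simp add: syl_def lm_lm)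
    thus ?thesis using True p h g \<open>j = i\<close> by auto
  next
    case False
    thus ?thesis using p h by auto
  qed
qed

section \<open>Products of conjugates\<close>

definition conjugate :: "('i \<times> 'a) list \<times> 'i \<times> 'a \<Rightarrow> ('i \<times> 'a) list" where
  "conjugate = (\<lambda>(l, i, g). l \<otimes>\<^bsub>FP\<^esub> syl i g \<otimes>\<^bsub>FP\<^esub> inv\<^bsub>FP\<^esub> l)"

definition item :: "('i \<times> 'a) list \<times> 'i \<times> 'a \<Rightarrow> bool" where
  "item = (\<lambda>(l, i, g). nf l \<and> g \<in> carrier G)"

lemma nf_inv: "nf l \<Longrightarrow> nf (inv\<^bsub>FP\<^esub> l)"
  using group.inv_closed[OF group_FP] by (simp add: FP_simps)

lemma fpm_inv: "nf l \<Longrightarrow> fpm (inv\<^bsub>FP\<^esub> l) l = []" "nf l \<Longrightarrow> fpm l (inv\<^bsub>FP\<^esub> l) = []"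
  using group.l_inv[OF group_FP] group.r_inv[OF group_FP] by (auto simp: FP_simps)

lemma inv_FP_eqI: "fpm k l = [] \<Longrightarrow> nf k \<Longrightarrow> nf l \<Longrightarrow> inv\<^bsub>FP\<^esub> l = k"
  using group.inv_equality[OF group_FP] by (simp add: FP_simps)

lemma nf_conjugate: "item x \<Longrightarrow> nf (conjugate x)"
  by (auto simp: item_def conjugate_def FP_simps nf_fpm nf_inv)

text \<open>By the cocycle rule the inverse of l is evaluated on a translate of \<open>Om\<close>.
  Invariance of \<open>Om\<close> under the whole conjugate makes its value inverse to
  \<open>keep l Om\<close>. The syllable in the middle sits at the vertex (i, l).\<close>

lemma keep_conjugate:
  fixes Om :: "'i \<Rightarrow> ('i \<times> 'a) list \<Rightarrow> bool"
  assumes V: "vertex_set Om" and x: "item (l, i, g)"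
    and inv: "\<And>j z. nf z \<Longrightarrow> Om j (fpm (conjugate (l, i, g)) z) = Om j z"
  shows "keep (conjugate (l, i, g)) Om = (if Om i l then keep l Om \<otimes>\<^bsub>FP\<^esub> syl i g \<otimes>\<^bsub>FP\<^esub> inv\<^bsub>FP\<^esub> (keep l Om) else [])"
proof -
  let ?k = "inv\<^bsub>FP\<^esub> l" and ?a = "syl i g"
  have n: "nf l" "nf ?k" "g \<in> carrier G" "nf ?a" using x by (auto simp: item_def nf_inv)
  let ?Om1 = "\<lambda>j z. Om j (fpm l z)" and ?Om2 = "\<lambda>j z. Om j (fpm (fpm l ?a) z)"
  have V1: "vertex_set ?Om1" and V2: "vertex_set ?Om2" using V n by (auto intro!: vertex_set_shift simp: nf_fpm)
  have "keep (fpm (fpm l ?a) ?k) Om = fpm (fpm (keep l Om) (keep ?a ?Om1)) (keep ?k ?Om2)"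
    using V V1 n by (simp add: keep_fpm nf_fpm)
  moreover have "keep ?a ?Om1 = (if Om i l then ?a else [])"
    using keep_lm[OF V1 nf_Nil n(3), of i] n by (simp add: syl_def fpm_Nil)
  moreover have "keep ?k ?Om2 = inv\<^bsub>FP\<^esub> (keep l Om)"
  proof (rule inv_FP_eqI[symmetric])
    have "keep l (\<lambda>j z. ?Om2 j (fpm ?k z)) = keep l Om"
    proof (rule keep_cong)
      fix j z assume z: "nf (z :: ('i \<times> 'a) list)"
      have "fpm (fpm l ?a) (fpm ?k z) = fpm (conjugate (l, i, g)) z"
        using n z by (simp add: conjugate_def FP_simps fpm_assoc nf_fpm)
      thus "?Om2 j (fpm ?k z) = Om j z" using inv[OF z] by simp
    qed (rule n)
    thus "fpm (keep ?k ?Om2) (keep l Om) = []"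
      using keep_fpm[OF V2 n(2,1)] fpm_inv(1)[OF n(1)] by simp
  qed (use n in \<open>simp_all add: nf_keep\<close>)
  ultimately show ?thesis
    using n fpm_inv(2)[OF nf_keep[OF n(1)]] by (simp add: conjugate_def FP_simps fpm_Nil nf_keep)
qed

definition conj_products :: "'a list \<Rightarrow> 'a set" where
  "conj_products gs = {conj_prod G ys gs |ys. set ys \<subseteq> carrier G \<and> length ys = length gs}"

lemma conj_products_Nil [simp]: "conj_products [] = {\<one>}"
  by (auto simp: conj_products_def conj_prod_def)

lemma conj_products_Cons:
  "conj_products (g # gs) = {y \<otimes> g \<otimes> inv y \<otimes> c |y c. y \<in> carrier G \<and> c \<in> conj_products gs}"
proof (intro equalityI subsetI)
  fix x assume "x \<in> conj_products (g # gs)"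
  then obtain ys where ys: "set ys \<subseteq> carrier G" "length ys = Suc (length gs)" "x = conj_prod G ys (g # gs)"
    by (auto simp: conj_products_def)
  then obtain y ys' where "ys = y # ys'" by (cases ys) auto
  thus "x \<in> {y \<otimes> g \<otimes> inv y \<otimes> c |y c. y \<in> carrier G \<and> c \<in> conj_products gs}"
    using ys by (auto simp: conj_products_def conj_prod_def)
next
  fix x assume "x \<in> {y \<otimes> g \<otimes> inv y \<otimes> c |y c. y \<in> carrier G \<and> c \<in> conj_products gs}"
  then obtain y ys where "y \<in> carrier G" "set ys \<subseteq> carrier G" "length ys = length gs"
    "x = conj_prod G (y # ys) (g # gs)"
    by (auto simp: conj_products_def conj_prod_def)
  thus "x \<in> conj_products (g # gs)" unfolding conj_products_def mem_Collect_eq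
    by (intro exI[of _ "y # ys"]) simp
qed

lemma conj_products_closed: "set gs \<subseteq> carrier G \<Longrightarrow> conj_products gs \<subseteq> carrier G"
  by (induction gs) (auto simp: conj_products_Cons)

text \<open>Moving an element of the group past a conjugate changes only the conjugating element, so
  two products of conjugates can be interleaved in any prescribed order.\<close>

lemma conj_products_merge:
  assumes "set (map f xs) \<subseteq> carrier G"
    and "a \<in> conj_products (map f (filter P xs))" "b \<in> conj_products (map f (filter (\<lambda>x. \<not> P x) xs))"
  shows "a \<otimes> b \<in> conj_products (map f xs)"
  using assms
proof (induction xs arbitrary: a b)
  case (Cons x xs)
  have cl: "set (map f (filter Q xs)) \<subseteq> carrier G" for Q using Cons.prems(1) by auto
  have fx: "f x \<in> carrier G" using Cons.prems(1) by simp
  show ?case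
  proof (cases "P x")
    case True
    then obtain y c where y: "y \<in> carrier G" "c \<in> conj_products (map f (filter P xs))" "a = y \<otimes> f x \<otimes> inv y \<otimes> c"
      using Cons.prems(2) by (auto simp: conj_products_Cons)
    have "b \<in> conj_products (map f (filter (\<lambda>x. \<not> P x) xs))" using Cons.prems True by simp
    hence cb: "c \<otimes> b \<in> conj_products (map f xs)" "b \<in> carrier G"
      using Cons.IH[OF _ y(2)] Cons.prems(1) conj_products_closed[OF cl] by auto
    have "c \<in> carrier G" using y conj_products_closed[OF cl] by auto
    hence "a \<otimes> b = y \<otimes> f x \<otimes> inv y \<otimes> (c \<otimes> b)" using y fx cb by (simp add: m_assoc)
    thus ?thesis using y cb unfolding conj_products_Cons list.map mem_Collect_eq by blast
  next
    case False
    then obtain y c where y: "y \<in> carrier G" "c \<in> conj_products (map f (filter (\<lambda>x. \<not> P x) xs))" "b = y \<otimes> f x \<otimes> inv y \<otimes> c"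
      using Cons.prems(3) by (auto simp: conj_products_Cons)
    have a: "a \<in> conj_products (map f (filter P xs))" using Cons.prems False by simp
    hence "a \<otimes> c \<in> conj_products (map f xs)" "a \<in> carrier G"
      using Cons.IH[OF _ a y(2)] Cons.prems(1) conj_products_closed[OF cl] by auto
    moreover have c: "c \<in> carrier G" using y conj_products_closed[OF cl] by auto
    moreover have "a \<otimes> b = (a \<otimes> y) \<otimes> f x \<otimes> inv (a \<otimes> y) \<otimes> (a \<otimes> c)"
    proof -
      have "inv a \<otimes> (a \<otimes> c) = c" using \<open>a \<in> carrier G\<close> c by (simp add: m_assoc[symmetric])
      thus ?thesis using y c fx \<open>a \<in> carrier G\<close> by (simp add: inv_mult_group m_assoc)
    qed
    ultimately show ?thesis using y fx unfolding conj_products_Cons list.map mem_Collect_eq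
      by (intro exI[of _ "a \<otimes> y"] exI[of _ "a \<otimes> c"]) simp
  qed
qed simp

text \<open>Deletion yields a trivial product in G separately for each factor of the free product;
  here these products are combined in the original order.\<close>

lemma conj_products_classes:
  assumes "set (map f xs) \<subseteq> carrier G" "\<And>k. \<one> \<in> conj_products (map f (filter (\<lambda>x. key x = k) xs))"
  shows "\<one> \<in> conj_products (map f xs)"
  using assms
proof (induction "length xs" arbitrary: xs rule: less_induct)
  case less
  show ?case
  proof (cases xs)
    case (Cons x xs')
    let ?ys = "filter (\<lambda>y. key y \<noteq> key x) xs"
    have "\<one> \<in> conj_products (map f ?ys)"
    proof (rule less.hyps)
      show "length ?ys < length xs" using Cons by (simp add: less_Suc_eq_le)
      show "set (map f ?ys) \<subseteq> carrier G" using less.prems by auto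
      fix k
      show "\<one> \<in> conj_products (map f (filter (\<lambda>x. key x = k) ?ys))"
      proof (cases "k = key x")
        case True
        thus ?thesis by simp
      next
        case False
        hence "filter (\<lambda>x. key x = k) ?ys = filter (\<lambda>x. key x = k) xs"
          unfolding filter_filter by (intro filter_cong) auto
        thus ?thesis using less.prems(2) by simp
      qed
    qed
    thus ?thesis using conj_products_merge[OF less.prems(1) less.prems(2)[of "key x"]] by fastforce
  qed simp
qed

definition product :: "(('i \<times> 'a) list \<times> 'i \<times> 'a) list \<Rightarrow> ('i \<times> 'a) list" where
  "product xs = foldr (\<lambda>x. fpm (conjugate x)) xs []"

lemma product_simps [simp]: "product [] = []" "product (x # xs) = fpm (conjugate x) (product xs)"
  by (simp_all add: product_def)

lemma nf_product: "list_all item xs \<Longrightarrow> nf (product xs)"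
  by (induction xs) (auto simp: nf_fpm nf_conjugate)

text \<open>All kept syllables belong to the i-th factor, so each conjugator reduces to an element
  of G and what survives is an equation in G between the g whose vertex lies in
  \<open>Om\<close>.\<close>

lemma keep_product:
  assumes "vertex_set Om" "\<And>j z. Om j z \<Longrightarrow> j = i" "list_all item xs"
    and "\<And>x j z. x \<in> set xs \<Longrightarrow> nf z \<Longrightarrow> Om j (fpm (conjugate x) z) = Om j z"
  shows "\<exists>c\<in>conj_products (map (\<lambda>(l, j, g). g) (filter (\<lambda>(l, j, g). Om j l) xs)). keep (product xs) Om = syl i c"
  using assms(3,4)
proof (induction xs)
  case Nil
  thus ?case by (simp add: syl_def)
next
  case (Cons x xs)
  obtain l j g where x: "x = (l, j, g)" by (cases x)
  let ?f = "\<lambda>(l, j, g). g" let ?P = "\<lambda>(l, j, g). Om j l"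
  have it: "item (l, j, g)" "list_all item xs" using Cons.prems x by auto
  hence lg: "nf l" "g \<in> carrier G" by (auto simp: item_def)
  obtain c where c: "c \<in> conj_products (map ?f (filter ?P xs))" "keep (product xs) Om = syl i c"
    using Cons.IH[OF it(2)] Cons.prems(2) by auto
  have "set (map ?f (filter ?P xs)) \<subseteq> carrier G" using it(2) by (auto simp: list_all_iff item_def)
  hence cG: "c \<in> carrier G" using c conj_products_closed by blast
  have "keep (product (x # xs)) Om = fpm (keep (conjugate x) Om) (keep (product xs) (\<lambda>j z. Om j (fpm (conjugate x) z)))"
    using keep_fpm[OF assms(1) nf_conjugate[OF it(1)] nf_product[OF it(2)]] x by simp
  also have "keep (product xs) (\<lambda>j z. Om j (fpm (conjugate x) z)) = keep (product xs) Om"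
    using Cons.prems(2) nf_product[OF it(2)] by (intro keep_cong) auto
  also have "keep (conjugate x) Om = (if Om j l then keep l Om \<otimes>\<^bsub>FP\<^esub> syl j g \<otimes>\<^bsub>FP\<^esub> inv\<^bsub>FP\<^esub> (keep l Om) else [])"
    unfolding x using Cons.prems(2) x by (intro keep_conjugate[OF assms(1) it(1)]) auto
  finally have eq: "keep (product (x # xs)) Om =
    fpm (if Om j l then keep l Om \<otimes>\<^bsub>FP\<^esub> syl j g \<otimes>\<^bsub>FP\<^esub> inv\<^bsub>FP\<^esub> (keep l Om) else []) (syl i c)" using c by simp
  show ?case
  proof (cases "Om j l")
    case True
    hence ji: "j = i" using assms(2) by blast
    have "keep l Om \<in> syl i ` carrier G" by (rule keep_supported) (erule assms(2), rule lg(1))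
    then obtain h where h: "h \<in> carrier G" "keep l Om = syl i h" by blast
    interpret hom: group_hom G FP "syl i"
      by (intro group_hom.intro group_hom_axioms.intro group_FP syl_hom group_axioms)
    have "keep (product (x # xs)) Om = syl i h \<otimes>\<^bsub>FP\<^esub> syl i g \<otimes>\<^bsub>FP\<^esub> inv\<^bsub>FP\<^esub> (syl i h) \<otimes>\<^bsub>FP\<^esub> syl i c"
      unfolding eq using True ji h(2) by (simp only: FP_simps if_True)
    also have "\<dots> = syl i (h \<otimes> g \<otimes> inv h \<otimes> c)" using h lg cG by simp
    finally show ?thesis using True x h c by (auto simp: conj_products_Cons)
  next
    case False
    thus ?thesis using eq x c by auto
  qed
qed

lemma product_trivial_solvable:
  assumes "list_all item xs" "product xs = []"
  shows "\<one> \<in> conj_products (map (\<lambda>(l, i, g). g) xs)"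
proof (rule conj_products_classes[of _ _ "\<lambda>(l, i, g). i"])
  show "set (map (\<lambda>(l, i, g). g) xs) \<subseteq> carrier G" using assms by (auto simp: list_all_iff item_def)
  fix k
  obtain c where c: "c \<in> conj_products (map (\<lambda>(l, j, g). g) (filter (\<lambda>(l, j, g). j = k) xs))" "keep (product xs) (\<lambda>j z. j = k) = syl k c"
    using keep_product[of "\<lambda>j z. j = k" k xs] assms by (auto simp: vertex_set_def)
  hence "syl k c = syl k \<one>" using assms by (simp add: syl_def)
  hence "c = \<one>" by (simp add: syl_eq_iff)
  thus "\<one> \<in> conj_products (map (\<lambda>(l, i, g). g) (filter (\<lambda>x. (case x of (l, i, g) \<Rightarrow> i) = k) xs))"
    using c by (simp add: case_prod_unfold)
qed

section \<open>Reluctant families\<close>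

lemma conj_products_set_prod: "conj_products gs \<subseteq> set_prod G (map (conj_class G) gs)"
proof (induction gs)
  case (Cons g gs)
  thus ?case by (fastforce simp: conj_products_Cons set_prod_def conj_class_def set_mult_def)
qed (simp add: set_prod_def)

lemma reluctant_filter:
  assumes "reluctant G (map f xs)" "\<one> \<in> conj_products (map f (filter P xs))" "\<exists>x\<in>set xs. P x" "x \<in> set xs"
  shows "P x"
proof (rule ccontr)
  assume "\<not> P x"
  let ?I = "{i. i < length xs \<and> P (xs ! i)}"
  have "?I \<noteq> {}" using assms(3) by (auto simp: in_set_conv_nth)
  hence "1 \<le> card ?I" by (simp add: Suc_le_eq card_gt_0_iff)
  moreover have "?I \<subset> {..<length xs}" using \<open>\<not> P x\<close> assms(4) by (auto simp: in_set_conv_nth)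
  hence "card ?I < card {..<length xs}" by (rule psubset_card_mono[rotated]) simp
  hence "card ?I \<le> length (map f xs) - 1" by simp
  moreover have "nths (map f xs) ?I = map f (filter P xs)" by (simp add: nths_map filter_eq_nths)
  hence "\<one> \<in> set_prod G (map (conj_class G) (nths (map f xs) ?I))"
    using assms(2) conj_products_set_prod[of "map f (filter P xs)"] by (metis subsetD)
  ultimately show False using assms(1) unfolding reluctant_def by force
qed

text \<open>A syllable of w at a vertex of \<open>Th\<close> follows a prefix to which the induction
  hypothesis applies, so this prefix is at most one syllable of index i; by alternation it is empty.
  Hence only the first syllable can be deleted, and as nothing is kept there is no other. In effect
  \<open>Th\<close> is a single vertex.\<close>

lemma stabilizer_of_trivial_keep:
  assumes V: "vertex_set Th" and supp: "\<And>j z. Th j z \<Longrightarrow> j = i" and "Th i []"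
    and triv: "\<And>w. nf w \<Longrightarrow> Th i w \<Longrightarrow> keep w (\<lambda>j z. \<not> Th j z) = []"
  shows "nf w \<Longrightarrow> Th i w \<Longrightarrow> w \<in> syl i ` carrier G"
proof (induction "length w" arbitrary: w rule: less_induct)
  case less
  have a0: "a = 0" if a: "a < length w" "Th (fst (w ! a)) (take a w)" for a
  proof (rule ccontr)
    assume "a \<noteq> 0"
    have i: "fst (w ! a) = i" using supp a by blast
    have nfa: "nf (take a w)" using less.prems(1) by (rule nf_take)
    hence "take a w \<in> syl i ` carrier G" using less.hyps[of "take a w"] a i by auto
    then obtain g where g: "take a w = syl i g" by blast
    have "length (take a w) \<le> 1" unfolding g by (simp add: syl_def)
    hence a1: "a = 1" using a \<open>a \<noteq> 0\<close> by simp
    then obtain p q w' where w: "w = p # q # w'" using a by (cases w; cases "tl w") auto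
    have "fst p = i" using g a1 w by (auto simp: syl_def split: if_splits)
    thus False using i a1 w less.prems(1) by (cases p) auto
  qed
  show ?case
  proof (cases "w \<noteq> [] \<and> fst (hd w) = i")
    case False
    have "keep w (\<lambda>j z. \<not> Th j z) = w"
    proof (rule keep_id[OF less.prems(1)])
      fix a assume a: "a < length w"
      show "\<not> Th (fst (w ! a)) (take a w)"
      proof
        assume t: "Th (fst (w ! a)) (take a w)"
        hence "a = 0" "fst (w ! a) = i" using a0[OF a] supp by auto
        thus False using False a by (cases w) auto
      qed
    qed
    hence "w = syl i \<one>" using triv less.prems by (simp add: syl_def)
    thus ?thesis by blast
  next
    case True
    then obtain g w' where w: "w = (i, g) # w'" by (cases w) auto
    have g: "g \<in> carrier G" "nf w'" using less.prems w by auto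
    have "keep w' (\<lambda>j z. \<not> Th j (lm i g z)) = w'"
    proof (rule keep_id[OF g(2)])
      fix a assume a: "a < length w'"
      have "nf ((i, g) # take a w')" using nf_take[OF less.prems(1), of "Suc a"] w by simp
      hence "lm i g (take a w') = take (Suc a) w" using w by (simp only: lm_Cons take_Suc_Cons)
      thus "\<not> Th (fst (w' ! a)) (lm i g (take a w'))" using a0[of "Suc a"] a w by auto
    qed
    hence "w' = []" using triv[OF less.prems] w \<open>Th i []\<close> by simp
    thus ?thesis using w less.prems(1) by (auto simp: syl_def intro!: image_eqI[of _ _ g])
  qed
qed

lemma product_trivial_reluctant:
  fixes xs :: "(('i \<times> 'a) list \<times> 'i \<times> 'a) list"
  assumes it: "list_all item xs" and triv: "product xs = []" and rel: "reluctant G (map (\<lambda>(l, i, g). g) xs)"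
    and x1: "(l1, i, g1) \<in> set xs" and x: "(l, j, g) \<in> set xs"
  shows "j = i \<and> (\<exists>h\<in>carrier G. l = fpm l1 (syl i h))"
proof -
  interpret FP: group FP by (rule group_FP)
  define Gam where "Gam = generate FP (conjugate ` set xs)"
  have nfc: "nf (conjugate y)" if "y \<in> set xs" for y
    using it that nf_conjugate unfolding list_all_iff by blast
  have l1: "nf l1" using x1 it by (auto simp: list_all_iff item_def)
  have sub: "subgroup Gam FP" unfolding Gam_def using nfc by (intro FP.generate_is_subgroup) (auto simp: FP_simps)
  have nfG: "nf y" if "y \<in> Gam" for y using subgroup.mem_carrier[OF sub that] by (simp add: FP_simps)
  define Om where "Om j z \<longleftrightarrow> j = i \<and> (\<exists>y\<in>Gam. \<exists>h\<in>carrier G. z = fpm y (fpm l1 (syl i h)))" for j z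
  have syl_mult: "fpm (syl k a) (syl k b) = syl k (a \<otimes> b)" if "a \<in> carrier G" "b \<in> carrier G" for k :: 'i and a b
    using hom_mult[OF syl_hom[of k] that] by (simp add: FP_simps)
  have Om_right: "Om j (fpm z (syl j h))" if "Om j z" "h \<in> carrier G" for j z h
  proof -
    obtain y h' where y: "j = i" "y \<in> Gam" "h' \<in> carrier G" "z = fpm y (fpm l1 (syl i h'))" using \<open>Om j z\<close> by (auto simp: Om_def)
    have "fpm z (syl j h) = fpm y (fpm l1 (syl i (h' \<otimes> h)))"
      using y that l1 nfG by (simp add: fpm_assoc nf_fpm syl_mult)
    thus ?thesis using y that by (auto simp: Om_def)
  qed
  have V: "vertex_set Om"
    unfolding vertex_set_def
  proof (intro allI impI iffI)
    fix j and z :: "('i \<times> 'a) list" and h assume z: "nf z" "h \<in> carrier G"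
    show "Om j z \<Longrightarrow> Om j (fpm z (syl j h))" using Om_right z by blast
    assume "Om j (fpm z (syl j h))"
    hence "Om j (fpm (fpm z (syl j h)) (syl j (inv h)))" using Om_right z by blast
    moreover have "fpm (fpm z (syl j h)) (syl j (inv h)) = z"
      using z by (simp add: fpm_assoc syl_mult) (simp add: syl_def fpm_Nil)
    ultimately show "Om j z" by simp
  qed
  have Om_left': "Om j (fpm y z)" if "y \<in> Gam" "nf z" "Om j z" for j y z
  proof -
    obtain y' h' where y': "j = i" "y' \<in> Gam" "h' \<in> carrier G" "z = fpm y' (fpm l1 (syl i h'))" using \<open>Om j z\<close> by (auto simp: Om_def)
    have "fpm y z = fpm (fpm y y') (fpm l1 (syl i h'))" using y' that l1 nfG by (simp add: fpm_assoc nf_fpm)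
    moreover have "fpm y y' \<in> Gam" using subgroup.m_closed[OF sub that(1) y'(2)] by (simp add: FP_simps)
    ultimately show ?thesis using y' by (auto simp: Om_def)
  qed
  have Om_left: "Om j (fpm y z) = Om j z" if "y \<in> Gam" "nf z" for j y z
  proof
    assume "Om j (fpm y z)"
    moreover have "inv\<^bsub>FP\<^esub> y \<in> Gam" by (rule subgroup.m_inv_closed[OF sub that(1)])
    ultimately have "Om j (fpm (inv\<^bsub>FP\<^esub> y) (fpm y z))" using Om_left' nf_fpm nfG that by blast
    moreover have "fpm (inv\<^bsub>FP\<^esub> y) (fpm y z) = z"
      using that(2) nfG[OF that(1)] nf_inv[OF nfG[OF that(1)]] by (simp add: fpm_assoc[symmetric] fpm_inv)
    ultimately show "Om j z" by simp
  qed (use Om_left' that in blast)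
  have cG: "conjugate y \<in> Gam" if "y \<in> set xs" for y unfolding Gam_def using that by (intro generate.incl) auto
  have oneG: "[] \<in> Gam" using subgroup.one_closed[OF sub] by (simp add: FP_simps)
  have Om_l1: "Om i l1" unfolding Om_def using oneG l1
    by (intro conjI refl bexI[of _ "[]"] bexI[of _ \<one>]) (auto simp: syl_def fpm_Nil)
  have all: "Om j l" if "(l, j, g) \<in> set xs" for l j g
  proof -
    have supp: "j = i" if "Om j z" for j z using that by (simp add: Om_def)
    have "\<exists>c\<in>conj_products (map (\<lambda>(l, j, g). g) (filter (\<lambda>(l, j, g). Om j l) xs)). keep (product xs) Om = syl i c"
      by (rule keep_product) (fact V, erule supp, fact it, rule Om_left, erule cG, assumption)
    then obtain c where c: "c \<in> conj_products (map (\<lambda>(l, j, g). g) (filter (\<lambda>(l, j, g). Om j l) xs))"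
      "keep (product xs) Om = syl i c" by blast
    have "c = \<one>" using c(2) triv by (auto simp: syl_def split: if_splits)
    hence 1: "\<one> \<in> conj_products (map (\<lambda>(l, j, g). g) (filter (\<lambda>(l, j, g). Om j l) xs))" using c(1) by simp
    have "\<exists>x\<in>set xs. case x of (l, j, g) \<Rightarrow> Om j l" using x1 Om_l1 by (intro bexI[of _ "(l1, i, g1)"]) simp_all
    from reluctant_filter[OF rel 1 this that] show ?thesis by simp
  qed
  let ?nOm = "\<lambda>j z. \<not> Om j z"
  have Vn: "vertex_set ?nOm" using V by (simp add: vertex_set_def)
  \<comment> \<open>Every generator has its vertex in \<open>Om\<close>, so deletion at
    \<open>Om\<close> kills it. On the stabilizer of \<open>Om\<close> deletion is multiplicative,
    hence all of \<open>Gam\<close> is killed.\<close>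
  have keep_Gam: "keep y ?nOm = []" if "y \<in> Gam" for y
    using that unfolding Gam_def
  proof (induction rule: generate.induct)
    case one
    thus ?case by (simp add: FP_simps)
  next
    case (incl h)
    then obtain l j g where h: "h = conjugate (l, j, g)" "(l, j, g) \<in> set xs" by auto
    have "item (l, j, g)" using h it by (auto simp: list_all_iff)
    thus ?case using keep_conjugate[OF Vn] all h Om_left[OF cG[OF h(2)]] by simp
  next
    case (inv h)
    then obtain l j g where h: "h = conjugate (l, j, g)" "(l, j, g) \<in> set xs" by auto
    have "item (l, j, g)" using h it by (auto simp: list_all_iff)
    hence k: "keep h ?nOm = []" using keep_conjugate[OF Vn] all h Om_left[OF cG[OF h(2)]] by simp
    let ?k = "inv\<^bsub>FP\<^esub> h"
    have n: "nf h" "nf ?k" using h nfc nf_inv by auto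
    have "?k \<in> Gam" using subgroup.m_inv_closed[OF sub cG[OF h(2)]] h by simp
    hence "keep h (\<lambda>j z. ?nOm j (fpm ?k z)) = keep h ?nOm" using n Om_left by (intro keep_cong) auto
    hence "fpm (keep ?k ?nOm) [] = []" using keep_fpm[OF Vn n(2,1)] fpm_inv(1)[OF n(1)] k by simp
    thus ?case using fpm_Nil[OF nf_keep[OF n(2)]] by simp
  next
    case (eng h1 h2)
    have h: "h1 \<in> Gam" "h2 \<in> Gam" using eng by (auto simp: Gam_def)
    hence "keep h2 (\<lambda>j z. ?nOm j (fpm h1 z)) = keep h2 ?nOm" using nfG Om_left by (intro keep_cong) auto
    thus ?case using keep_fpm[OF Vn nfG[OF h(1)] nfG[OF h(2)]] eng by (simp add: FP_simps)
  qed
  \<comment> \<open>The translate of \<open>Om\<close> by the inverse of \<open>l1\<close>, which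
    moves the base vertex of the orbit to (i, []).\<close>
  define Th where "Th j w \<longleftrightarrow> Om j (fpm l1 w)" for j w
  \<comment> \<open>A vertex of the orbit satisfies l1 w = y l1 h with y in \<open>Gam\<close> and h
    in the i-th factor. Deletion kills y, and also h, whose vertex is the one of \<open>l1\<close>.
    So l1 w and l1 have the same image, and w is killed relative to the translated set.\<close>
  have triv_Th: "keep w (\<lambda>j z. \<not> Th j z) = []" if w: "nf w" "Th i w" for w
  proof -
    obtain y h where y: "y \<in> Gam" "h \<in> carrier G" "fpm l1 w = fpm y (fpm l1 (syl i h))"
      using w by (auto simp: Th_def Om_def)
    have n: "nf y" "nf (fpm l1 (syl i h))" using y nfG l1 by (auto simp: nf_fpm)
    have "keep (fpm y (fpm l1 (syl i h))) ?nOm = fpm (keep y ?nOm) (keep (fpm l1 (syl i h)) (\<lambda>j z. ?nOm j (fpm y z)))"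
      using keep_fpm[OF Vn n] .
    also have "\<dots> = keep (fpm l1 (syl i h)) ?nOm"
      using keep_Gam[OF y(1)] keep_cong[OF _ n(2), of "\<lambda>j z. ?nOm j (fpm y z)" ?nOm] Om_left[OF y(1)] by simp
    also have "\<dots> = fpm (keep l1 ?nOm) (keep (syl i h) (\<lambda>j z. ?nOm j (fpm l1 z)))"
      using keep_fpm[OF Vn l1 nf_syl[OF y(2)]] .
    also have "keep (syl i h) (\<lambda>j z. ?nOm j (fpm l1 z)) = []"
      using Om_l1 l1 by (simp add: syl_def fpm_Nil)
    finally have "fpm (keep l1 ?nOm) (keep w (\<lambda>j z. ?nOm j (fpm l1 z))) = keep l1 ?nOm"
      using keep_fpm[OF Vn l1 w(1)] y fpm_Nil[OF nf_keep[OF l1]] by simp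
    hence "keep w (\<lambda>j z. ?nOm j (fpm l1 z)) = []"
      using FP.r_cancel_one'[of "keep l1 ?nOm" "keep w (\<lambda>j z. ?nOm j (fpm l1 z))"]
        FP.l_cancel_one[of "keep l1 ?nOm" "keep w (\<lambda>j z. ?nOm j (fpm l1 z))"] nf_keep[OF l1] nf_keep[OF w(1)]
      by (simp add: FP_simps)
    thus ?thesis by (simp add: Th_def)
  qed
  have lj: "nf l" "g \<in> carrier G" using x it by (auto simp: list_all_iff item_def)
  have ji: "j = i" and Oml: "Om i l" using all[OF x] by (auto simp: Om_def)
  let ?w = "fpm (inv\<^bsub>FP\<^esub> l1) l"
  have lw: "fpm l1 ?w = l" using l1 lj nf_inv[OF l1] by (simp add: fpm_assoc[symmetric] fpm_inv)
  have "?w \<in> syl i ` carrier G"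
  proof (rule stabilizer_of_trivial_keep[of Th])
    show "vertex_set Th" unfolding Th_def using vertex_set_shift[OF V l1] .
    show "Th i []" using Om_l1 l1 by (simp add: Th_def fpm_Nil)
    show "Th i ?w" using lw Oml by (simp add: Th_def)
    show "nf ?w" using nf_fpm nf_inv[OF l1] lj by blast
    show "j = i" if "Th j z" for j z using that by (simp add: Th_def Om_def)
    show "keep w (\<lambda>j z. \<not> Th j z) = []" if "nf w" "Th i w" for w using triv_Th that .
  qed
  thus ?thesis using ji lw by force
qed

end

section \<open>The embedding into a quotient of F(a,b)\<close>

lemma Fab_simps: "carrier Fab = {w. reduced w}" "u \<otimes>\<^bsub>Fab\<^esub> v = red (u @ v)" "\<one>\<^bsub>Fab\<^esub> = []"
  by (simp_all add: Fab_def free_grp_def)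

lemma group_Fab: "group Fab"
proof (rule groupI)
  show "\<exists>v\<in>carrier Fab. v \<otimes>\<^bsub>Fab\<^esub> u = \<one>\<^bsub>Fab\<^esub>" if "u \<in> carrier Fab" for u
    using that red_inv_cancel[of u "[]"] by (intro bexI[of _ "inv_word u"]) (simp_all add: Fab_simps)
qed (auto simp: Fab_simps red_append_red red_reduced)

lemma word_Fab [simp]: "word x \<in> carrier Fab" by (simp add: Fab_simps)

lemma word_mult: "word x \<otimes>\<^bsub>Fab\<^esub> word y = word (x + y)"
  by (simp add: Fab_simps word_plus)

lemma word_one: "\<one>\<^bsub>Fab\<^esub> = word 0" by (simp add: Fab_simps)

lemma word_inv: "inv\<^bsub>Fab\<^esub> (word x) = word (- x)"
  by (rule group.inv_equality[OF group_Fab]) (simp_all add: word_mult word_one del: word_0)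

lemma word_surj: "u \<in> carrier Fab \<Longrightarrow> \<exists>x. u = word x"
  by (auto simp: Fab_simps intro: exI[of _ "Fg u"] simp: Fg_inverse)

lemma normal_closure_normal:
  assumes "group K" "T \<subseteq> carrier K" shows "normal_closure K T \<lhd> K"
proof -
  interpret group K by fact
  let ?A = "{N. N \<lhd> K \<and> T \<subseteq> N}"
  have "carrier K \<lhd> K" by (rule normal_invI) (auto simp: subgroup_self)
  hence ne: "carrier K \<in> ?A" using assms by simp
  show ?thesis
    unfolding normal_closure_def
  proof (rule normal_invI)
    show "subgroup (\<Inter> ?A) K" using ne by (intro subgroups_Inter) (auto simp: normal_imp_subgroup)
    show "x \<otimes>\<^bsub>K\<^esub> h \<otimes>\<^bsub>K\<^esub> inv\<^bsub>K\<^esub> x \<in> \<Inter> ?A" if "h \<in> \<Inter> ?A" "x \<in> carrier K" for x h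
      using that normal.inv_op_closed2 by fastforce
  qed
qed

lemma normal_closure_incl: "T \<subseteq> normal_closure K T"
  by (auto simp: normal_closure_def)

lemma normal_closure_least: "N \<lhd> K \<Longrightarrow> T \<subseteq> N \<Longrightarrow> normal_closure K T \<subseteq> N"
  by (auto simp: normal_closure_def)

lemma conj_prod_simps: "conj_prod M [] gs = \<one>\<^bsub>M\<^esub>" "conj_prod M xs [] = \<one>\<^bsub>M\<^esub>"
  "conj_prod M (x # xs) (g # gs) = x \<otimes>\<^bsub>M\<^esub> g \<otimes>\<^bsub>M\<^esub> inv\<^bsub>M\<^esub> x \<otimes>\<^bsub>M\<^esub> conj_prod M xs gs"
  by (simp_all add: conj_prod_def)

lemma (in group) conj_prod_closed: "set xs \<subseteq> carrier G \<Longrightarrow> set gs \<subseteq> carrier G \<Longrightarrow> conj_prod G xs gs \<in> carrier G"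
  by (induction xs gs rule: list_induct2') (auto simp: conj_prod_simps)

lemma conj_prod_hom:
  assumes "group_hom G M h" "set xs \<subseteq> carrier G" "set gs \<subseteq> carrier G"
  shows "conj_prod M (map h xs) (map h gs) = h (conj_prod G xs gs)"
proof -
  interpret group_hom G M h by fact
  show ?thesis using assms(2,3)
    by (induction xs gs rule: list_induct2') (auto simp: conj_prod_simps G.conj_prod_closed)
qed

definition conj_sum :: "('a fg \<times> 'a fg) list \<Rightarrow> 'a fg" where
  "conj_sum s = sum_list (map (\<lambda>(u, b). u + b - u) s)"

lemma conj_sum_simps [simp]: "conj_sum [] = 0" "conj_sum ((u, b) # s) = u + b - u + conj_sum s"
  "conj_sum (s @ t) = conj_sum s + conj_sum t"
  by (simp_all add: conj_sum_def)

lemma conj_prod_Fab: "length us = length bs \<Longrightarrow> conj_prod Fab (map word us) (map word bs) = word (conj_sum (zip us bs))"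
  by (induction us bs rule: list_induct2)
    (simp_all add: conj_prod_simps word_mult word_inv word_one del: word_0)

lemma not_successivelyE:
  assumes "\<not> successively P s" obtains s1 p q s2 where "s = s1 @ p # q # s2" "\<not> P p q"
proof -
  have "\<exists>s1 p q s2. s = s1 @ p # q # s2 \<and> \<not> P p q" using assms
  proof (induction s)
    case (Cons a s)
    then obtain b t where s: "s = b # t" by (cases s) auto
    show ?case
    proof (cases "P a b")
      case True
      hence "\<not> successively P s" using Cons.prems s by simp
      then obtain s1 p q s2 where "s = s1 @ p # q # s2" "\<not> P p q" using Cons.IH by blast
      thus ?thesis by (intro exI[of _ "a # s1"] exI[of _ p] exI[of _ q] exI[of _ s2]) simp
    next
      case False
      thus ?thesis using s by (intro exI[of _ "[]"] exI[of _ a] exI[of _ b] exI[of _ t]) simp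
    qed
  qed simp
  thus ?thesis using that by blast
qed

locale sc_embedding = group G for G (structure) +
  fixes Xw :: "'a \<Rightarrow> abword"
  assumes reduced_Xw: "g \<in> carrier G \<Longrightarrow> g \<noteq> \<one> \<Longrightarrow> reduced (Xw g)"
    and sc: "small_cancellation (carrier G - {\<one>}) (\<lambda>g. Fg (Xw g))"
begin

sublocale SC: small_cancellation "carrier G - {\<one>}" "\<lambda>g. Fg (Xw g)"
  by (rule sc)

abbreviation "Wd \<equiv> SC.Wd"
abbreviation "be \<equiv> SC.be"

lemma eps_Nil [simp]: "eps G [] = \<one>"
  and eps_Cons: "eps G (y # w) = (if snd y then inv (fst y) else fst y) \<otimes> eps G w"
  by (simp_all add: eps_def)

lemma eps_closed [simp]: "w \<in> Wd \<Longrightarrow> eps G w \<in> carrier G"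
  by (induction w) (auto simp: eps_Cons)

lemma eps_append: "u \<in> Wd \<Longrightarrow> w \<in> Wd \<Longrightarrow> eps G (u @ w) = eps G u \<otimes> eps G w"
  by (induction u) (auto simp: eps_Cons m_assoc)

lemma eps_inv: "w \<in> Wd \<Longrightarrow> eps G (inv_word w) = inv (eps G w)"
proof (induction w)
  case (Cons y w)
  have "eps G (inv_word w @ [inv_letter y]) = eps G (inv_word w) \<otimes> eps G [inv_letter y]"
    using Cons.prems by (intro eps_append) (auto simp: inv_letter_def)
  thus ?case using Cons by (auto simp: inv_word_Cons eps_Cons inv_letter_def inv_mult_group)
qed simp

lemma eps_red: "w \<in> Wd \<Longrightarrow> eps G (red w) = eps G w"
proof (induction w)
  case (Cons y w)
  have IH: "eps G (red w) = eps G w" using Cons by simp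
  have rw: "red w \<in> Wd" using Cons by (intro SC.Wd_red) simp
  show ?case
  proof (cases "red w")
    case Nil
    thus ?thesis using IH by (simp add: red_Cons cons_red_def eps_Cons)
  next
    case (Cons m u)
    show ?thesis
    proof (cases "m = inv_letter y")
      case True
      have "eps G w = eps G (m # u)" using IH Cons by simp
      hence "eps G (y # w) = eps G u"
        using True Cons.prems rw Cons \<open>y # w \<in> Wd\<close> by (auto simp: eps_Cons inv_letter_def m_assoc[symmetric])
      thus ?thesis using True Cons by (simp add: red_Cons cons_red_def)
    next
      case False
      hence "red (y # w) = y # red w" using Cons by (simp add: red_Cons cons_red_def)
      thus ?thesis using IH by (simp add: eps_Cons)
    qed
  qed
qed simp

lemma be_0_eps: assumes "w \<in> Wd" "be w = 0" shows "eps G w = \<one>"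
proof -
  have "red w = []" using assms by (intro SC.be_eq_0) (auto simp: SC.Wd_red SC.be_red)
  thus ?thesis using eps_red[OF assms(1)] by simp
qed

lemma word_be: "w \<in> Wd \<Longrightarrow> word (be w) = beta Xw w"
proof (induction w)
  case (Cons y w)
  have y: "reduced (Xw (fst y))" using Cons.prems reduced_Xw by auto
  have "word (SC.val y) = (if snd y then inv_word (Xw (fst y)) else Xw (fst y))"
    using y by (simp add: SC.val_def word_uminus Fg_inverse)
  thus ?case using Cons by (simp add: word_plus beta_def red_append_red)
qed (simp add: beta_def)

lemma carrier_FG: "carrier (FG G) = {w \<in> Wd. reduced w}"
  by (auto simp: FG_def free_grp_def SC.Wd_def)

lemma kernel_FG: "kernel (FG G) G (eps G) = {w \<in> Wd. reduced w \<and> eps G w = \<one>}"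
  by (auto simp: kernel_def carrier_FG)

abbreviation "N \<equiv> Lgrp G Xw"

lemma normal_N: "N \<lhd> Fab"
  unfolding Lgrp_def by (intro normal_closure_normal group_Fab) (auto simp: Fab_simps beta_def)

lemma be_N: assumes "w \<in> Wd" "eps G w = \<one>" shows "word (be w) \<in> N"
proof -
  have "red w \<in> kernel (FG G) G (eps G)" using assms by (simp add: kernel_FG SC.Wd_red eps_red)
  hence "beta Xw (red w) \<in> N" unfolding Lgrp_def by (intro subsetD[OF normal_closure_incl] imageI)
  thus ?thesis using word_be[OF SC.Wd_red[OF assms(1)]] by (simp add: SC.be_red)
qed

section \<open>The normal closure of the relators\<close>

definition relator :: "('a \<times> bool) list \<Rightarrow> bool" where
  "relator w \<longleftrightarrow> w \<in> Wd \<and> eps G w = \<one>"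

text \<open>The normal closure in explicit form. Inverses need no separate mention because the
  inverse word of a relator is a relator.\<close>

definition relator_sums :: "ab fg set" where
  "relator_sums = {conj_sum (map (\<lambda>(u, w). (u, be w)) s) |s. list_all relator (map snd s)}"

lemma relator_sumsI: "list_all relator (map snd s) \<Longrightarrow> conj_sum (map (\<lambda>(u, w). (u, be w)) s) \<in> relator_sums"
  by (auto simp: relator_sums_def)

lemma relator_sumsE:
  assumes "x \<in> relator_sums"
  obtains s where "list_all relator (map snd s)" "x = conj_sum (map (\<lambda>(u, w). (u, be w)) s)"
  using assms by (auto simp: relator_sums_def)

lemma relator_sums_single: "relator w \<Longrightarrow> u + be w - u \<in> relator_sums"
  using relator_sumsI[of "[(u, w)]"] by simp

lemma relator_sums_0: "0 \<in> relator_sums"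
  using relator_sumsI[of "[]"] by simp

lemma relator_sums_add: assumes "x \<in> relator_sums" "y \<in> relator_sums" shows "x + y \<in> relator_sums"
proof -
  obtain s t where s: "list_all relator (map snd s)" "x = conj_sum (map (\<lambda>(u, w). (u, be w)) s)"
    and t: "list_all relator (map snd t)" "y = conj_sum (map (\<lambda>(u, w). (u, be w)) t)"
    using assms by (elim relator_sumsE)
  thus ?thesis using relator_sumsI[of "s @ t"] by simp
qed

lemma relator_sums_uminus: assumes "x \<in> relator_sums" shows "- x \<in> relator_sums"
proof -
  have "- conj_sum (map (\<lambda>(u, w). (u, be w)) s) \<in> relator_sums" if "list_all relator (map snd s)" for s using that
  proof (induction s)
    case (Cons p s)
    obtain u w where p: "p = (u, w)" by fastforce
    have "relator (inv_word w)" using Cons.prems p by (simp add: relator_def eps_inv)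
    hence "u + be (inv_word w) - u \<in> relator_sums" by (rule relator_sums_single)
    moreover have "- conj_sum (map (\<lambda>(u, w). (u, be w)) s) \<in> relator_sums" using Cons by simp
    moreover have "- conj_sum (map (\<lambda>(u, w). (u, be w)) (p # s)) =
      - conj_sum (map (\<lambda>(u, w). (u, be w)) s) + (u + be (inv_word w) - u)"
      by (simp add: p SC.be_inv grp del: add_uminus_conv_diff)
    ultimately show ?case using relator_sums_add by metis
  qed (simp add: relator_sums_0)
  thus ?thesis using assms by (auto elim: relator_sumsE)
qed

lemma relator_sums_conj: assumes "x \<in> relator_sums" shows "v + x - v \<in> relator_sums"
proof -
  have "v + conj_sum (map (\<lambda>(u, w). (u, be w)) s) - v \<in> relator_sums" if "list_all relator (map snd s)" for s using that
  proof (induction s)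
    case (Cons p s)
    obtain u w where p: "p = (u, w)" by fastforce
    have "(v + u) + be w - (v + u) \<in> relator_sums" using Cons p by (intro relator_sums_single) simp
    moreover have "v + conj_sum (map (\<lambda>(u, w). (u, be w)) s) - v \<in> relator_sums" using Cons by simp
    moreover have "v + conj_sum (map (\<lambda>(u, w). (u, be w)) (p # s)) - v =
      ((v + u) + be w - (v + u)) + (v + conj_sum (map (\<lambda>(u, w). (u, be w)) s) - v)"
      by (simp add: p grp del: add_uminus_conv_diff)
    ultimately show ?case using relator_sums_add by metis
  qed (simp add: relator_sums_0)
  thus ?thesis using assms by (auto elim: relator_sumsE)
qed

lemma N_relator_sums: "N \<subseteq> word ` relator_sums"
  unfolding Lgrp_def
proof (rule normal_closure_least)
  show "word ` relator_sums \<lhd> Fab"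
  proof (rule group.normal_invI[OF group_Fab])
    show "subgroup (word ` relator_sums) Fab"
    proof (rule group.subgroupI[OF group_Fab])
      show "word ` relator_sums \<noteq> {}" using relator_sums_0 by blast
      show "inv\<^bsub>Fab\<^esub> a \<in> word ` relator_sums" if a: "a \<in> word ` relator_sums" for a
      proof -
        obtain x where x: "a = word x" "x \<in> relator_sums" using a by (rule imageE)
        show ?thesis unfolding x(1) word_inv by (intro imageI relator_sums_uminus x)
      qed
      show "a \<otimes>\<^bsub>Fab\<^esub> b \<in> word ` relator_sums" if ab: "a \<in> word ` relator_sums" "b \<in> word ` relator_sums" for a b
      proof -
        obtain x where x: "a = word x" "x \<in> relator_sums" using ab(1) by (rule imageE)
        obtain y where y: "b = word y" "y \<in> relator_sums" using ab(2) by (rule imageE)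
        show ?thesis unfolding x(1) y(1) word_mult by (intro imageI relator_sums_add x y)
      qed
    qed auto
    fix a h assume h: "h \<in> word ` relator_sums" and a: "a \<in> carrier Fab"
    obtain v where v: "a = word v" using word_surj[OF a] by blast
    obtain x where x: "h = word x" "x \<in> relator_sums" using h by (rule imageE)
    have "a \<otimes>\<^bsub>Fab\<^esub> h \<otimes>\<^bsub>Fab\<^esub> inv\<^bsub>Fab\<^esub> a = word (v + x - v)" by (simp add: v x(1) word_mult word_inv)
    thus "a \<otimes>\<^bsub>Fab\<^esub> h \<otimes>\<^bsub>Fab\<^esub> inv\<^bsub>Fab\<^esub> a \<in> word ` relator_sums"
      using imageI[OF relator_sums_conj[OF x(2)], of word v] by simp
  qed
  show "beta Xw ` kernel (FG G) G (eps G) \<subseteq> word ` relator_sums"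
  proof
    fix b assume "b \<in> beta Xw ` kernel (FG G) G (eps G)"
    then obtain w where w: "relator w" "b = word (be w)" by (auto simp: kernel_FG relator_def word_be)
    show "b \<in> word ` relator_sums" unfolding w(2) using imageI[OF relator_sums_single[OF w(1), of 0], of word] by simp
  qed
qed

definition cong :: "ab fg \<Rightarrow> ab fg \<Rightarrow> bool" where
  "cong x y \<longleftrightarrow> word (- x + y) \<in> N"

lemma subgroup_N: "subgroup N Fab"
  using normal_imp_subgroup normal_N by blast

lemma N_add: "word x \<in> N \<Longrightarrow> word y \<in> N \<Longrightarrow> word (x + y) \<in> N"
  using subgroup.m_closed[OF subgroup_N] by (simp only: word_mult[symmetric])
lemma N_uminus: "word x \<in> N \<Longrightarrow> word (- x) \<in> N"
  using subgroup.m_inv_closed[OF subgroup_N] by (simp only: word_inv[symmetric])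
lemma N_0: "word 0 \<in> N"
  using subgroup.one_closed[OF subgroup_N] by (simp only: word_one)
lemma N_conj: "word x \<in> N \<Longrightarrow> word (v + x - v) \<in> N"
  using normal.inv_op_closed2[OF normal_N, of "word v" "word x"] by (simp add: word_mult word_inv)

lemma cong_refl: "cong x x" using N_0 by (simp add: cong_def)
lemma cong_sym: "cong x y \<Longrightarrow> cong y x"
  unfolding cong_def using N_uminus[of "- x + y"] by (simp add: minus_add)
lemma cong_trans: "cong x y \<Longrightarrow> cong y z \<Longrightarrow> cong x z"
  unfolding cong_def using N_add[of "- x + y" "- y + z"] by (simp add: grp del: add_uminus_conv_diff)
lemma cong_add: "cong x y \<Longrightarrow> cong x' y' \<Longrightarrow> cong (x + x') (y + y')"
proof -
  assume h: "cong x y" "cong x' y'"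
  have "word (- x' + (- x + y) - (- x')) \<in> N" using h N_conj by (simp only: cong_def)
  hence "word (- x' + (- x + y) - (- x') + (- x' + y')) \<in> N" using h N_add by (simp only: cong_def)
  moreover have "- x' + (- x + y) - (- x') + (- x' + y') = - (x + x') + (y + y')"
    by (simp add: grp del: add_uminus_conv_diff)
  ultimately show ?thesis by (simp only: cong_def)
qed

lemma cong_be: assumes "w \<in> Wd" "w' \<in> Wd" "eps G w = eps G w'" shows "cong (be w) (be w')"
proof -
  have "eps G (inv_word w @ w') = \<one>" using assms by (simp add: eps_append eps_inv)
  thus ?thesis using be_N[of "inv_word w @ w'"] assms by (simp add: cong_def SC.be_inv)
qed

text \<open>The free basis omits the identity of G, which is therefore represented by the empty
  word.\<close>

definition wd :: "'a \<Rightarrow> ('a \<times> bool) list" where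
  "wd g = (if g = \<one> then [] else [(g, False)])"

lemma wd [simp]: "g \<in> carrier G \<Longrightarrow> wd g \<in> Wd" "g \<in> carrier G \<Longrightarrow> eps G (wd g) = g" "reduced (wd g)"
  by (auto simp: wd_def eps_Cons)

section \<open>The quotient H and the embedded group\<close>

abbreviation "H \<equiv> Hgrp G Xw"

definition proj :: "ab fg \<Rightarrow> abword set" where
  "proj x = N #>\<^bsub>Fab\<^esub> word x"

lemma group_H: "group H"
  unfolding Hgrp_def by (rule normal.factorgroup_is_group[OF normal_N])

lemma proj_hom: "group_hom Fab H (\<lambda>u. N #>\<^bsub>Fab\<^esub> u)"
  unfolding Hgrp_def
  by (intro group_hom.intro group_hom_axioms.intro group_Fab normal.factorgroup_is_group normal.r_coset_hom_Mod normal_N)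

lemma proj_closed [simp]: "proj x \<in> carrier H"
  unfolding proj_def by (rule group_hom.hom_closed[OF proj_hom]) simp

lemma proj_mult: "proj x \<otimes>\<^bsub>H\<^esub> proj y = proj (x + y)"
  unfolding proj_def word_mult[symmetric] by (rule group_hom.hom_mult[OF proj_hom, symmetric]) simp_all

lemma proj_surj: assumes "X' \<in> carrier H" shows "\<exists>x. X' = proj x"
proof -
  obtain u where "u \<in> carrier Fab" "X' = N #>\<^bsub>Fab\<^esub> u"
    using assms by (auto simp: Hgrp_def FactGroup_def RCOSETS_def)
  thus ?thesis using word_surj by (auto simp: proj_def)
qed

lemma proj_eq: "proj x = proj y \<longleftrightarrow> word (x - y) \<in> N"
proof -
  interpret group_hom Fab H "\<lambda>u. N #>\<^bsub>Fab\<^esub> u" by (rule proj_hom)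
  have "proj x = proj y \<longleftrightarrow> word y \<in> N #>\<^bsub>Fab\<^esub> word x"
  proof
    assume "proj x = proj y"
    thus "word y \<in> N #>\<^bsub>Fab\<^esub> word x" unfolding proj_def using G.rcos_self[OF word_Fab subgroup_N] by blast
  next
    assume "word y \<in> N #>\<^bsub>Fab\<^esub> word x"
    from G.repr_independence[OF this word_Fab subgroup_N] show "proj x = proj y" by (simp add: proj_def)
  qed
  also have "\<dots> \<longleftrightarrow> word (y - x) \<in> N"
  proof
    assume "word y \<in> N #>\<^bsub>Fab\<^esub> word x"
    then obtain n where n: "n \<in> N" "word y = n \<otimes>\<^bsub>Fab\<^esub> word x" by (auto simp: r_coset_def)
    then obtain z where z: "n = word z" using word_surj subgroup.mem_carrier[OF subgroup_N] by blast
    hence "y = z + x" using n word_mult by (simp add: word_inject)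
    thus "word (y - x) \<in> N" using n z by (simp add: add.assoc)
  next
    assume "word (y - x) \<in> N"
    moreover have "word y = word (y - x) \<otimes>\<^bsub>Fab\<^esub> word x" by (simp add: word_mult)
    ultimately show "word y \<in> N #>\<^bsub>Fab\<^esub> word x" unfolding r_coset_def by blast
  qed
  also have "\<dots> \<longleftrightarrow> word (x - y) \<in> N" using N_uminus[of "y - x"] N_uminus[of "x - y"] unfolding minus_diff_eq by blast
  finally show ?thesis .
qed

lemma proj_cong: "cong x y \<Longrightarrow> proj x = proj y"
  using N_conj[of "- x + y" x] N_uminus unfolding proj_eq cong_def
  by (simp add: grp del: add_uminus_conv_diff) (metis minus_add minus_minus)

lemma proj_1: "proj x = \<one>\<^bsub>H\<^esub> \<longleftrightarrow> word x \<in> N"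
proof -
  have "\<one>\<^bsub>H\<^esub> = proj 0" unfolding proj_def word_one[symmetric] using group_hom.hom_one[OF proj_hom] by simp
  thus ?thesis using proj_eq[of x 0] by simp
qed

lemma gamma_eps: assumes "w \<in> Wd" shows "gamma G Xw (eps G w) = proj (be w)"
proof -
  let ?w = "SOME v. v \<in> carrier (FG G) \<and> eps G v = eps G w"
  have "red w \<in> carrier (FG G) \<and> eps G (red w) = eps G w" using assms by (simp add: carrier_FG SC.Wd_red eps_red)
  hence w: "?w \<in> carrier (FG G) \<and> eps G ?w = eps G w" by (rule someI)
  hence "gamma G Xw (eps G w) = proj (be ?w)" by (simp add: gamma_def proj_def word_be carrier_FG)
  also have "\<dots> = proj (be w)" using w assms by (intro proj_cong cong_be) (auto simp: carrier_FG)
  finally show ?thesis .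
qed

lemma gamma_wd: "g \<in> carrier G \<Longrightarrow> gamma G Xw g = proj (be (wd g))"
  using gamma_eps[of "wd g"] by simp

lemma gamma_hom: "group_hom G H (gamma G Xw)"
proof (intro group_hom.intro group_hom_axioms.intro group_axioms group_H homI)
  fix g h assume gh: "g \<in> carrier G" "h \<in> carrier G"
  have "gamma G Xw (eps G (wd g @ wd h)) = proj (be (wd g @ wd h))" using gh by (intro gamma_eps) simp
  thus "gamma G Xw (g \<otimes> h) = gamma G Xw g \<otimes>\<^bsub>H\<^esub> gamma G Xw h"
    using gh by (simp add: eps_append gamma_wd proj_mult)
qed (simp add: gamma_wd)

section \<open>From the normal closure to the free product\<close>

definition evK :: "(ab fg \<times> ('a \<times> bool) list) list \<Rightarrow> ab fg" where
  "evK s = conj_sum (map (\<lambda>(r, w). (r, be w)) s)"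

text \<open>The homomorphism from the normal closure of \<open>F\<close> to the free product M is
  never defined as a function. It is handled through lists of syllables, evaluated by
  \<open>evK\<close> in the free group and by \<open>evM\<close> in M.\<close>

definition evM :: "(ab fg \<times> ('a \<times> bool) list) list \<Rightarrow> (ab fg \<times> 'a) list" where
  "evM s = foldr (\<lambda>(r, w). lm r (eps G w)) s []"

lemma evK_simps [simp]: "evK [] = 0" "evK ((r, w) # s) = r + be w - r + evK s" "evK (s @ t) = evK s + evK t"
  by (simp_all add: evK_def)

lemma evM_simps [simp]: "evM [] = []" "evM ((r, w) # s) = lm r (eps G w) (evM s)"
  by (simp_all add: evM_def)

definition sylls :: "ab fg set \<Rightarrow> (ab fg \<times> ('a \<times> bool) list) list \<Rightarrow> bool" where
  "sylls R s \<longleftrightarrow> set s \<subseteq> R \<times> Wd"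

lemma sylls_simps [simp]: "sylls R []" "sylls R ((r, w) # s) \<longleftrightarrow> r \<in> R \<and> w \<in> Wd \<and> sylls R s"
  "sylls R (s @ t) \<longleftrightarrow> sylls R s \<and> sylls R t"
  by (auto simp: sylls_def)

lemma nf_evM: "sylls R s \<Longrightarrow> nf (evM s)"
  by (induction s) (auto simp: nf_lm)

lemma evM_append: "sylls R s \<Longrightarrow> sylls R t \<Longrightarrow> evM (s @ t) = fpm (evM s) (evM t)"
  by (induction s) (auto simp: fpm_lm nf_evM)

lemma evM_trivial:
  assumes free: "SC.free R" and "sylls R s" "evK s = 0"
  shows "evM s = []"
  using assms(2,3)
proof (induction "length s" arbitrary: s rule: less_induct)
  case less
  let ?s = "map (\<lambda>(r, w). (r, be w)) s"
  have ev: "SC.ev ?s = evK s"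
    by (induction s) auto
  consider (drop) r w where "(r, w) \<in> set s" "be w = 0"
    | (merge) "\<not> successively (\<lambda>p q. fst p \<noteq> fst q) s"
    | (alt) "\<And>r w. (r, w) \<in> set s \<Longrightarrow> be w \<noteq> 0" "successively (\<lambda>p q. fst p \<noteq> fst q) s" by blast
  thus ?case
  proof cases
    case drop
    then obtain s1 s2 where s: "s = s1 @ (r, w) # s2" by (auto dest: split_list)
    have o: "sylls R s1" "sylls R s2" "w \<in> Wd" using less.prems(1) s by auto
    have e: "eps G w = \<one>" using be_0_eps[OF o(3)] drop by simp
    have "evM (s1 @ s2) = []" using less s drop by (intro less.hyps) auto
    thus ?thesis using o s e less.prems(1) by (simp add: evM_append)
  next
    case merge
    then obtain s1 p q s2 where s': "s = s1 @ p # q # s2" "fst p = fst q"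
      by (rule not_successivelyE) simp
    obtain r w w' where pq: "p = (r, w)" "q = (r, w')" using s' by (cases p; cases q) auto
    have s: "s = s1 @ (r, w) # (r, w') # s2" using s' pq by simp
    have o: "sylls R s1" "sylls R s2" "w \<in> Wd" "w' \<in> Wd" "r \<in> R" using less.prems(1) s by auto
    let ?t = "s1 @ (r, w @ w') # s2"
    have "evM ?t = []"
    proof (rule less.hyps)
      have "r + be w - r + (r + be w' - r + c) = r + (be w + be w') - r + c" for c
        by (simp add: grp del: add_uminus_conv_diff)
      thus "evK ?t = 0" using less.prems(2) s by simp
    qed (use less.prems s in auto)
    moreover have "evM ?t = evM s" using o s nf_evM[OF o(2)] by (simp add: evM_append eps_append lm_lm)
    ultimately show ?thesis by simp
  next
    case alt
    have "set ?s \<subseteq> R \<times> (SC.F - {0})" using less.prems(1) alt(1) by (auto simp: sylls_def SC.F_def)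
    moreover have "successively (\<lambda>p q. fst p \<noteq> fst q) ?s"
      using alt(2) by (simp add: successively_map case_prod_unfold)
    moreover have "SC.ev ?s = 0" using ev less.prems(2) by simp
    ultimately have "?s = []" using free unfolding SC.free_def by blast
    thus ?thesis by simp
  qed
qed

text \<open>A map back from M to the free group. The words \<open>wd g\<close> are arbitrary
  choices, so it inverts the passage to M only modulo N.\<close>

definition chi :: "(ab fg \<times> 'a) list \<Rightarrow> ab fg" where
  "chi s = evK (map (\<lambda>(r, g). (r, wd g)) s)"

lemma chi_lm:
  assumes "nf t" "w \<in> Wd" shows "cong (chi (lm r (eps G w) t)) (r + be w - r + chi t)"
proof -
  have conj: "cong (r + x - r) (r + y - r)" if "cong x y" for x y
    unfolding diff_conv_add_uminus by (intro cong_add cong_refl that)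
  have single: "cong (r + be (wd (eps G w)) - r) (r + be w - r)"
    using assms by (intro conj cong_be) auto
  show ?thesis
  proof (cases "eps G w = \<one>")
    case True
    hence "cong 0 (r + be w - r)" using single by (simp add: wd_def)
    from cong_add[OF this cong_refl[of "chi t"]] show ?thesis using True by simp
  next
    case w1: False
    show ?thesis
    proof (cases "t \<noteq> [] \<and> fst (hd t) = r")
      case False
      hence "lm r (eps G w) t = (r, eps G w) # t" using w1 by (cases "(r, eps G w, t)" rule: lm.cases) auto
      thus ?thesis using cong_add[OF single cong_refl[of "chi t"]] by (simp add: chi_def)
    next
      case True
      then obtain h t' where t: "t = (r, h) # t'" by (cases t) auto
      have h: "h \<in> carrier G" using assms t by simp
      have rhs: "r + be w - r + chi t = r + be (w @ wd h) - r + chi t'"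
        by (simp add: t chi_def grp del: add_uminus_conv_diff)
      have e: "eps G (w @ wd h) = eps G w \<otimes> h" using assms h by (simp add: eps_append)
      have gh: "eps G w \<otimes> h \<in> carrier G" using assms h by simp
      have "cong (r + be (wd (eps G w \<otimes> h)) - r) (r + be (w @ wd h) - r)"
        using e h assms gh by (intro conj cong_be) auto
      from cong_add[OF this cong_refl[of "chi t'"]]
      have "cong (r + be (wd (eps G w \<otimes> h)) - r + chi t') (r + be w - r + chi t)" unfolding rhs .
      moreover have "chi (lm r (eps G w) t) = r + be (wd (eps G w \<otimes> h)) - r + chi t'"
        using w1 t by (auto simp: chi_def wd_def)
      ultimately show ?thesis by simp
    qed
  qed
qed

lemma chi_evM: "sylls R s \<Longrightarrow> cong (chi (evM s)) (evK s)"
proof (induction s)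
  case Nil
  thus ?case by (simp add: chi_def cong_refl)
next
  case (Cons p s)
  obtain r w where p: "p = (r, w)" by fastforce
  have o: "w \<in> Wd" "sylls R s" using Cons.prems p by auto
  have "cong (chi (lm r (eps G w) (evM s))) (r + be w - r + chi (evM s))" using nf_evM[OF o(2)] o(1) by (rule chi_lm)
  moreover have "cong (r + be w - r + chi (evM s)) (r + be w - r + evK s)" using Cons.IH[OF o(2)] cong_add cong_refl by blast
  ultimately show ?case using cong_trans p by simp
qed

text \<open>The Bass--Serre vertex (r, l) corresponds to the coset uF: l is an image in the free product of the element of the
  normal closure that takes rF to uF.\<close>

definition represents :: "ab fg set \<Rightarrow> ab fg \<Rightarrow> (ab fg \<times> 'a) list \<Rightarrow> ab fg \<Rightarrow> bool" where
  "represents R u l r \<longleftrightarrow> r \<in> R \<and>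
    (\<exists>s w. sylls R s \<and> w \<in> Wd \<and> u = evK s + r + be w \<and> l = fpm (evM s) (syl r (eps G w)))"

lemma represents_ex: assumes "u \<in> SC.Orb R" shows "\<exists>l r. represents R u l r"
proof -
  obtain x r f where x: "x \<in> SC.L R" "r \<in> R" "f \<in> SC.F" "u = x + r + f" using assms by (auto simp: SC.Orb_def)
  have "\<exists>t. sylls R t \<and> evK t = SC.ev s" if "set s \<subseteq> R \<times> SC.F" for s using that
  proof (induction s)
    case Nil
    thus ?case by (intro exI[of _ "[]"]) simp
  next
    case (Cons p s)
    obtain r f where p: "p = (r, f)" by fastforce
    obtain t where t: "sylls R t" "evK t = SC.ev s" using Cons by auto
    have "f \<in> SC.F" using Cons p by simp
    then obtain w where "w \<in> Wd" "f = be w" unfolding SC.F_def by blast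
    thus ?case using t Cons.prems p by (intro exI[of _ "(r, w) # t"]) simp
  qed
  then obtain s where s: "sylls R s" "evK s = x" using x(1) unfolding SC.L_def by blast
  obtain w where w: "w \<in> Wd" "f = be w" using x(3) unfolding SC.F_def by blast
  show ?thesis unfolding represents_def using s w x by blast
qed

lemma represents_nf: "represents R u l r \<Longrightarrow> nf l"
  by (auto simp: represents_def nf_fpm nf_evM)

lemma represents_cong: assumes "represents R u l r" shows "cong (chi l + r) u"
proof -
  obtain s w where s: "r \<in> R" "sylls R s" "w \<in> Wd" "u = evK s + r + be w" "l = fpm (evM s) (syl r (eps G w))"
    using assms by (auto simp: represents_def)
  have o: "sylls R [(r, w)]" using s by simp
  have "l = evM (s @ [(r, w)])" using evM_append[OF s(2) o] s(5) by (simp add: syl_def)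
  hence "cong (chi l) (evK (s @ [(r, w)]))" using chi_evM[of R "s @ [(r, w)]"] s by simp
  hence "cong (chi l + r) (evK (s @ [(r, w)]) + r)" using cong_add cong_refl by blast
  moreover have "evK (s @ [(r, w)]) + r = u" using s(4) by (simp add: grp del: add_uminus_conv_diff)
  ultimately show ?thesis by simp
qed

text \<open>Carries vertices of M back to H: if the representatives of two cosets differ by an
  element h of the factor, applying \<open>chi\<close> shows that u and u' differ by h modulo N.
  This turns a single vertex into a single left coset.\<close>

lemma represents_cong_eq:
  assumes "represents R u l r" "represents R u' l' r" "l' = fpm l (syl r h)" "h \<in> carrier G"
  shows "cong (u + be (wd h)) u'"
proof -
  obtain s w where s: "r \<in> R" "sylls R s" "w \<in> Wd" "u = evK s + r + be w" "l = fpm (evM s) (syl r (eps G w))"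
    using assms(1) by (auto simp: represents_def)
  have n: "nf (evM s)" using s nf_evM by blast
  have "represents R (u + be (wd h)) l' r"
    unfolding represents_def
  proof (intro conjI exI)
    show "u + be (wd h) = evK s + r + be (w @ wd h)" using s by (simp add: add.assoc)
    have "fpm (syl r (eps G w)) (syl r h) = syl r (eps G w \<otimes> h)"
      using hom_mult[OF syl_hom[of r], of "eps G w" h] s assms(4) by (simp add: FP_simps)
    thus "l' = fpm (evM s) (syl r (eps G (w @ wd h)))"
      using assms(3,4) s n by (simp add: fpm_assoc eps_append)
  qed (use s assms in auto)
  hence "cong (chi l' + r) (u + be (wd h))" by (rule represents_cong)
  moreover have "cong (chi l' + r) u'" using assms(2) by (rule represents_cong)
  ultimately show ?thesis using cong_sym cong_trans by blast
qed

definition inv_run :: "(ab fg \<times> ('a \<times> bool) list) list \<Rightarrow> (ab fg \<times> ('a \<times> bool) list) list" where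
  "inv_run s = rev (map (\<lambda>(r, w). (r, inv_word w)) s)"

lemma inv_run_simps [simp]: "inv_run [] = []" "inv_run ((r, w) # s) = inv_run s @ [(r, inv_word w)]"
  by (simp_all add: inv_run_def)

lemma sylls_inv_run: "sylls R s \<Longrightarrow> sylls R (inv_run s)"
  by (induction s) auto

lemma evK_inv_run: "evK (inv_run s) = - evK s"
  by (induction s) (auto simp: SC.be_inv grp simp del: add_uminus_conv_diff)

lemma evM_inv_run: "sylls R s \<Longrightarrow> evM (inv_run s) = inv\<^bsub>FP\<^esub> (evM s)"
proof (rule inv_FP_eqI[symmetric])
  have "fpm (evM (inv_run s)) (fpm (evM s) z) = z" if "sylls R s" "nf z" for z using that
  proof (induction s arbitrary: z)
    case (Cons p s)
    obtain r w where p: "p = (r, w)" by fastforce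
    have o: "w \<in> Wd" "sylls R s" "r \<in> R" using Cons.prems p by auto
    have "evM (inv_run (p # s)) = fpm (evM (inv_run s)) (syl r (inv (eps G w)))"
      using o sylls_inv_run[OF o(2)] evM_append[of R "inv_run s" "[(r, inv_word w)]"] p by (simp add: eps_inv syl_def)
    moreover have "fpm (evM (p # s)) z = lm r (eps G w) (fpm (evM s) z)"
      using p o Cons.prems nf_evM[OF o(2)] by (simp add: fpm_lm)
    ultimately have "fpm (evM (inv_run (p # s))) (fpm (evM (p # s)) z) =
      fpm (evM (inv_run s)) (lm r (inv (eps G w)) (lm r (eps G w) (fpm (evM s) z)))"
      using o Cons.prems nf_evM[OF sylls_inv_run[OF o(2)]] nf_evM[OF o(2)]
      by (simp add: fpm_assoc fpm_syl nf_lm nf_fpm)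
    also have "\<dots> = z" using o Cons.prems Cons.IH nf_evM[OF o(2)] by (simp add: lm_cancel nf_fpm)
    finally show ?case .
  qed simp
  from this[of "[]"] show "sylls R s \<Longrightarrow> fpm (evM (inv_run s)) (evM s) = []"
    using fpm_Nil[OF nf_evM[of R s]] by simp
qed (use nf_evM sylls_inv_run in blast)+

text \<open>Each conjugate is written as a list of syllables with indices in R. The concatenation
  has value 0 in the free group, so \<open>evM_trivial\<close> applies to it.\<close>

lemma product_trivial:
  assumes free: "SC.free R" and rep: "\<And>u. represents R u (hat u) (idx u)"
    and s: "list_all (\<lambda>(u, w). w \<in> Wd) s" "conj_sum (map (\<lambda>(u, w). (u, be w)) s) = 0"
  shows "product (map (\<lambda>(u, w). (hat u, idx u, eps G w)) s) = []"
proof -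
  have "\<exists>t. sylls R t \<and> evK t = conj_sum (map (\<lambda>(u, w). (u, be w)) s) \<and>
      evM t = product (map (\<lambda>(u, w). (hat u, idx u, eps G w)) s)" if "list_all (\<lambda>(u, w). w \<in> Wd) s" for s
    using that
  proof (induction s)
    case Nil
    thus ?case by (intro exI[of _ "[]"]) simp
  next
    case (Cons p s)
    obtain u w where p: "p = (u, w)" by fastforce
    have w: "w \<in> Wd" using Cons.prems p by simp
    obtain t where t: "sylls R t" "evK t = conj_sum (map (\<lambda>(u, w). (u, be w)) s)"
      "evM t = product (map (\<lambda>(u, w). (hat u, idx u, eps G w)) s)" using Cons by auto
    obtain a v where a: "idx u \<in> R" "sylls R a" "v \<in> Wd" "u = evK a + idx u + be v"
      "hat u = fpm (evM a) (syl (idx u) (eps G v))" using rep[of u] by (auto simp: represents_def)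
    \<comment> \<open>Since u equals \<open>evK a + idx u + be v\<close>, the conjugate of
      \<open>be w\<close> by u is the run \<open>a\<close>, then three syllables of the single index
      \<open>idx u\<close>, then the inverse run.\<close>
    let ?c = "[(idx u, v), (idx u, w), (idx u, inv_word v)]"
    let ?t = "a @ ?c @ inv_run a @ t"
    have oc: "sylls R ?c" using a w by simp
    have oi: "sylls R (inv_run a)" using a sylls_inv_run by blast
    have e: "evK (a @ ?c @ inv_run a) = u + be w - u"
      by (subst (1 2) a(4)) (simp add: evK_inv_run SC.be_inv grp del: add_uminus_conv_diff)
    have "evK ?t = evK (a @ ?c @ inv_run a) + evK t" by (simp only: evK_simps(3) add.assoc)
    hence 1: "evK ?t = u + be w - u + evK t" unfolding e .
    have nfa: "nf (evM a)" "nf (evM (inv_run a))" "nf (evM t)" "nf (evM ?c)"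
      using nf_evM a(2) oi t(1) oc by blast+
    have gs: "eps G v \<in> carrier G" "eps G w \<in> carrier G" using a w by auto
    interpret FP: group FP by (rule group_FP)
    interpret hom: group_hom G FP "syl (idx u)"
      by (intro group_hom.intro group_hom_axioms.intro group_FP syl_hom group_axioms)
    have c: "evM ?c = syl (idx u) (eps G v) \<otimes>\<^bsub>FP\<^esub> syl (idx u) (eps G w) \<otimes>\<^bsub>FP\<^esub> inv\<^bsub>FP\<^esub> (syl (idx u) (eps G v))"
    proof -
      have "evM ?c = syl (idx u) (eps G v \<otimes> eps G w \<otimes> inv (eps G v))"
        using a(3) w gs by (simp add: eps_inv syl_def lm_lm nf_lm m_assoc del: lm.simps)
      thus ?thesis using gs by simp
    qed
    have A: "evM a \<in> carrier FP" "syl (idx u) (eps G v) \<in> carrier FP" "syl (idx u) (eps G w) \<in> carrier FP"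
      using nfa gs by (auto simp: FP_simps)
    have "conjugate (hat u, idx u, eps G w) = evM a \<otimes>\<^bsub>FP\<^esub> evM ?c \<otimes>\<^bsub>FP\<^esub> inv\<^bsub>FP\<^esub> (evM a)"
      unfolding conjugate_def a(5) FP_simps(2)[symmetric] c prod.case
      using A by (simp add: FP.inv_mult_group FP.m_assoc)
    also have "\<dots> = fpm (evM a) (fpm (evM ?c) (evM (inv_run a)))"
      using nfa evM_inv_run[OF a(2)] by (simp add: FP_simps fpm_assoc)
    finally have c': "conjugate (hat u, idx u, eps G w) = fpm (evM a) (fpm (evM ?c) (evM (inv_run a)))" .
    have o1: "sylls R (inv_run a @ t)" using oi t(1) by simp
    have o2: "sylls R (?c @ inv_run a @ t)" using oc o1 unfolding sylls_simps(3) by blast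
    have "evM ?t = fpm (evM a) (fpm (evM ?c) (fpm (evM (inv_run a)) (evM t)))"
      unfolding evM_append[OF a(2) o2] evM_append[OF oc o1] evM_append[OF oi t(1)] by (rule refl)
    also have "\<dots> = fpm (conjugate (hat u, idx u, eps G w)) (evM t)"
      unfolding c' using nfa by (simp only: fpm_assoc nf_fpm)
    finally have "evM ?t = fpm (conjugate (hat u, idx u, eps G w)) (evM t)" .
    thus ?case using 1 t a w oc oi p by (intro exI[of _ ?t]) simp
  qed
  from this[OF s(1)] obtain t where "sylls R t" "evK t = 0"
    "evM t = product (map (\<lambda>(u, w). (hat u, idx u, eps G w)) s)" using s(2) by auto
  thus ?thesis using evM_trivial[OF free] by metis
qed

lemma product_append: "list_all item xs \<Longrightarrow> list_all item ys \<Longrightarrow> product (xs @ ys) = fpm (product xs) (product ys)"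
  by (induction xs) (auto simp: fpm_assoc nf_product nf_conjugate)

lemma conjugate_one: "nf l \<Longrightarrow> conjugate (l, i, \<one>) = []"
  using fpm_inv(2)[of l] by (simp add: conjugate_def FP_simps syl_def fpm_Nil)

lemma product_relators: "list_all (\<lambda>(l, i, g). nf l \<and> g = \<one>) xs \<Longrightarrow> product xs = []"
  by (induction xs) (auto simp: conjugate_one)

text \<open>An equation in H becomes one in the free group after appending suitable conjugates of
  relators. In M each appended factor is a conjugate of the identity, so the original factors alone
  have trivial product there.\<close>

lemma lift_equation:
  assumes free: "SC.free R" and rep: "\<And>u. represents R u (hat u) (idx u)"
    and gs: "set gs \<subseteq> carrier G" and len: "length us = length gs"
    and eq: "conj_prod H (map proj us) (map (gamma G Xw) gs) = \<one>\<^bsub>H\<^esub>"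
  shows "product (map (\<lambda>(u, g). (hat u, idx u, g)) (zip us gs)) = []"
proof -
  let ?s = "map (\<lambda>(u, g). (u, wd g)) (zip us gs)"
  let ?f = "\<lambda>(u, w). (u, be w)"
  have g: "map (gamma G Xw) gs = map proj (map (\<lambda>g. be (wd g)) gs)" using gs by (auto simp: gamma_wd)
  have "conj_prod H (map proj us) (map (gamma G Xw) gs) =
    N #>\<^bsub>Fab\<^esub> conj_prod Fab (map word us) (map word (map (\<lambda>g. be (wd g)) gs))"
    unfolding g using conj_prod_hom[OF proj_hom, of "map word us" "map word (map (\<lambda>g. be (wd g)) gs)"]
    by (simp add: proj_def[abs_def] o_def image_subset_iff)
  also have "\<dots> = proj (conj_sum (map ?f ?s))"
    using len by (subst conj_prod_Fab) (simp_all add: proj_def zip_map2 o_def case_prod_unfold)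
  finally have "proj (conj_sum (map ?f ?s)) = \<one>\<^bsub>H\<^esub>" unfolding eq by (rule sym)
  hence "word (conj_sum (map ?f ?s)) \<in> N" unfolding proj_1 .
  hence "conj_sum (map ?f ?s) \<in> relator_sums" using N_relator_sums by (auto simp del: map_map simp: word_inject)
  hence "- conj_sum (map ?f ?s) \<in> relator_sums" by (rule relator_sums_uminus)
  then obtain t where t: "list_all relator (map snd t)" "- conj_sum (map ?f ?s) = conj_sum (map ?f t)" by (rule relator_sumsE)
  let ?m = "\<lambda>(u, w). (hat u, idx u, eps G w)"
  have mem: "g \<in> carrier G" if "(u, g) \<in> set (zip us gs)" for u g using that gs by (auto dest: set_zip_rightD)
  have sW: "list_all (\<lambda>(u, w). w \<in> Wd) ?s" using mem by (auto simp: list_all_iff)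
  have tW: "list_all (\<lambda>(u, w). w \<in> Wd) t" using t(1) by (auto simp: list_all_iff relator_def)
  have "conj_sum (map ?f (?s @ t)) = 0" using t(2)[symmetric] by simp
  hence "product (map ?m (?s @ t)) = []" using sW tW by (intro product_trivial[OF free rep]) auto
  moreover have "list_all item (map ?m ?s)" "list_all item (map ?m t)"
    using sW tW represents_nf[OF rep] by (auto simp: list_all_iff item_def)
  moreover have "product (map ?m t) = []"
    using t(1) represents_nf[OF rep] by (intro product_relators) (auto simp: list_all_iff relator_def)
  ultimately have "product (map ?m ?s) = []" using fpm_Nil[OF nf_product, of "map ?m ?s"] by (simp add: product_append del: map_map)
  moreover have "map ?m ?s = map (\<lambda>(u, g). (hat u, idx u, g)) (zip us gs)" using mem by auto
  ultimately show ?thesis by (simp only:)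
qed

theorem solvable_in_G:
  assumes "set gs \<subseteq> carrier G" "set xs \<subseteq> carrier H" "length xs = length gs"
    and "conj_prod H xs (map (gamma G Xw) gs) = \<one>\<^bsub>H\<^esub>"
  shows "\<exists>ys. set ys \<subseteq> gamma G Xw ` carrier G \<and> length ys = length gs \<and>
      conj_prod H ys (map (gamma G Xw) gs) = \<one>\<^bsub>H\<^esub>"
    and "length gs \<ge> 1 \<Longrightarrow> reluctant G gs \<Longrightarrow> \<exists>h\<in>carrier H. set xs \<subseteq> h <#\<^bsub>H\<^esub> (gamma G Xw ` carrier G)"
proof -
  obtain R where R: "SC.free R" "SC.Orb R = UNIV" using SC.free_transversal by blast
  have "\<forall>u. \<exists>l r. represents R u l r" using represents_ex R(2) by auto
  then obtain hat idx where rep: "\<And>u. represents R u (hat u) (idx u)" by metis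
  have "\<exists>us. xs = map proj us" using assms(2)
  proof (induction xs)
    case (Cons x xs)
    then obtain us where "xs = map proj us" by auto
    moreover obtain u where "x = proj u" using proj_surj Cons.prems by auto
    ultimately show ?case by (intro exI[of _ "u # us"]) simp
  qed simp
  then obtain us where us: "xs = map proj us" by blast
  have len: "length us = length gs" using us assms(3) by simp
  let ?it = "map (\<lambda>(u, g). (hat u, idx u, g)) (zip us gs)"
  have prod: "product ?it = []"
    using lift_equation[OF R(1) rep assms(1) len] assms(4) us by simp
  have it: "list_all item ?it"
    using assms(1) represents_nf[OF rep] by (auto simp: list_all_iff item_def dest: set_zip_rightD)
  have gs: "map (\<lambda>(l, i, g). g) ?it = gs" using len by (simp add: o_def case_prod_unfold)
  have "\<one> \<in> conj_products gs" using product_trivial_solvable[OF it prod] gs by simp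
  then obtain ys where ys: "set ys \<subseteq> carrier G" "length ys = length gs" "conj_prod G ys gs = \<one>"
    by (auto simp: conj_products_def)
  show "\<exists>ys. set ys \<subseteq> gamma G Xw ` carrier G \<and> length ys = length gs \<and>
      conj_prod H ys (map (gamma G Xw) gs) = \<one>\<^bsub>H\<^esub>"
  proof (intro exI conjI)
    show "set (map (gamma G Xw) ys) \<subseteq> gamma G Xw ` carrier G" using ys by auto
    show "length (map (gamma G Xw) ys) = length gs" using ys by simp
    show "conj_prod H (map (gamma G Xw) ys) (map (gamma G Xw) gs) = \<one>\<^bsub>H\<^esub>"
      using conj_prod_hom[OF gamma_hom ys(1) assms(1)] ys(3) group_hom.hom_one[OF gamma_hom] by simp
  qed
  assume "length gs \<ge> 1" "reluctant G gs"
  then obtain u1 us' g1 gs' where 1: "us = u1 # us'" "gs = g1 # gs'" using len by (cases us; cases gs) auto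
  have rel: "reluctant G (map (\<lambda>(l, i, g). g) ?it)" using \<open>reluctant G gs\<close> gs by simp
  have in1: "(hat u1, idx u1, g1) \<in> set ?it" using 1 by simp
  show "\<exists>h\<in>carrier H. set xs \<subseteq> h <#\<^bsub>H\<^esub> (gamma G Xw ` carrier G)"
  proof (intro bexI subsetI)
    fix x assume "x \<in> set xs"
    then obtain u where u: "u \<in> set us" "x = proj u" using us by auto
    then obtain k where "k < length us" "u = us ! k" by (auto simp: in_set_conv_nth)
    hence "(u, gs ! k) \<in> set (zip us gs)" using len by (auto simp: set_zip)
    hence "(hat u, idx u, gs ! k) \<in> set ?it" by force
    from product_trivial_reluctant[OF it prod rel in1 this]
    obtain h where h: "idx u = idx u1" "h \<in> carrier G" "hat u = fpm (hat u1) (syl (idx u1) h)" by blast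
    have "cong (u1 + be (wd h)) u"
      using represents_cong_eq[OF rep[of u1] _ h(3,2)] rep[of u] h(1) by simp
    hence "x = proj u1 \<otimes>\<^bsub>H\<^esub> gamma G Xw h" using u(2) h(2) proj_cong by (simp add: proj_mult gamma_wd)
    thus "x \<in> proj u1 <#\<^bsub>H\<^esub> (gamma G Xw ` carrier G)" using h(2) by (auto simp: l_coset_def)
  qed simp
qed

end

section \<open>The given family of words\<close>

lemma exponential_infinite: "exponential Ys \<Longrightarrow> infinite Ys"
proof
  assume "exponential Ys" and fin: "finite Ys"
  then obtain C :: nat and c :: real where c: "c > 1" "\<And>i. i \<ge> C \<Longrightarrow> real (card {Y\<in>Ys. length Y \<le> i}) \<ge> c ^ i"
    unfolding exponential_def by blast
  obtain n where n: "real (card Ys) < c ^ n" using real_arch_pow[OF c(1)] by blast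
  have "c ^ n \<le> c ^ (max n C)" using c(1) by (intro power_increasing) auto
  also have "\<dots> \<le> real (card {Y\<in>Ys. length Y \<le> max n C})" using c(2) by simp
  also have "\<dots> \<le> real (card Ys)" using fin by (intro of_nat_mono card_mono) auto
  finally show False using n by simp
qed

text \<open>In a word of length at most 100 even a single letter is long enough for the small overlap condition, so
  all other words of the family avoid a letter; being 7-aperiodic they would be powers below 7 of the other letter.\<close>

lemma long_words:
  assumes "exponential Ys" "\<forall>Y\<in>Ys. positive Y" "small_overlap Ys" "\<forall>Y\<in>Ys. aperiodic 7 Y" "W \<in> Ys"
  shows "100 < length W"
proof (rule ccontr)
  assume "\<not> 100 < length W"
  hence short: "length W \<le> 100" by simp
  have inf: "infinite Ys" using exponential_infinite assms(1) by blast
  have uniq: "U = W" if "sublist V W" "real (length V) \<ge> 0.01 * real (length W)" "U \<in> Ys" "sublist V U" for U V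
    using assms(3,5) that unfolding small_overlap_def by blast
  show False
  proof (cases W)
    case Nil
    hence "Ys \<subseteq> {W}" using uniq[of "[]"] by auto
    thus False using inf finite_subset by blast
  next
    case (Cons l W')
    have "snd l = False" using assms(2,5) Cons by (auto simp: positive_def)
    then obtain x where l: "l = (x, False)" by (cases l) auto
    obtain y :: ab where y: "\<And>z. z \<noteq> x \<Longrightarrow> z = y" by (cases x) (metis ab.exhaust)+
    have "U \<in> (\<lambda>n. replicate n (y, False)) ` {..<7}" if U: "U \<in> Ys" "U \<noteq> W" for U
    proof -
      have "l \<notin> set U"
      proof
        assume "l \<in> set U"
        then obtain a b where "U = a @ [l] @ b" by (auto dest: split_list)
        hence "sublist [l] U" by (auto simp: sublist_def)
        moreover have "W = [] @ [l] @ W'" using Cons by simp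
        hence "sublist [l] W" by (metis sublist_appendI)
        ultimately show False using uniq[of "[l]" U] U short by simp
      qed
      have "m = (y, False)" if m: "m \<in> set U" for m
      proof -
        have "snd m = False" using assms(2) U(1) m by (auto simp: positive_def)
        moreover from this have "fst m \<noteq> x" using \<open>l \<notin> set U\<close> m l by (cases m) auto
        ultimately show ?thesis using y[of "fst m"] by (cases m) simp
      qed
      hence rep: "U = replicate (length U) (y, False)" by (metis replicate_eqI)
      have "length U < 7"
      proof (rule ccontr)
        assume "\<not> length U < 7"
        hence "U = replicate 7 (y, False) @ replicate (length U - 7) (y, False)"
          using rep by (metis le_add_diff_inverse linorder_not_less replicate_add)
        hence "sublist (replicate 7 (y, False)) U" by (metis append_Nil sublist_appendI)
        moreover have "concat (replicate 7 [(y, False)]) = replicate 7 (y, False)" by (simp add: numeral_eq_Suc)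
        ultimately show False using assms(4) U(1) unfolding aperiodic_def by (metis not_Cons_self2)
      qed
      thus ?thesis using rep by blast
    qed
    hence "Ys \<subseteq> insert W ((\<lambda>n. replicate n (y, False)) ` {..<7})" by blast
    thus False using inf finite_subset by blast
  qed
qed

text \<open>Uniqueness of the occurrence of V forces the prefixes in front of it to have the same
  length; the factor 100 states the one percent threshold in integers.\<close>

lemma small_overlap_piece:
  assumes "small_overlap Ys" "W \<in> Ys" "U \<in> Ys" "W = p @ V @ q" "U = p' @ V @ q'" "length W \<le> 100 * length V"
  shows "U = W \<and> p = p'"
proof -
  have "sublist V W" "sublist V U" using assms(4,5) by auto
  moreover have "real (length W) \<le> real (100 * length V)" using assms(6) by (simp only: of_nat_le_iff)
  hence "real (length V) \<ge> 0.01 * real (length W)" by (simp add: power2_eq_square)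
  ultimately have 1: "occurrences V W = 1" and U: "U = W" using assms(1-3) unfolding small_overlap_def by blast+
  let ?I = "{i. i + length V \<le> length W \<and> take (length V) (drop i W) = V}"
  have "length p \<in> ?I" using assms(4) by simp
  moreover have "length p' \<in> ?I" using assms(5) U by simp
  moreover obtain i where "?I = {i}" using 1 unfolding occurrences_def by (rule card_1_singletonE)
  ultimately have "length p = length p'" by (metis (no_types, lifting) singletonD)
  thus ?thesis using U assms(4,5) by simp
qed

theorem theorem4:
  fixes G :: "('g, 'm) monoid_scheme" and len :: "'g \<Rightarrow> nat"
    and Ys :: "abword set" and d :: real and Xw :: "'g \<Rightarrow> abword"
  assumes "group G"
    and "length_function G len"
    and "exponential Ys"
    and "\<forall>Y\<in>Ys. positive Y"
    and "small_overlap Ys"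
    and "\<forall>Y\<in>Ys. aperiodic 7 Y"
    and "inj_on Xw (carrier G - {\<one>\<^bsub>G\<^esub>})"
    and "\<forall>g\<in>carrier G - {\<one>\<^bsub>G\<^esub>}. Xw g \<in> Ys \<and> len g \<le> length (Xw g)
                                     \<and> real (length (Xw g)) < d * real (len g)"
  shows "(\<forall>gs xs. set gs \<subseteq> carrier G \<and> set xs \<subseteq> carrier (Hgrp G Xw) \<and> length xs = length gs \<and>
              conj_prod (Hgrp G Xw) xs (map (gamma G Xw) gs) = \<one>\<^bsub>Hgrp G Xw\<^esub> \<longrightarrow>
           (\<exists>ys. set ys \<subseteq> gamma G Xw ` carrier G \<and> length ys = length gs \<and>
              conj_prod (Hgrp G Xw) ys (map (gamma G Xw) gs) = \<one>\<^bsub>Hgrp G Xw\<^esub>))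
       \<and> (\<forall>gs xs. length gs \<ge> 1 \<and> set gs \<subseteq> carrier G \<and> reluctant G gs \<and>
              set xs \<subseteq> carrier (Hgrp G Xw) \<and> length xs = length gs \<and>
              conj_prod (Hgrp G Xw) xs (map (gamma G Xw) gs) = \<one>\<^bsub>Hgrp G Xw\<^esub> \<longrightarrow>
           (\<exists>h\<in>carrier (Hgrp G Xw). set xs \<subseteq> h <#\<^bsub>Hgrp G Xw\<^esub> (gamma G Xw ` carrier G)))"
proof -
  let ?S = "carrier G - {\<one>\<^bsub>G\<^esub>}"
  have Ys: "Xw g \<in> Ys" if "g \<in> ?S" for g using assms(8) that by blast
  have red: "reduced (Xw g)" if "g \<in> ?S" for g using assms(6) Ys[OF that] by (auto simp: aperiodic_def)
  have word: "word (Fg (Xw g)) = Xw g" if "g \<in> ?S" for g using red[OF that] by (simp add: Fg_inverse)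
  have "small_cancellation ?S (\<lambda>g. Fg (Xw g))"
  proof
    fix g l assume g: "g \<in> ?S" and "l \<in> set (word (Fg (Xw g)))"
    thus "\<not> snd l" using assms(4) Ys[OF g] word[OF g] by (auto simp: positive_def)
  next
    fix g assume g: "g \<in> ?S"
    show "98 \<le> nrm (Fg (Xw g))"
      using long_words[OF assms(3-6) Ys[OF g]] word[OF g] by (simp add: nrm_def)
  next
    fix g h p V q p' q'
    assume gh: "g \<in> ?S" "h \<in> ?S" and V: "word (Fg (Xw g)) = p @ V @ q" "word (Fg (Xw h)) = p' @ V @ q'"
      "nrm (Fg (Xw g)) \<le> 100 * length V"
    have "Xw h = Xw g \<and> p = p'"
      using small_overlap_piece[OF assms(5) Ys[OF gh(1)] Ys[OF gh(2)], of p V q p' q'] V word gh by (simp add: nrm_def)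
    thus "g = h \<and> p = p'" using assms(7) gh by (auto dest: inj_onD)
  qed
  then interpret sc_embedding G Xw
    using assms(1) red by (auto simp: sc_embedding_def sc_embedding_axioms_def)
  show ?thesis using solvable_in_G by blast
qed

end
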